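(* Let $p$ be a prime, $N=2m=2m_1\cdots m_r$ where $p_1,\dots,p_r$ are distinct odd primes, $u_i\ge1$, $m_i=p_i^{u_i}$, let $f_i=\mathrm{ord}_{m_i}(p)$ and $f=\mathrm{ord}_N(p)$. Assume all $f_i$ are odd and $\gcd(f_1,f_i)=1$ for all $i\in\{2,\dots,r\}$. If $\phi(m_1)/f_1=2$, $2\in\langle p\rangle\pmod{m_1}$, $-2\in\langle p\rangle\pmod{m/m_1}$ and $p_1\in\langle p\rangle\pmod{m/m_1}$, then $(N,f,p)\in\mathcal{P}^\ast$ and $(N,f,p)$ has property $(\star)$.
   Context: For $n\mid p^f-1$ and $\eta_n$ a multiplicative character of order $n$ of $\mathbb{F}_{p^f}$, the Gauss sum is $G_{p^f}(\eta_n)=\sum_{x\in\mathbb{F}_{p^f}^\ast}\zeta_p^{\mathrm{Tr}_{p^f/p}(x)}\eta_n(x)$ with $\zeta_k=\exp(2\pi i/k)$; it is pure if $p^{-f/2}G_{p^f}(\eta_n)$ is a root of unity (independent of the choice of $\eta_n$). $\mathcal{P}$ is the set of triples $(n,f,p)$, $n\mid p^f-1$, for which it is pure; $\mathcal{P}^\ast=\{(n,f,p)\in\mathcal{P}:\mathrm{ord}_n(p)=f\}$. Property $(\star)$: $(2\prod_{i\in J}m_i,f,p)\in\mathcal{P}$ for every $J\subseteq\{1,\dots,r\}$ with $1\in J$. $\phi$ is Euler's totient function; $\langle p\rangle\pmod n$ is the subgroup of $(\mathbb{Z}/n\mathbb{Z})^\times$ generated by $p$. *)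

theory Defs
  imports
    "HOL-Complex_Analysis.Complex_Analysis"
    "HOL-Number_Theory.Number_Theory"
    "HOL-Algebra.Algebra"
begin

definition zeta :: "nat \<Rightarrow> complex" where
  "zeta k = exp (2 * of_real pi * \<i> / of_nat k)"

(* The field trace of F_(p^f) over its prime field as the sum of the Galois conjugates of x. *)
definition abs_trace :: "('a, 'b) ring_scheme \<Rightarrow> nat \<Rightarrow> nat \<Rightarrow> 'a \<Rightarrow> 'a" where
  "abs_trace R p f x = (\<Oplus>\<^bsub>R\<^esub>i\<in>{..<f}. x [^]\<^bsub>R\<^esub> (p ^ i))"

(* The trace lies in the prime field {k . 1 | 0 <= k < p}; this is its representative k,
   so that zeta p ^ trace_rep R p f x is the value of the canonical additive character at x. *)
definition trace_rep :: "('a, 'b) ring_scheme \<Rightarrow> nat \<Rightarrow> nat \<Rightarrow> 'a \<Rightarrow> nat" where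
  "trace_rep R p f x = (THE k. k < p \<and> add_pow R k \<one>\<^bsub>R\<^esub> = abs_trace R p f x)"

(* Only the values of eta on the nonzero elements matter, here and below. *)
definition mult_character :: "('a, 'b) ring_scheme \<Rightarrow> ('a \<Rightarrow> complex) \<Rightarrow> bool" where
  "mult_character R \<eta> \<longleftrightarrow>
     (\<forall>x\<in>carrier R - {\<zero>\<^bsub>R\<^esub>}. \<eta> x \<noteq> 0) \<and>
     (\<forall>x\<in>carrier R - {\<zero>\<^bsub>R\<^esub>}. \<forall>y\<in>carrier R - {\<zero>\<^bsub>R\<^esub>}. \<eta> (x \<otimes>\<^bsub>R\<^esub> y) = \<eta> x * \<eta> y)"

definition character_order :: "('a, 'b) ring_scheme \<Rightarrow> ('a \<Rightarrow> complex) \<Rightarrow> nat" where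
  "character_order R \<eta> = (LEAST k. k > 0 \<and> (\<forall>x\<in>carrier R - {\<zero>\<^bsub>R\<^esub>}. \<eta> x ^ k = 1))"

definition gauss_sum ::
    "('a, 'b) ring_scheme \<Rightarrow> nat \<Rightarrow> nat \<Rightarrow> ('a \<Rightarrow> complex) \<Rightarrow> complex" where
  "gauss_sum R p f \<eta> = (\<Sum>x\<in>carrier R - {\<zero>\<^bsub>R\<^esub>}. zeta p ^ trace_rep R p f x * \<eta> x)"

definition root_of_unity :: "complex \<Rightarrow> bool" where
  "root_of_unity z \<longleftrightarrow> (\<exists>k>0. z ^ k = 1)"

definition pure_gauss_sum ::
    "('a, 'b) ring_scheme \<Rightarrow> nat \<Rightarrow> nat \<Rightarrow> ('a \<Rightarrow> complex) \<Rightarrow> bool" where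
  "pure_gauss_sum R p f \<eta> \<longleftrightarrow>
     root_of_unity (of_real (real p powr (- real f / 2)) * gauss_sum R p f \<eta>)"

(* Purity depends neither on the model R of F_(p^f) nor on the character of order n, so it is
   required of all of them.  Every finite field has a copy with carrier in nat, and characters
   of order n exist because n dvd p ^ f - 1, so the inner quantifiers are never vacuous. *)
definition pure_triples :: "(nat \<times> nat \<times> nat) set" where
  "pure_triples = {(n, f, p). Factorial_Ring.prime p \<and> f > 0 \<and> n dvd p ^ f - 1 \<and>
     (\<forall>(R :: nat ring) \<eta>. field R \<longrightarrow> finite (carrier R) \<longrightarrow> card (carrier R) = p ^ f \<longrightarrow>
        mult_character R \<eta> \<longrightarrow> character_order R \<eta> = n \<longrightarrow> pure_gauss_sum R p f \<eta>)}"

definition pure_triples_star :: "(nat \<times> nat \<times> nat) set" where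
  "pure_triples_star = {(n, f, p). (n, f, p) \<in> pure_triples \<and> ord n p = f}"

(* Property (star) of (2 * m 1 * ... * m r, f, p); it refers to the chosen numbering of
   the prime power factors m i, in which m 1 is distinguished. *)
definition star_property :: "nat \<Rightarrow> (nat \<Rightarrow> nat) \<Rightarrow> nat \<Rightarrow> nat \<Rightarrow> bool" where
  "star_property r m f p \<longleftrightarrow>
     (\<forall>J. J \<subseteq> {1..r} \<longrightarrow> 1 \<in> J \<longrightarrow> (2 * (\<Prod>i\<in>J. m i), f, p) \<in> pure_triples)"

(* a mod n lies in the subgroup of the units of Z/n generated by p (for p coprime to n);
   nonnegative exponents suffice since the group is finite.  For n = 1 it always holds. *)
definition in_powers_mod :: "int \<Rightarrow> nat \<Rightarrow> nat \<Rightarrow> bool" where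
  "in_powers_mod a p n \<longleftrightarrow> (\<exists>k::nat. [a = int p ^ k] (mod int n))"

end

theory Submission
  imports Defs
begin

text \<open>
  Fix a subring \<open>V\<close> of the complex numbers that is maximal among those not containing \<open>1/p\<close>. It is a
  valuation ring, its residue field contains a copy of the field with \<open>p ^ f\<close> elements, and
  \<open>V \<inter> \<int>[1/p] = \<int>\<close>. Write \<open>\<omega>\<close> for the inverse of the Teichmueller character with respect to \<open>V\<close>
  and \<open>\<pi> = \<epsilon> - 1\<close> with \<open>\<epsilon>\<close> a primitive \<open>p\<close>-th root of unity. Integrality of Jacobi sums makes the
  valuation of the Gauss sum \<open>G a\<close> of \<open>\<omega> ^ a\<close> subadditive in \<open>a\<close>, and \<open>G (p ^ i) = G 1\<close> has the valuation
  of \<open>\<pi>\<close>; so \<open>v(G a) \<le> s(a) v(\<pi>)\<close>, where \<open>s(a)\<close> is the base-\<open>p\<close> digit sum. If \<open>s(a) = f (p - 1) / 2\<close> for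
  all \<open>a = b (p ^ f - 1) / n\<close> with \<open>b\<close> prime to \<open>n\<close>, then with \<open>G a * G (-a) = \<plusminus> p ^ f\<close> all numbers
  \<open>G a\<^sup>2 / p ^ f\<close> lie in \<open>V\<close> and on the unit circle, and a Kronecker type argument shows that they
  are roots of unity.

  The condition on the digit sums says that \<open>B(b / n) = 0\<close> for \<open>B(x) = \<Sum>j<f. {p ^ j x} - 1/2\<close>. This
  function is odd, invariant under \<open>x \<mapsto> p x\<close>, and satisfies \<open>\<Sum>i<l. B(x + i/l) = B(l x)\<close>. For
  \<open>n = 2 m\<^sub>1 M'\<close> the relation with \<open>l = 2\<close> reduces the claim to \<open>B(2 y) = B(y)\<close> for \<open>y = y\<^sub>1 + y'\<close> with denominators
  \<open>m\<^sub>1\<close> and \<open>M'\<close>. As the two orders are coprime, \<open>y\<^sub>1\<close> and \<open>y'\<close> can be multiplied by powers of \<open>p\<close>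
  independently, so \<open>B(2 y) = B(y\<^sub>1 - y') = - B(- y\<^sub>1 + y')\<close>. Finally the relations with \<open>l = m\<^sub>1\<close> and
  \<open>l = m\<^sub>1 / p\<^sub>1\<close> give \<open>\<Sum> B(c / m\<^sub>1 + y') = 0\<close> over the units \<open>c\<close> modulo \<open>m\<^sub>1\<close>; the index being 2,
  this says \<open>B(y\<^sub>1 + y') + B(- y\<^sub>1 + y') = 0\<close>.
\<close>

hide_const (open) up_ring.coeff up_ring.monom module.smult Polynomials.degree

section \<open>A valuation ring of the complex numbers above a prime\<close>

text \<open>By \<open>total_V\<close> the set \<open>V\<close> is a valuation ring with fraction
  field the complex numbers, and by \<open>inv_p_notin\<close> its maximal ideal lies above
  \<open>p\<close>. Roots of unity and Gauss sums are elements of \<open>V\<close> directly, so no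
  number field or completion has to be built.\<close>

locale val_ring =
  fixes p :: nat and V :: "complex set"
  assumes prime_p: "Factorial_Ring.prime p"
    and one_V: "1 \<in> V"
    and diff_V: "x \<in> V \<Longrightarrow> y \<in> V \<Longrightarrow> x - y \<in> V"
    and mult_V: "x \<in> V \<Longrightarrow> y \<in> V \<Longrightarrow> x * y \<in> V"
    and total_V: "x \<in> V \<or> inverse x \<in> V"
    and inv_p_notin: "inverse (of_nat p) \<notin> V"

definition subring_avoiding :: "complex \<Rightarrow> complex set \<Rightarrow> bool" where
  "subring_avoiding c V \<longleftrightarrow> 1 \<in> V \<and> (\<forall>x\<in>V. \<forall>y\<in>V. x - y \<in> V \<and> x * y \<in> V) \<and> c \<notin> V"

lemma subring_avoiding_closed:
  assumes "subring_avoiding c V"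
  shows "1 \<in> V" "0 \<in> V" "x \<in> V \<Longrightarrow> y \<in> V \<Longrightarrow> x - y \<in> V" "x \<in> V \<Longrightarrow> y \<in> V \<Longrightarrow> x * y \<in> V"
    "x \<in> V \<Longrightarrow> - x \<in> V" "x \<in> V \<Longrightarrow> y \<in> V \<Longrightarrow> x + y \<in> V"
proof -
  have *: "1 \<in> V" "\<And>x y. x \<in> V \<Longrightarrow> y \<in> V \<Longrightarrow> x - y \<in> V" "\<And>x y. x \<in> V \<Longrightarrow> y \<in> V \<Longrightarrow> x * y \<in> V"
    using assms unfolding subring_avoiding_def by auto
  show o: "1 \<in> V" by (rule *(1))
  show z: "0 \<in> V" using *(2)[OF o o] by simp
  show "x \<in> V \<Longrightarrow> y \<in> V \<Longrightarrow> x - y \<in> V" "x \<in> V \<Longrightarrow> y \<in> V \<Longrightarrow> x * y \<in> V" using * by auto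
  show n: "- x \<in> V" if "x \<in> V" for x using *(2)[OF z that] by simp
  show "x \<in> V \<Longrightarrow> y \<in> V \<Longrightarrow> x + y \<in> V" using *(2)[of x "- y"] n[of y] by auto
qed

lemma subring_avoiding_sum:
  assumes "subring_avoiding c V" "\<And>x. x \<in> A \<Longrightarrow> h x \<in> V"
  shows "sum h A \<in> V"
  using assms(2)
  by (induction A rule: infinite_finite_induct)
     (auto intro: subring_avoiding_closed(2,6)[OF assms(1)])

lemma subring_avoiding_power:
  assumes "subring_avoiding c V" "x \<in> V"
  shows "x ^ n \<in> V"
  by (induction n) (auto intro: subring_avoiding_closed(1,4)[OF assms(1)] assms(2))

text \<open>The values at \<open>y\<close> of the polynomials over \<open>V\<close> form a subring
  that contains \<open>V\<close> and \<open>y\<close>. It is strictly larger than \<open>V\<close>,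
  so by maximality it no longer avoids \<open>c\<close>.\<close>

lemma maximal_subring_adjoin:
  assumes V: "subring_avoiding c V" and max: "\<And>W. subring_avoiding c W \<Longrightarrow> V \<subseteq> W \<Longrightarrow> W = V"
    and y: "y \<notin> V"
  shows "\<exists>P. (\<forall>i. coeff P i \<in> V) \<and> poly P y = c"
proof (rule ccontr)
  assume no: "\<not> ?thesis"
  note cl = subring_avoiding_closed[OF V]
  define W where "W = {poly P y | P. \<forall>i. coeff P i \<in> V}"
  have "V \<subseteq> W"
  proof
    fix v assume v: "v \<in> V"
    have "\<forall>i. coeff [:v:] i \<in> V" using v cl(2) by (auto simp: coeff_pCons split: nat.split)
    moreover have "v = poly [:v:] y" by simp
    ultimately show "v \<in> W" unfolding W_def by blast
  qed
  moreover have "subring_avoiding c W"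
    unfolding subring_avoiding_def
  proof (intro conjI ballI)
    show "1 \<in> W" using \<open>V \<subseteq> W\<close> cl(1) by auto
    show "c \<notin> W" using no unfolding W_def by blast
  next
    fix a b assume "a \<in> W" "b \<in> W"
    then obtain P Q where PQ: "\<forall>i. coeff P i \<in> V" "\<forall>i. coeff Q i \<in> V" "a = poly P y" "b = poly Q y"
      unfolding W_def by blast
    have "\<forall>i. coeff (P - Q) i \<in> V" "a - b = poly (P - Q) y" using PQ cl by auto
    thus "a - b \<in> W" unfolding W_def by blast
    have "\<forall>i. coeff (P * Q) i \<in> V" unfolding coeff_mult
      using PQ cl by (auto intro!: subring_avoiding_sum[OF V])
    moreover have "a * b = poly (P * Q) y" using PQ by auto
    ultimately show "a * b \<in> W" unfolding W_def by blast
  qed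
  ultimately have "W = V" using max by blast
  moreover have "y \<in> W"
  proof -
    have "\<forall>i. coeff [:0, 1:] i \<in> V" using cl(1,2) by (auto simp: coeff_pCons split: nat.split)
    moreover have "y = poly [:0, 1:] y" by simp
    ultimately show ?thesis unfolding W_def by blast
  qed
  ultimately show False using y by blast
qed

text \<open>Otherwise \<open>inverse c\<close> is a polynomial in the inverse of
  \<open>d = 1 - c * a\<close>. Clearing denominators puts some \<open>inverse c * d ^ n\<close>
  into \<open>V\<close>, and \<open>inverse c * d = inverse c - a\<close> lets the powers of
  \<open>d\<close> be stripped one at a time until \<open>inverse c\<close> itself is in
  \<open>V\<close>.\<close>

lemma maximal_subring_unit:
  assumes V: "subring_avoiding (inverse c) V" and max: "\<And>W. subring_avoiding (inverse c) W \<Longrightarrow> V \<subseteq> W \<Longrightarrow> W = V"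
    and c: "c \<noteq> 0" "c \<in> V" and a: "a \<in> V"
  shows "1 - c * a \<noteq> 0" "inverse (1 - c * a) \<in> V"
proof -
  note cl = subring_avoiding_closed[OF V]
  have cV: "inverse c \<notin> V" using V by (simp add: subring_avoiding_def)
  show nz: "1 - c * a \<noteq> 0"
  proof
    assume "1 - c * a = 0"
    hence "a = inverse c" using c by (simp add: field_simps)
    thus False using a cV by simp
  qed
  show "inverse (1 - c * a) \<in> V"
  proof (rule ccontr)
    assume "inverse (1 - c * a) \<notin> V"
    from maximal_subring_adjoin[OF V max this] obtain P
      where P: "\<And>i. coeff P i \<in> V" "poly P (inverse (1 - c * a)) = inverse c" by blast
    define d where "d = 1 - c * a"
    have dV: "d \<in> V" unfolding d_def using cl a c by auto
    have "inverse c * d ^ degree P = (\<Sum>i\<le>degree P. coeff P i * d ^ (degree P - i))"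
    proof -
      have "inverse c * d ^ degree P = (\<Sum>i\<le>degree P. coeff P i * inverse d ^ i * d ^ degree P)"
        using P(2)[folded d_def] unfolding poly_altdef
        by (metis (no_types) sum_distrib_right)
      also have "\<dots> = (\<Sum>i\<le>degree P. coeff P i * d ^ (degree P - i))"
        using nz unfolding d_def[symmetric]
        by (intro sum.cong refl) (simp add: power_diff power_inverse field_simps)
      finally show ?thesis .
    qed
    hence dn: "inverse c * d ^ degree P \<in> V"
      using P(1) dV by (auto intro!: subring_avoiding_sum[OF V] cl(4) subring_avoiding_power[OF V])
    have "inverse c * d ^ n \<in> V \<Longrightarrow> inverse c \<in> V" for n
    proof (induction n)
      case (Suc n)
      have "inverse c * d ^ Suc n = inverse c * d ^ n - a * d ^ n"
        using c(1) by (simp add: d_def field_simps)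
      hence "inverse c * d ^ n = inverse c * d ^ Suc n + a * d ^ n" by simp
      also have "\<dots> \<in> V" using Suc(2) a dV by (auto intro!: cl subring_avoiding_power[OF V])
      finally show ?case using Suc(1) by simp
    qed simp
    thus False using dn cV by blast
  qed
qed

text \<open>If \<open>x\<close> and \<open>inverse x\<close> were both missing,
  \<open>inverse c\<close> would be a polynomial in each of them. The relation of smaller degree
  lowers the degree of the other one, and induction on the sum of the degrees ends in a
  contradiction.\<close>

lemma maximal_subring_total:
  assumes V: "subring_avoiding (inverse c) V" and max: "\<And>W. subring_avoiding (inverse c) W \<Longrightarrow> V \<subseteq> W \<Longrightarrow> W = V"
    and c: "c \<noteq> 0" "c \<in> V"
  shows "x \<in> V \<or> inverse x \<in> V"
proof (rule ccontr)
  assume "\<not> ?thesis"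
  hence x: "x \<notin> V" "inverse x \<notin> V" by auto
  note cl = subring_avoiding_closed[OF V]
  have cV: "inverse c \<notin> V" using V by (simp add: subring_avoiding_def)
  have False if "\<And>i. coeff P i \<in> V" "\<And>i. coeff Q i \<in> V" "poly P y = inverse c"
    "poly Q (inverse y) = inverse c" "y \<noteq> 0" "degree P + degree Q = k" for P Q y k
    using that
  proof (induction k arbitrary: P Q y rule: less_induct)
    case (less k P Q y)
    \<comment> \<open>Swapping \<open>P\<close> with \<open>Q\<close> and \<open>y\<close> with
      \<open>inverse y\<close> preserves the situation, so the degree of \<open>Q\<close> may be
      taken not to exceed that of \<open>P\<close>.\<close>
    have wlog: False if P: "\<And>i. coeff P i \<in> V" and Q: "\<And>i. coeff Q i \<in> V" and Py: "poly P y = inverse c"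
      and Qy: "poly Q (inverse y) = inverse c" and y: "y \<noteq> 0" and k: "degree P + degree Q = k"
      and le: "degree Q \<le> degree P" for P Q y
    proof -
      define n where "n = degree P"
      define d where "d = degree Q"
      have d0: "d > 0"
      proof (rule ccontr)
        assume "\<not> d > 0"
        then obtain b where "Q = [:b:]" using degree_eq_zeroE[of Q] by (auto simp: d_def)
        hence "inverse c = b" "coeff Q 0 = b" using Qy by auto
        thus False using Q[of 0] cV by auto
      qed
      have n0: "n > 0" using d0 le by (simp add: n_def d_def)
      define b where "b = coeff Q"
      \<comment> \<open>As \<open>1 - c * b 0\<close> is a unit, the relation for \<open>Q\<close>
        becomes \<open>1 = w * c * (\<Sum>j=1..d. b j * inverse y ^ j)\<close>. Multiplying the
        leading term of \<open>P\<close> by this 1 replaces it by terms of lower degree.\<close>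
      define w where "w = inverse (1 - c * b 0)"
      have w: "1 - c * b 0 \<noteq> 0" "w \<in> V"
        using maximal_subring_unit[OF V max c, of "b 0"] Q by (auto simp: w_def b_def)
      define a where "a = coeff P n"
      define P' where "P' = P - monom a n + (\<Sum>j=1..d. monom (a * w * c * b j) (n - j))"
      have "coeff P' i \<in> V" for i
        unfolding P'_def coeff_add coeff_diff coeff_sum coeff_monom
        using P Q w c cl by (auto intro!: cl subring_avoiding_sum[OF V] simp: a_def b_def)
      moreover have "poly P' y = inverse c"
      proof -
        have "inverse c = (\<Sum>j\<le>d. b j * inverse y ^ j)"
          using Qy unfolding poly_altdef b_def d_def by simp
        also have "\<dots> = b 0 + (\<Sum>j=1..d. b j * inverse y ^ j)"
          by (simp add: sum.atMost_shift sum.atLeast1_atMost_eq)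
        finally have "1 = c * b 0 + c * (\<Sum>j=1..d. b j * inverse y ^ j)"
          using c by (metis distrib_left right_inverse)
        hence "w * (1 - c * b 0) = w * (c * (\<Sum>j=1..d. b j * inverse y ^ j))"
          by (intro arg_cong[of _ _ "(*) w"]) (metis add_diff_cancel_left')
        hence one: "1 = w * c * (\<Sum>j=1..d. b j * inverse y ^ j)"
          using w by (metis left_inverse mult.assoc w_def)
        have "a * y ^ n = a * y ^ n * (w * c * (\<Sum>j=1..d. b j * inverse y ^ j))" using one by simp
        also have "\<dots> = (\<Sum>j=1..d. a * w * c * b j * y ^ (n - j))"
          unfolding sum_distrib_left
        proof (intro sum.cong refl)
          fix j assume "j \<in> {1..d}"
          hence "j \<le> n" using le by (simp add: n_def d_def)
          thus "a * y ^ n * (w * c * (b j * inverse y ^ j)) = a * w * c * b j * y ^ (n - j)"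
            using y by (simp add: power_diff power_inverse field_simps)
        qed
        finally show ?thesis unfolding P'_def using Py by (simp add: poly_sum poly_monom)
      qed
      moreover have "degree P' < n"
      proof -
        have "degree P' \<le> n - 1"
        proof (rule degree_le, intro allI impI)
          fix i assume "n - 1 < i"
          hence i: "i \<ge> n" using n0 by simp
          have "coeff (P - monom a n) i = 0"
            using i by (cases "i = n") (auto simp: a_def n_def coeff_eq_0)
          moreover have "(\<Sum>j=1..d. coeff (monom (a * w * c * b j) (n - j)) i) = 0"
            using i n0 by (intro sum.neutral ballI) auto
          ultimately show "coeff P' i = 0" unfolding P'_def coeff_add coeff_sum by simp
        qed
        thus ?thesis using n0 by simp
      qed
      ultimately show False using less.IH[of "degree P' + degree Q" P' Q y] Q Qy y k by (simp add: n_def)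
    qed
    show False
    proof (cases "degree Q \<le> degree P")
      case True
      thus ?thesis using wlog[of P Q y] less.prems by auto
    next
      case False
      thus ?thesis using wlog[of Q P "inverse y"] less.prems by auto
    qed
  qed
  moreover have "x \<noteq> 0" using x cl(2) by auto
  moreover obtain P where "\<forall>i. coeff P i \<in> V" "poly P x = inverse c"
    using maximal_subring_adjoin[OF V max x(1)] by blast
  moreover obtain Q where "\<forall>i. coeff Q i \<in> V" "poly Q (inverse x) = inverse c"
    using maximal_subring_adjoin[OF V max x(2)] by blast
  ultimately show False by blast
qed

text \<open>Zorn's lemma applies because the integers avoid the inverse of \<open>p\<close> and the
  union of a chain of such subrings is again one.\<close>

lemma val_ring_exists:
  assumes p: "Factorial_Ring.prime p"
  shows "\<exists>V. val_ring p V"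
proof -
  let ?c = "of_nat p :: complex"
  have c0: "?c \<noteq> 0" using p by (simp add: prime_gt_0_nat)
  have "subring_avoiding (inverse ?c) \<int>"
  proof -
    have "inverse ?c \<notin> \<int>"
    proof
      assume "inverse ?c \<in> \<int>"
      then obtain k where "inverse ?c = of_int k" by (auto elim: Ints_cases)
      hence "of_int (int p * k) = (of_int 1 :: complex)" using c0 by (simp add: field_simps)
      hence "int p * k = 1" by (simp only: of_int_eq_iff)
      hence "int p dvd 1" by (metis dvd_triv_left)
      thus False using p by (simp add: not_prime_unit)
    qed
    thus ?thesis by (auto simp: subring_avoiding_def)
  qed
  hence "\<exists>M\<in>Collect (subring_avoiding (inverse ?c)). \<forall>W\<in>Collect (subring_avoiding (inverse ?c)). M \<subseteq> W \<longrightarrow> W = M"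
  proof (intro subset_Zorn_nonempty)
    fix \<C> assume C: "\<C> \<noteq> {}" "subset.chain (Collect (subring_avoiding (inverse ?c))) \<C>"
    hence sub: "\<And>A. A \<in> \<C> \<Longrightarrow> subring_avoiding (inverse ?c) A"
      and ch: "\<And>A B. A \<in> \<C> \<Longrightarrow> B \<in> \<C> \<Longrightarrow> A \<subseteq> B \<or> B \<subseteq> A"
      unfolding subset_chain_def by auto
    have "x - y \<in> \<Union>\<C> \<and> x * y \<in> \<Union>\<C>" if xy: "x \<in> \<Union>\<C>" "y \<in> \<Union>\<C>" for x y
    proof -
      obtain A B where "A \<in> \<C>" "B \<in> \<C>" "x \<in> A" "y \<in> B" using xy by blast
      with ch[of A B] obtain D where D: "D \<in> \<C>" "x \<in> D" "y \<in> D" by blast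
      with subring_avoiding_closed(3,4)[OF sub[OF D(1)]] show ?thesis by blast
    qed
    moreover have "1 \<in> \<Union>\<C>" using C(1) subring_avoiding_closed(1)[OF sub] by blast
    moreover have "inverse ?c \<notin> \<Union>\<C>" using sub unfolding subring_avoiding_def by blast
    ultimately show "\<Union>\<C> \<in> (Collect (subring_avoiding (inverse ?c)))" unfolding subring_avoiding_def by blast
  qed blast
  then obtain V where V: "subring_avoiding (inverse ?c) V"
    and max: "\<And>W. subring_avoiding (inverse ?c) W \<Longrightarrow> V \<subseteq> W \<Longrightarrow> W = V" by blast
  have nat: "of_nat n \<in> V" for n by (induction n) (auto intro: subring_avoiding_closed[OF V])
  have "val_ring p V"
    using V maximal_subring_total[OF V max c0 nat] p
    unfolding val_ring_def subring_avoiding_def by blast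
  thus ?thesis by blast
qed

section \<open>The maximal ideal of the valuation ring\<close>

context val_ring
begin

text \<open>The nonunits of \<open>V\<close>. Zero is listed separately because
  \<open>inverse 0 = 0\<close> lies in \<open>V\<close>.\<close>

definition mx :: "complex set" where "mx = {x \<in> V. x = 0 \<or> inverse x \<notin> V}"

lemma p_gt_1: "p > 1" using prime_p by (rule prime_gt_1_nat)

lemma zero_V: "0 \<in> V" using diff_V[OF one_V one_V] by simp
lemma uminus_V: "x \<in> V \<Longrightarrow> - x \<in> V" using diff_V[OF zero_V] by fastforce
lemma add_V: "x \<in> V \<Longrightarrow> y \<in> V \<Longrightarrow> x + y \<in> V" using diff_V[OF _ uminus_V] by fastforce
lemma sum_V: "(\<And>i. i \<in> I \<Longrightarrow> h i \<in> V) \<Longrightarrow> sum h I \<in> V"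
  by (induction I rule: infinite_finite_induct) (auto intro: add_V zero_V)
lemma power_V: "x \<in> V \<Longrightarrow> x ^ n \<in> V"
  by (induction n) (auto intro: mult_V one_V)
lemma of_nat_V: "of_nat n \<in> V"
  by (induction n) (auto intro: add_V zero_V one_V)
lemma of_int_V: "of_int n \<in> V"
  by (cases n) (auto intro: of_nat_V uminus_V simp: uminus_V[OF of_nat_V[of "Suc _"]] simp del: of_nat_Suc)

text \<open>Here \<open>x\<close> is a power of \<open>inverse x\<close>, so it lies in
  \<open>V\<close> whichever of the two does.\<close>

lemma root_of_unity_V: assumes "x ^ k = 1" "k > 0" shows "x \<in> V"
proof (rule ccontr)
  assume "x \<notin> V"
  hence "inverse x ^ (k - 1) \<in> V" using total_V power_V by blast
  moreover have "inverse x ^ (k - 1) = x"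
  proof -
    have "x \<noteq> 0" using assms by (auto simp: power_0_left split: if_splits)
    moreover have "x * x ^ (k - 1) = 1" using assms by (metis power_eq_if less_numeral_extra(3))
    ultimately show ?thesis by (simp add: power_inverse field_simps)
  qed
  ultimately show False using \<open>x \<notin> V\<close> by simp
qed

lemma mx_V: "x \<in> mx \<Longrightarrow> x \<in> V" by (simp add: mx_def)
lemma zero_mx: "0 \<in> mx" by (simp add: mx_def zero_V)
lemma one_notin_mx: "1 \<notin> mx" by (simp add: mx_def one_V)

lemma mult_mx: assumes "x \<in> mx" "y \<in> V" shows "x * y \<in> mx"
proof (cases "x * y = 0")
  case False
  have "inverse (x * y) \<notin> V"
  proof
    assume "inverse (x * y) \<in> V"
    hence "y * inverse (x * y) \<in> V" using assms mult_V by blast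
    moreover have "y * inverse (x * y) = inverse x" using False by (simp add: field_simps)
    ultimately have "inverse x \<in> V" by metis
    thus False using assms False by (simp add: mx_def)
  qed
  thus ?thesis using assms by (simp add: mx_def mult_V)
next
  case True
  thus ?thesis by (simp only: True zero_mx)
qed

lemma mult_mx': "x \<in> V \<Longrightarrow> y \<in> mx \<Longrightarrow> x * y \<in> mx"
  using mult_mx[of y x] by (simp add: mult.commute)

lemma add_mx: assumes "x \<in> mx" "y \<in> mx" shows "x + y \<in> mx"
proof -
  have *: "x + y \<in> mx" if "x \<in> mx" "y \<in> mx" "x \<noteq> 0" "y / x \<in> V" for x y
  proof -
    have "x + y = x * (1 + y / x)" using that by (simp add: field_simps)
    thus ?thesis using mult_mx[OF that(1) add_V[OF one_V that(4)]] by simp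
  qed
  show ?thesis
  proof (cases "x = 0 \<or> y = 0")
    case False
    have "y / x \<in> V \<or> x / y \<in> V" using total_V[of "y / x"] by (simp add: field_simps)
    thus ?thesis using *[of x y] *[of y x] assms False by (auto simp: add.commute)
  qed (use assms in auto)
qed

lemma uminus_mx: "x \<in> mx \<Longrightarrow> - x \<in> mx"
  using mult_mx[OF _ uminus_V[OF one_V]] by fastforce
lemma diff_mx: "x \<in> mx \<Longrightarrow> y \<in> mx \<Longrightarrow> x - y \<in> mx"
  using add_mx[OF _ uminus_mx] by fastforce
lemma sum_mx: "(\<And>i. i \<in> I \<Longrightarrow> h i \<in> mx) \<Longrightarrow> sum h I \<in> mx"
  by (induction I rule: infinite_finite_induct) (auto intro: add_mx zero_mx)

lemma inverse_V: "x \<in> V \<Longrightarrow> x \<notin> mx \<Longrightarrow> inverse x \<in> V"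
  by (auto simp: mx_def)

lemma prime_mx: assumes "x * y \<in> mx" "x \<in> V" "y \<in> V" shows "x \<in> mx \<or> y \<in> mx"
proof (rule ccontr)
  assume "\<not> ?thesis"
  hence "inverse x \<in> V" "x \<noteq> 0" "y \<notin> mx" using assms by (auto simp: mx_def)
  moreover have "y = (x * y) * inverse x" using \<open>x \<noteq> 0\<close> by simp
  ultimately show False using mult_mx[OF assms(1)] by metis
qed

lemma power_mx: assumes "x ^ n \<in> mx" "x \<in> V" shows "x \<in> mx"
  using assms(1)
  by (induction n) (use one_notin_mx prime_mx power_V assms(2) in auto)

lemma root_of_unity_notin_mx: assumes "x ^ k = 1" "k > 0" shows "x \<notin> mx"
proof
  assume "x \<in> mx"
  hence "x * x ^ (k - 1) \<in> mx" using mult_mx power_V mx_V by blast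
  moreover have "x * x ^ (k - 1) = 1" using assms by (metis power_eq_if less_numeral_extra(3))
  ultimately show False using one_notin_mx by simp
qed

lemma p_mx: "of_nat p \<in> mx" using inv_p_notin of_nat_V by (simp add: mx_def)

lemma of_int_mx_iff: "of_int c \<in> mx \<longleftrightarrow> int p dvd c"
proof
  assume "int p dvd c"
  then obtain d where "c = int p * d" by (elim dvdE)
  thus "of_int c \<in> mx" using mult_mx[OF p_mx of_int_V, of d] by simp
next
  assume c: "of_int c \<in> mx"
  show "int p dvd c"
  proof (rule ccontr)
    assume "\<not> int p dvd c"
    hence "coprime (int p) c" using prime_p by (metis prime_imp_coprime prime_nat_int_transfer)
    then obtain u v where "u * int p + v * c = 1"
      using bezout_int[of "int p" c] by (auto simp: coprime_iff_gcd_eq_1)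
    hence "of_int u * of_nat p + of_int v * of_int c = (1 :: complex)"
      by (metis of_int_1 of_int_add of_int_mult of_int_of_nat_eq)
    moreover have "of_int u * of_nat p + of_int v * of_int c \<in> mx"
      by (intro add_mx mult_mx' of_int_V p_mx c)
    ultimately show False using one_notin_mx by simp
  qed
qed

lemma of_nat_mx_iff: "of_nat c \<in> mx \<longleftrightarrow> p dvd c"
  using of_int_mx_iff[of "int c"] by simp

text \<open>The numerator is the quotient times a power of \<open>p\<close>, hence in
  \<open>mx\<close> and divisible by \<open>p\<close>, until the denominator is used up. This is how
  the sums in the Kronecker argument are recognised as integers.\<close>

lemma V_int_if_denom_p_power:
  assumes "of_int a / of_nat (p ^ s) \<in> V"
  shows "\<exists>b. of_int a / of_nat (p ^ s) = (of_int b :: complex)"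
  using assms
proof (induction s arbitrary: a)
  case 0
  thus ?case by auto
next
  case (Suc s)
  have p0: "of_nat p \<noteq> (0::complex)" using p_gt_1 by simp
  have "of_int a = (of_int a / of_nat (p ^ Suc s)) * (of_nat (p ^ Suc s) :: complex)"
    using p0 by simp
  moreover have "\<dots> \<in> mx"
    using mult_mx'[OF Suc.prems, of "of_nat (p ^ Suc s)"] of_nat_mx_iff[of "p ^ Suc s"] by (simp del: of_nat_power)
  ultimately have "int p dvd a" using of_int_mx_iff by metis
  then obtain b where b: "a = int p * b" by (elim dvdE)
  have "of_int a / of_nat (p ^ Suc s) = (of_int b / of_nat (p ^ s) :: complex)"
    using p0 by (simp add: b field_simps)
  with Suc show ?case by metis
qed

end

section \<open>Reducing roots of unity to a finite field\<close>

lemma zeta_power: "zeta n ^ k = exp (2 * of_real pi * \<i> * (of_nat k / of_nat n))"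
  by (simp add: zeta_def mult_ac flip: exp_of_nat_mult)

lemma zeta_power_eq_1_iff:
  assumes "n > 0"
  shows "zeta n ^ k = 1 \<longleftrightarrow> n dvd k"
proof -
  have "zeta n ^ k = exp (2 * of_real pi * \<i> * of_nat k / of_nat n)" by (simp add: zeta_power)
  also have "\<dots> = 1 \<longleftrightarrow> n dvd k" using complex_root_unity_eq_1[of n k] assms by simp
  finally show ?thesis .
qed

lemma root_of_unity_as_zeta_power:
  assumes "w ^ n = 1" "n > 0"
  shows "\<exists>k<n. w = zeta n ^ k"
proof -
  have "w \<in> {exp (2 * of_real pi * \<i> * of_nat j / of_nat n) | j. j < n}"
    using assms complex_roots_unity[of n] by auto
  thus ?thesis by (auto simp: zeta_power)
qed

lemma sum_powers_root_of_unity: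
  fixes w :: complex
  assumes "w ^ n = 1"
  shows "(\<Sum>j<n. w ^ j) = (if w = 1 then of_nat n else 0)"
  using assms by (auto simp: geometric_sum)

text \<open>Integer polynomials are the common source of the finite field and of the cyclotomic
  integers: they are evaluated in the field by \<open>ev\<close> and at complex numbers by
  \<open>evc\<close>, which lets the two sides be compared.\<close>

definition evc :: "int poly \<Rightarrow> complex \<Rightarrow> complex" where
  "evc P z = poly (map_poly of_int P) z"

lemma evc_0 [simp]: "evc 0 z = 0" by (simp add: evc_def)
lemma evc_pCons [simp]: "evc (pCons a P) z = of_int a + z * evc P z"
  by (simp add: evc_def map_poly_pCons)
lemma evc_add: "evc (P + Q) z = evc P z + evc Q z"
  by (induction P Q rule: poly_induct2) (simp_all add: algebra_simps)
lemma evc_smult: "evc (smult a P) z = of_int a * evc P z"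
  by (induction P) (simp_all add: algebra_simps)
lemma evc_diff: "evc (P - Q) z = evc P z - evc Q z"
  using evc_add[of P "smult (-1) Q" z] unfolding evc_smult by simp
lemma evc_mult: "evc (P * Q) z = evc P z * evc Q z"
  by (induction P) (simp_all add: evc_add evc_smult algebra_simps)
lemma evc_monom: "evc (monom a n) z = of_int a * z ^ n"
  by (induction n) (simp_all add: monom_0 monom_Suc algebra_simps)

lemma evc_altdef:
  assumes "\<And>i. i \<ge> N \<Longrightarrow> coeff P i = 0"
  shows "evc P z = (\<Sum>i<N. of_int (coeff P i) * z ^ i)"
  using assms
proof (induction N arbitrary: P)
  case 0
  hence "P = 0" by (intro poly_eqI) simp
  thus ?case by simp
next
  case (Suc N)
  obtain a Q where P: "P = pCons a Q" by (rule pCons_cases)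
  have "evc Q z = (\<Sum>i<N. of_int (coeff Q i) * z ^ i)"
    by (rule Suc.IH) (use Suc.prems[of "Suc _"] P in simp)
  thus ?case by (simp add: P sum.lessThan_Suc_shift sum_distrib_left mult_ac del: sum.lessThan_Suc)
qed

text \<open>Inverse discrete Fourier transform: the values at the \<open>n\<close>-th roots of unity
  determine the coefficients by orthogonality. The exponent \<open>n - d\<close> stands for
  \<open>- d\<close>.\<close>

lemma evc_fourier:
  assumes "\<And>i. i \<ge> n \<Longrightarrow> coeff P i = 0" "d < n"
  shows "(\<Sum>j<n. evc P (zeta n ^ j) * zeta n ^ (j * (n - d))) = of_nat n * of_int (coeff P d)"
proof -
  have "(\<Sum>j<n. evc P (zeta n ^ j) * zeta n ^ (j * (n - d)))
      = (\<Sum>j<n. \<Sum>i<n. of_int (coeff P i) * (zeta n ^ (i + (n - d))) ^ j)"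
  proof (intro sum.cong refl)
    fix j
    have "evc P (zeta n ^ j) = (\<Sum>i<n. of_int (coeff P i) * (zeta n ^ j) ^ i)"
      by (rule evc_altdef) (use assms(1) in blast)
    moreover have "of_int (coeff P i) * (zeta n ^ j) ^ i * zeta n ^ (j * (n - d))
      = of_int (coeff P i) * (zeta n ^ (i + (n - d))) ^ j" for i
      by (simp add: power_add power_mult_distrib mult_ac flip: power_mult)
    ultimately show "evc P (zeta n ^ j) * zeta n ^ (j * (n - d))
      = (\<Sum>i<n. of_int (coeff P i) * (zeta n ^ (i + (n - d))) ^ j)"
      by (simp only: sum_distrib_right)
  qed
  also have "\<dots> = (\<Sum>i<n. of_int (coeff P i) * (\<Sum>j<n. (zeta n ^ (i + (n - d))) ^ j))"
    by (subst sum.swap) (simp add: sum_distrib_left)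
  also have "\<dots> = (\<Sum>i<n. if i = d then of_nat n * of_int (coeff P d) else 0)"
  proof (intro sum.cong refl)
    fix i assume i: "i \<in> {..<n}"
    have "(zeta n ^ (i + (n - d))) ^ n = 1"
      using assms(2) by (simp add: zeta_power_eq_1_iff flip: power_mult)
    moreover have "zeta n ^ (i + (n - d)) = 1 \<longleftrightarrow> i = d"
    proof -
      have "n dvd i + (n - d) \<longleftrightarrow> i = d"
      proof
        assume "n dvd i + (n - d)"
        then obtain k where k: "i + (n - d) = n * k" by (elim dvdE)
        have "0 < n * k" "n * k < n * 2" unfolding k[symmetric] using i assms(2) by auto
        hence "k = 1" by simp
        thus "i = d" using k assms(2) by simp
      qed (use assms(2) in auto)
      thus ?thesis using assms(2) by (simp add: zeta_power_eq_1_iff)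
    qed
    ultimately show "of_int (coeff P i) * (\<Sum>j<n. (zeta n ^ (i + (n - d))) ^ j)
        = (if i = d then of_nat n * of_int (coeff P d) else 0)"
      by (simp only: sum_powers_root_of_unity) simp
  qed
  finally show ?thesis using assms(2) by simp
qed

lemma (in val_ring) evc_V: "w \<in> V \<Longrightarrow> evc P w \<in> V"
  by (induction P) (auto intro: zero_V add_V mult_V of_int_V)

text \<open>Only the prime \<open>p\<close> links \<open>R\<close> to \<open>V\<close>; the
  embedding of \<open>R\<close> into the residue field of \<open>V\<close> is constructed inside the
  locale.\<close>

locale finite_field_above = val_ring p V + field R
  for p :: nat and V :: "complex set" and R :: "('a, 'b) ring_scheme" (structure) +
  fixes f :: nat
  assumes fin: "finite (carrier R)" and card_R: "card (carrier R) = p ^ f" and p_odd: "odd p"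
begin

definition n0 :: nat where "n0 = p ^ f - 1"
definition U :: "'a set" where "U = carrier R - {\<zero>}"

lemma fin_U: "finite U" using fin by (simp add: U_def)
lemma card_U: "card U = n0" using fin card_R by (simp add: U_def n0_def)
lemma one_U: "\<one> \<in> U" by (simp add: U_def)
lemma U_carrier: "x \<in> U \<Longrightarrow> x \<in> carrier R" by (simp add: U_def)
lemma mult_U: "x \<in> U \<Longrightarrow> y \<in> U \<Longrightarrow> x \<otimes> y \<in> U" by (auto simp: U_def integral_iff)

lemma f_pos: "f > 0"
proof (rule ccontr)
  assume "\<not> f > 0"
  hence "f = 0" by simp
  hence "n0 = 0" unfolding n0_def by simp
  thus False using card_U one_U fin_U by auto
qed

lemma n0_ge_2: "n0 \<ge> 2"
proof -
  have "p \<noteq> 2" using p_odd by auto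
  hence "p \<ge> 3" using p_gt_1 by simp
  moreover have "p ^ 1 \<le> p ^ f" using f_pos p_gt_1 by (intro power_increasing) auto
  ultimately show ?thesis by (simp add: n0_def)
qed

lemma n0_Suc: "p ^ f = Suc n0" using p_gt_1 by (simp add: n0_def)

lemma p_not_dvd_n0: "\<not> p dvd n0"
proof
  assume "p dvd n0"
  moreover have "p dvd Suc n0" using f_pos by (simp flip: n0_Suc)
  ultimately have "p dvd 1" using dvd_diff_nat[of p "Suc n0" n0] by simp
  thus False using p_gt_1 by simp
qed

lemma generator_exists: "\<exists>g\<in>U. U = (\<lambda>i. g [^] i) ` {..<n0} \<and> inj_on (\<lambda>i::nat. g [^] i) {..<n0} \<and> g [^] n0 = \<one>"
proof -
  have carr: "carrier (Multiplicative_Group.mult_of R) = U" by (simp add: U_def)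
  obtain g where g: "g \<in> U" "U = {g [^] i | i::nat. i \<in> UNIV}"
    using finite_field_mult_group_has_gen[OF fin] unfolding carr by blast
  interpret G: group "Multiplicative_Group.mult_of R" rewrites "([^]\<^bsub>Multiplicative_Group.mult_of R\<^esub>) = (([^]) :: _ \<Rightarrow> nat \<Rightarrow> _)" and "\<one>\<^bsub>Multiplicative_Group.mult_of R\<^esub> = \<one>"
    by (rule field_mult_group) (simp_all add: fun_eq_iff nat_pow_def)
  have "g [^] order (Multiplicative_Group.mult_of R) = \<one>" using G.pow_order_eq_1[of g] g(1) unfolding carr by blast
  hence g1: "g [^] n0 = \<one>" by (simp add: order_def card_U[symmetric] U_def)
  have mod: "g [^] i = g [^] (i mod n0)" for i
  proof -
    have "g [^] i = g [^] (n0 * (i div n0) + i mod n0)" by simp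
    also have "\<dots> = (g [^] n0) [^] (i div n0) \<otimes> g [^] (i mod n0)"
      using U_carrier[OF g(1)] by (simp only: nat_pow_mult[symmetric] nat_pow_pow)
    finally show ?thesis using U_carrier[OF g(1)] by (simp add: g1 nat_pow_one)
  qed
  have im: "U = (\<lambda>i. g [^] i) ` {..<n0}"
  proof
    show "U \<subseteq> (\<lambda>i. g [^] i) ` {..<n0}"
    proof
      fix x assume "x \<in> U"
      then obtain i :: nat where "x = g [^] i" using g(2) by blast
      hence "x = g [^] (i mod n0)" using mod by simp
      moreover have "i mod n0 \<in> {..<n0}" using n0_ge_2 by simp
      ultimately show "x \<in> (\<lambda>i. g [^] i) ` {..<n0}" by blast
    qed
    show "(\<lambda>i. g [^] i) ` {..<n0} \<subseteq> U" using g(2) by blast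
  qed
  moreover have "inj_on (\<lambda>i::nat. g [^] i) {..<n0}"
    by (rule eq_card_imp_inj_on) (use im card_U in auto)
  ultimately show ?thesis using g(1) g1 by blast
qed

definition g :: 'a where
  "g = (SOME g. g \<in> U \<and> U = (\<lambda>i. g [^] i) ` {..<n0} \<and> inj_on (\<lambda>i::nat. g [^] i) {..<n0} \<and> g [^] n0 = \<one>)"

lemma g: "g \<in> U" "U = (\<lambda>i. g [^] i) ` {..<n0}" "inj_on (\<lambda>i::nat. g [^] i) {..<n0}" "g [^] n0 = \<one>"
  using someI_ex[OF generator_exists[unfolded Bex_def]] unfolding g_def by blast+

lemma g_carrier [simp]: "g \<in> carrier R" by (rule U_carrier[OF g(1)])

lemma g_pow_mod: "g [^] (i mod n0) = g [^] i"
proof -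
  have "g [^] i = g [^] (n0 * (i div n0) + i mod n0)" by simp
  also have "\<dots> = (g [^] n0) [^] (i div n0) \<otimes> g [^] (i mod n0)"
    by (simp only: nat_pow_mult[symmetric] nat_pow_pow g_carrier)
  finally show ?thesis by (simp add: g nat_pow_one)
qed

lemma g_pow_eq_iff: "g [^] i = g [^] j \<longleftrightarrow> i mod n0 = j mod n0"
proof -
  have "g [^] i = g [^] j \<longleftrightarrow> g [^] (i mod n0) = g [^] (j mod n0)" by (simp only: g_pow_mod)
  also have "\<dots> \<longleftrightarrow> i mod n0 = j mod n0"
    using inj_on_eq_iff[OF g(3), of "i mod n0" "j mod n0"] n0_ge_2 by simp
  finally show ?thesis .
qed

lemma g_pow_U: "g [^] (i::nat) \<in> U"
  by (induction i) (auto intro: one_U mult_U g(1))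

definition emb :: "int \<Rightarrow> 'a" where "emb k = add_pow R k \<one>"

lemma emb_closed [simp]: "emb k \<in> carrier R" by (simp add: emb_def)
lemma emb_add: "emb (a + b) = emb a \<oplus> emb b" unfolding emb_def by (simp add: add.int_pow_mult)
lemma emb_mult: "emb (a * b) = emb a \<otimes> emb b"
  unfolding emb_def by (simp add: add_pow_ldistr_int add.int_pow_pow mult.commute)
lemma emb_0 [simp]: "emb 0 = \<zero>" by (simp add: emb_def add_pow_int_ge)
lemma emb_1 [simp]: "emb 1 = \<one>" by (simp add: emb_def add_pow_int_ge)
lemma emb_uminus: "emb (- a) = \<ominus> emb a"
  using emb_add[of "- a" a] by (simp add: minus_equality)

lemma emb_p: "emb (int p) = \<zero>"
proof -
  have "emb (int (order (add_monoid R))) = \<zero>"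
    using add.pow_order_eq_1[of \<one>] unfolding emb_def by (simp add: add_pow_int_ge)
  hence "emb (int p ^ f) = \<zero>" by (simp add: order_def card_R)
  moreover have "emb (int p ^ k) = emb (int p) [^] k" for k
    by (induction k) (simp_all add: emb_mult m_comm)
  ultimately have "emb (int p) [^] f = \<zero>" by simp
  moreover have "x [^] k \<noteq> \<zero>" if "x \<in> carrier R" "x \<noteq> \<zero>" for x and k :: nat
    by (induction k) (use that integral in auto)
  ultimately show ?thesis using emb_closed by blast
qed

lemma emb_eq_0_iff: "emb k = \<zero> \<longleftrightarrow> int p dvd k"
proof
  assume "int p dvd k"
  then obtain l where "k = int p * l" by (elim dvdE)
  thus "emb k = \<zero>" by (simp add: emb_mult emb_p)
next
  assume k: "emb k = \<zero>"
  show "int p dvd k"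
  proof (rule ccontr)
    assume "\<not> int p dvd k"
    hence "coprime (int p) k" using prime_p by (metis prime_imp_coprime prime_nat_int_transfer)
    then obtain u v where "u * int p + v * k = 1"
      using bezout_int[of "int p" k] by (metis coprime_iff_gcd_eq_1)
    hence "emb (u * int p + v * k) = \<one>" by simp
    thus False by (simp add: emb_add emb_mult emb_p k)
  qed
qed

text \<open>Horner evaluation at the generator \<open>g\<close> on coefficient lists. Through
  \<open>ev\<close> it gives the ring homomorphism from the integer polynomials to \<open>R\<close>
  that sends \<open>X\<close> to \<open>g\<close>.\<close>

fun evl :: "int list \<Rightarrow> 'a" where
  "evl [] = \<zero>"
| "evl (a # as) = emb a \<oplus> g \<otimes> evl as"

definition ev :: "int poly \<Rightarrow> 'a" where "ev P = evl (coeffs P)"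

lemma evl_closed [simp]: "evl as \<in> carrier R" by (induction as) auto
lemma ev_closed [simp]: "ev P \<in> carrier R" by (simp add: ev_def)
lemma ev_0 [simp]: "ev 0 = \<zero>" by (simp add: ev_def)
lemma ev_pCons [simp]: "ev (pCons a P) = emb a \<oplus> g \<otimes> ev P"
  by (cases "a = 0 \<and> P = 0") (auto simp: ev_def cCons_def)
lemma ev_add: "ev (P + Q) = ev P \<oplus> ev Q"
  by (induction P Q rule: poly_induct2) (simp_all add: emb_add r_distr a_ac)
lemma ev_smult: "ev (smult a P) = emb a \<otimes> ev P"
  by (induction P) (simp_all add: emb_mult r_distr m_lcomm)
lemma ev_mult: "ev (P * Q) = ev P \<otimes> ev Q"
  by (induction P) (simp_all add: ev_add ev_smult l_distr m_assoc)
lemma ev_diff: "ev (P - Q) = ev P \<ominus> ev Q"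
  using ev_add[of P "smult (-1) Q"] unfolding ev_smult emb_uminus emb_1 by (simp add: l_minus a_minus_def)
lemma ev_monom: "ev (Polynomial.monom a n) = emb a \<otimes> g [^] n"
  by (induction n) (simp_all add: monom_0 monom_Suc m_ac)

text \<open>Up to a scalar, \<open>P\<close> modulo \<open>p\<close> is the minimal polynomial of
  \<open>g\<close> over the prime field, so \<open>P\<close> and \<open>p\<close> generate the
  kernel of \<open>ev\<close>. The proof is division with remainder modulo \<open>p\<close>; the
  clause on \<open>A\<close> bounds the degree of the quotient.\<close>

lemma ev_kernel_division:
  assumes P: "ev P = \<zero>" "\<not> int p dvd Polynomial.coeff P (Polynomial.degree P)"
    and min: "\<And>Q. ev Q = \<zero> \<Longrightarrow> \<not> int p dvd Polynomial.coeff Q (Polynomial.degree Q) \<Longrightarrow> Polynomial.degree P \<le> Polynomial.degree Q"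
    and h: "ev h = \<zero>" "\<And>i. i \<ge> N \<Longrightarrow> Polynomial.coeff h i = 0"
  shows "\<exists>A S. h = P * A + smult (int p) S \<and> (\<forall>i. i + Polynomial.degree P \<ge> N \<longrightarrow> Polynomial.coeff A i = 0)"
  using h
proof (induction N arbitrary: h)
  case 0
  hence "h = 0" by (intro poly_eqI) simp
  thus ?case by (intro exI[of _ 0]) simp
next
  case (Suc N)
  define c where "c = Polynomial.coeff h N"
  show ?case
  proof (cases "int p dvd c")
    case True
    then obtain c' where c': "c = int p * c'" by (elim dvdE)
    have "emb c = \<zero>" using True by (simp only: emb_eq_0_iff)
    hence "ev (h - Polynomial.monom c N) = \<zero>" using Suc.prems(1) by (simp add: ev_diff ev_monom)
    moreover have "Polynomial.coeff (h - Polynomial.monom c N) i = 0" if "i \<ge> N" for i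
      using Suc.prems(2)[of i] that by (cases "i = N") (auto simp: c_def)
    ultimately obtain A S where AS: "h - Polynomial.monom c N = P * A + smult (int p) S"
      "\<forall>i. i + Polynomial.degree P \<ge> N \<longrightarrow> Polynomial.coeff A i = 0" using Suc.IH by blast
    have "h = P * A + smult (int p) (S + Polynomial.monom c' N)"
      using AS(1) by (simp add: smult_add_right smult_monom c' algebra_simps)
    thus ?thesis using AS(2) by (intro exI[of _ A] exI[of _ "S + Polynomial.monom c' N"]) auto
  next
    case False
    hence "Polynomial.degree h = N" using Suc.prems(2)
      by (intro antisym degree_le) (auto simp: c_def intro!: le_degree)
    hence dN: "Polynomial.degree P \<le> N" using min[OF Suc.prems(1)] False by (simp add: c_def)
    have "coprime (int p) (Polynomial.coeff P (Polynomial.degree P))"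
      using P(2) prime_p by (metis prime_imp_coprime prime_nat_int_transfer)
    \<comment> \<open>\<open>b\<close> inverts the leading coefficient of \<open>P\<close> modulo
      \<open>p\<close>. What \<open>P * B\<close> leaves of the top coefficient of \<open>h\<close>
      is the multiple \<open>p * (c * u)\<close>, which goes into \<open>S\<close>.\<close>
    then obtain u b where ub: "u * int p + b * Polynomial.coeff P (Polynomial.degree P) = 1"
      using bezout_int[of "int p" "Polynomial.coeff P (Polynomial.degree P)"] by (metis coprime_iff_gcd_eq_1)
    define B where "B = Polynomial.monom (b * c) (N - Polynomial.degree P)"
    have PB: "P * B = Polynomial.monom (b * c) (N - Polynomial.degree P) * P"
      unfolding B_def by (rule mult.commute)
    define h' where "h' = h - P * B - Polynomial.monom (int p * (c * u)) N"
    have "ev h' = \<zero>" unfolding h'_def using Suc.prems(1) P(1)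
      by (simp add: ev_diff ev_mult ev_monom emb_mult emb_p)
    moreover have "Polynomial.coeff h' i = 0" if "i \<ge> N" for i
    proof (cases "i = N")
      case True
      have "Polynomial.coeff (P * B) N = Polynomial.coeff P (Polynomial.degree P) * (b * c)"
        unfolding PB coeff_monom_mult using dN by simp
      hence "Polynomial.coeff h' N = c * (1 - (u * int p + b * Polynomial.coeff P (Polynomial.degree P)))"
        by (simp add: h'_def c_def algebra_simps)
      thus ?thesis using ub True by simp
    next
      case False
      hence i: "i > N" using that by simp
      hence "Polynomial.coeff (P * B) i = 0"
        unfolding PB coeff_monom_mult using dN by (simp add: coeff_eq_0)
      thus ?thesis using i Suc.prems(2)[of i] by (simp add: h'_def)
    qed
    ultimately obtain A S where AS: "h' = P * A + smult (int p) S"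
      "\<forall>i. i + Polynomial.degree P \<ge> N \<longrightarrow> Polynomial.coeff A i = 0" using Suc.IH by blast
    have "Polynomial.monom (int p * (c * u)) N = smult (int p) (Polynomial.monom (c * u) N)" by (simp add: smult_monom)
    hence "h = P * (A + B) + smult (int p) (S + Polynomial.monom (c * u) N)"
      using AS(1) unfolding h'_def by (simp add: smult_add_right algebra_simps)
    moreover have "Polynomial.coeff (A + B) i = 0" if "i + Polynomial.degree P \<ge> Suc N" for i
      using AS(2) that dN by (auto simp: B_def)
    ultimately show ?thesis by blast
  qed
qed

text \<open>Write \<open>X ^ n0 - 1 = P * A + p * S\<close> as in \<open>ev_kernel_division\<close>.
  If no \<open>n0\<close>-th root of unity were a root of \<open>P\<close> modulo \<open>mx\<close>,
  all of them would be roots of \<open>A\<close> modulo \<open>mx\<close>. As \<open>A\<close> has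
  degree below \<open>n0\<close> and \<open>p\<close> does not divide \<open>n0\<close>, Fourier
  inversion would make \<open>p\<close> divide \<open>A\<close>, hence the leading coefficient
  1.\<close>

lemma root_above_exists:
  "\<exists>z. z ^ n0 = 1 \<and> (\<forall>h. ev h = \<zero> \<longrightarrow> evc h z \<in> mx)"
proof -
  define T where "T = Polynomial.monom 1 n0 - (1 :: int poly)"
  have one: "ev 1 = \<one>" "evc 1 z = 1" for z
    using ev_monom[of 1 0] evc_monom[of 1 0 z] by (simp_all add: monom_0 one_pCons)
  have T: "ev T = \<zero>" by (simp add: T_def ev_diff ev_monom g one)
  have T0: "Polynomial.coeff T n0 = 1" "\<And>i. i \<ge> Suc n0 \<Longrightarrow> Polynomial.coeff T i = 0"
    using n0_ge_2 by (auto simp: T_def)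
  hence "Polynomial.degree T = n0" by (intro antisym degree_le) (auto intro!: le_degree)
  hence "ev T = \<zero> \<and> \<not> int p dvd Polynomial.coeff T (Polynomial.degree T)" using T T0 p_gt_1 by simp
  hence ex: "\<exists>d P. Polynomial.degree P = d \<and> ev P = \<zero> \<and> \<not> int p dvd Polynomial.coeff P (Polynomial.degree P)" by blast
  define d where "d = (LEAST d. \<exists>P. Polynomial.degree P = d \<and> ev P = \<zero> \<and> \<not> int p dvd Polynomial.coeff P (Polynomial.degree P))"
  obtain P where P: "Polynomial.degree P = d" "ev P = \<zero>" "\<not> int p dvd Polynomial.coeff P (Polynomial.degree P)"
    using LeastI_ex[OF ex] unfolding d_def by blast
  have min: "Polynomial.degree P \<le> Polynomial.degree Q" if "ev Q = \<zero>" "\<not> int p dvd Polynomial.coeff Q (Polynomial.degree Q)" for Q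
    unfolding P(1) d_def by (rule Least_le) (use that in blast)
  have div: "\<exists>A S. h = P * A + smult (int p) S \<and> (\<forall>i. i + Polynomial.degree P \<ge> N \<longrightarrow> Polynomial.coeff A i = 0)"
    if "ev h = \<zero>" "\<forall>i\<ge>N. Polynomial.coeff h i = 0" for h N
    by (rule ev_kernel_division[OF P(2,3)]) (use min that in blast)+
  \<comment> \<open>A constant in the kernel of \<open>ev\<close> is divisible by \<open>p\<close>.
    Positive degree of \<open>P\<close> keeps the degree of \<open>A\<close> below
    \<open>n0\<close>, as the Fourier inversion requires.\<close>
  have "d > 0"
  proof (rule ccontr)
    assume "\<not> d > 0"
    then obtain a where "P = [:a:]" using P(1) degree_eq_zeroE[of P] by auto
    thus False using P(2,3) by (simp add: emb_eq_0_iff)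
  qed
  have "\<exists>j<n0. evc P (zeta n0 ^ j) \<in> mx"
  proof (rule ccontr)
    assume no: "\<not> ?thesis"
    obtain A S where AS: "T = P * A + smult (int p) S" "\<forall>i. i + Polynomial.degree P \<ge> Suc n0 \<longrightarrow> Polynomial.coeff A i = 0"
      using div[OF T, of "Suc n0"] T0(2) by blast
    have A0: "Polynomial.coeff A i = 0" if "i \<ge> n0" for i using AS(2) that \<open>d > 0\<close> P(1) by simp
    have V: "evc Q (zeta n0 ^ j) \<in> V" for Q j
      using root_of_unity_V[of "zeta n0 ^ j" n0] n0_ge_2
      by (intro evc_V) (simp add: zeta_power_eq_1_iff flip: power_mult)
    have "evc A (zeta n0 ^ j) \<in> mx" if "j < n0" for j
    proof -
      have "evc T (zeta n0 ^ j) = 0"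
        using n0_ge_2 by (simp add: T_def evc_diff evc_monom one zeta_power_eq_1_iff flip: power_mult)
      hence "evc P (zeta n0 ^ j) * evc A (zeta n0 ^ j) = - (of_nat p * evc S (zeta n0 ^ j))"
        unfolding AS(1) by (simp add: evc_add evc_mult evc_smult eq_neg_iff_add_eq_0)
      also have "\<dots> \<in> mx" by (intro uminus_mx mult_mx p_mx V)
      finally show ?thesis using no that prime_mx[OF _ V V] by blast
    qed
    moreover have "zeta n0 \<in> V" using root_of_unity_V[of "zeta n0" n0] n0_ge_2 by (simp add: zeta_power_eq_1_iff)
    ultimately have sum: "(\<Sum>j<n0. evc A (zeta n0 ^ j) * zeta n0 ^ (j * (n0 - i))) \<in> mx" for i
      by (intro sum_mx mult_mx power_V) auto
    have "of_nat n0 * of_int (Polynomial.coeff A i) \<in> mx" if "i < n0" for i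
    proof -
      have "(\<Sum>j<n0. evc A (zeta n0 ^ j) * zeta n0 ^ (j * (n0 - i))) = of_nat n0 * of_int (Polynomial.coeff A i)"
        by (rule evc_fourier) (use A0 that in auto)
      thus ?thesis using sum[of i] by simp
    qed
    hence A: "int p dvd Polynomial.coeff A i" if "i < n0" for i
      using prime_mx[OF _ of_nat_V of_int_V] that p_not_dvd_n0 by (metis of_nat_mx_iff of_int_mx_iff)
    have "int p dvd Polynomial.coeff A i" for i using A[of i] A0[of i] by (cases "i < n0") auto
    hence "int p dvd Polynomial.coeff T n0" unfolding AS(1) by (simp add: coeff_mult dvd_sum)
    thus False using T0 p_gt_1 by simp
  qed
  then obtain j where j: "j < n0" "evc P (zeta n0 ^ j) \<in> mx" by blast
  have z: "(zeta n0 ^ j) ^ n0 = 1" using n0_ge_2 by (simp add: zeta_power_eq_1_iff flip: power_mult)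
  have V: "evc Q (zeta n0 ^ j) \<in> V" for Q
    using root_of_unity_V[OF z] n0_ge_2 by (intro evc_V) simp
  have "evc h (zeta n0 ^ j) \<in> mx" if h: "ev h = \<zero>" for h
  proof -
    obtain A S where "h = P * A + smult (int p) S"
      using div[OF h, of "Suc (Polynomial.degree h)"] by (auto simp: coeff_eq_0)
    thus ?thesis by (simp add: evc_add evc_mult evc_smult add_mx mult_mx j(2) p_mx V)
  qed
  thus ?thesis using z by blast
qed

definition z :: complex where
  "z = (SOME z. z ^ n0 = 1 \<and> (\<forall>h. ev h = \<zero> \<longrightarrow> evc h z \<in> mx))"

lemma z: "z ^ n0 = 1" "ev h = \<zero> \<Longrightarrow> evc h z \<in> mx"
  using someI_ex[OF root_above_exists] unfolding z_def by blast+

lemma z_pow_mod: "z ^ (i mod n0) = z ^ i"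
proof -
  have "z ^ i = z ^ (n0 * (i div n0) + i mod n0)" by simp
  thus ?thesis unfolding power_add power_mult by (simp add: z(1))
qed

text \<open>If \<open>n0\<close> does not divide \<open>d\<close>, then
  \<open>g [^] d \<ominus> \<one>\<close> has an inverse \<open>g [^] e\<close>, so
  \<open>(X ^ d - 1) * X ^ e - 1\<close> lies in the kernel of \<open>ev\<close>. Its value at
  \<open>z\<close> would be \<open>- 1\<close>, which is not in \<open>mx\<close>. Thus
  \<open>z\<close> is primitive.\<close>

lemma z_pow_eq_1_imp: assumes "z ^ d = 1" shows "n0 dvd d"
proof (rule ccontr)
  assume "\<not> n0 dvd d"
  hence "g [^] d \<noteq> \<one>" using g_pow_eq_iff[of d 0] by (auto simp: mod_eq_0_iff_dvd)
  hence "g [^] d \<ominus> \<one> \<in> Units R" by (simp add: field_Units)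
  then obtain y where y: "y \<in> carrier R" "(g [^] d \<ominus> \<one>) \<otimes> y = \<one>"
    using Units_inv_closed Units_r_inv by blast
  hence "y \<noteq> \<zero>" by auto
  then obtain e where e: "y = g [^] (e::nat)" using y g(2) by (auto simp: U_def)
  define h where "h = (Polynomial.monom 1 d - 1) * Polynomial.monom 1 e - (1 :: int poly)"
  have one: "ev 1 = \<one>" "evc 1 z = 1" for z
    using ev_monom[of 1 0] evc_monom[of 1 0 z] by (simp_all add: monom_0 one_pCons)
  have "ev h = \<zero>" using y e by (simp add: h_def ev_diff ev_mult ev_monom one)
  from z(2)[OF this] have "- 1 \<in> mx"
    by (simp add: h_def evc_diff evc_mult evc_monom one assms)
  thus False using uminus_mx[of "-1"] one_notin_mx by simp
qed

lemma z_pow_eq_iff: "z ^ i = z ^ j \<longleftrightarrow> i mod n0 = j mod n0"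
proof
  assume eq: "z ^ i = z ^ j"
  have "z \<noteq> 0" using z(1) n0_ge_2 by (auto simp: power_0_left split: if_splits)
  have *: "n0 dvd j - i" if "z ^ i = z ^ j" "i \<le> j" for i j
  proof -
    have "z ^ i * z ^ (j - i) = z ^ j" using that(2) by (simp only: power_add[symmetric] le_add_diff_inverse)
    hence "z ^ i * z ^ (j - i) = z ^ i" using that(1) by simp
    hence "z ^ (j - i) = 1" using \<open>z \<noteq> 0\<close> by simp
    thus ?thesis by (rule z_pow_eq_1_imp)
  qed
  show "i mod n0 = j mod n0"
    using *[of i j] *[of j i] eq by (metis mod_eq_dvd_iff_nat nle_le)
qed (metis z_pow_mod)

definition dlog :: "'a \<Rightarrow> nat" where "dlog x = (SOME i. x = g [^] i)"

lemma g_dlog: assumes "x \<in> U" shows "g [^] dlog x = x"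
proof -
  have "\<exists>i::nat. x = g [^] i" using assms g(2) by blast
  from someI_ex[OF this] show ?thesis unfolding dlog_def by (rule sym)
qed

text \<open>The Teichmueller lift: multiplicative, with values in \<open>V\<close> that are zero or
  roots of unity, and additive modulo \<open>mx\<close>.\<close>

definition \<tau> :: "'a \<Rightarrow> complex" where "\<tau> x = (if x = \<zero> then 0 else z ^ dlog x)"

lemma \<tau>_0 [simp]: "\<tau> \<zero> = 0" by (simp add: \<tau>_def)
lemma \<tau>_g_pow: "\<tau> (g [^] i) = z ^ i"
proof -
  have "g [^] dlog (g [^] i) = g [^] i" by (rule g_dlog[OF g_pow_U])
  hence "z ^ dlog (g [^] i) = z ^ i" by (simp only: g_pow_eq_iff z_pow_eq_iff)
  moreover have "g [^] i \<noteq> \<zero>" using g_pow_U[of i] by (simp add: U_def)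
  ultimately show ?thesis by (simp add: \<tau>_def)
qed
lemma \<tau>_1 [simp]: "\<tau> \<one> = 1" using \<tau>_g_pow[of 0] by simp

lemma U_cases: assumes "x \<in> U" obtains i where "i < n0" "x = g [^] i"
  using assms g(2) by auto

lemma \<tau>_mult: assumes "x \<in> carrier R" "y \<in> carrier R" shows "\<tau> (x \<otimes> y) = \<tau> x * \<tau> y"
proof (cases "x = \<zero> \<or> y = \<zero>")
  case False
  then obtain i j where "x = g [^] (i::nat)" "y = g [^] (j::nat)"
    using assms U_cases by (metis DiffI U_def empty_iff insertE)
  thus ?thesis by (simp add: nat_pow_mult \<tau>_g_pow power_add)
qed (use assms in auto)

lemma \<tau>_pow: "x \<in> carrier R \<Longrightarrow> \<tau> (x [^] (k::nat)) = \<tau> x ^ k"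
  by (induction k) (simp_all add: \<tau>_mult)

lemma \<tau>_U_pow: "x \<in> U \<Longrightarrow> \<tau> x ^ n0 = 1"
  by (elim U_cases) (metis \<tau>_g_pow power_mult mult.commute power_one z(1))
lemma \<tau>_V: "x \<in> carrier R \<Longrightarrow> \<tau> x \<in> V"
  using root_of_unity_V[OF \<tau>_U_pow] n0_ge_2 zero_V by (cases "x = \<zero>") (auto simp: U_def)
lemma \<tau>_U_notin_mx: "x \<in> U \<Longrightarrow> \<tau> x \<notin> mx"
  using root_of_unity_notin_mx[OF \<tau>_U_pow] n0_ge_2 by simp

text \<open>A polynomial with value \<open>x\<close> in the field and \<open>\<tau> x\<close> at
  \<open>z\<close>; through it the kernel property of \<open>z\<close> turns into congruences for
  \<open>\<tau>\<close>.\<close>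

definition lift :: "'a \<Rightarrow> int poly" where "lift x = (if x = \<zero> then 0 else Polynomial.monom 1 (dlog x))"

lemma ev_lift: "x \<in> carrier R \<Longrightarrow> ev (lift x) = x"
  using g_dlog[of x] by (simp add: lift_def ev_monom U_def)
lemma evc_lift: "evc (lift x) z = \<tau> x"
  by (simp add: lift_def \<tau>_def evc_monom)

lemma \<tau>_add: assumes "x \<in> carrier R" "y \<in> carrier R"
  shows "\<tau> (x \<oplus> y) - (\<tau> x + \<tau> y) \<in> mx"
proof -
  have "ev (lift (x \<oplus> y) - (lift x + lift y)) = \<zero>"
    using assms by (simp add: ev_diff ev_add ev_lift)
  from z(2)[OF this] show ?thesis by (simp add: evc_diff evc_add evc_lift)
qed

lemma \<tau>_emb: "\<tau> (emb k) - of_int k \<in> mx"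
proof -
  have "ev (lift (emb k) - [:k:]) = \<zero>" by (simp add: ev_diff ev_lift)
  from z(2)[OF this] show ?thesis by (simp add: evc_diff evc_lift)
qed

lemma \<tau>_inj_mod: assumes "x \<in> carrier R" "y \<in> carrier R" "\<tau> x - \<tau> y \<in> mx" shows "x = y"
proof (rule ccontr)
  assume "x \<noteq> y"
  hence "x \<ominus> y \<in> U" using assms by (simp add: U_def)
  hence "\<tau> (x \<ominus> y) \<notin> mx" by (rule \<tau>_U_notin_mx)
  moreover have "\<tau> ((x \<ominus> y) \<oplus> y) - (\<tau> (x \<ominus> y) + \<tau> y) \<in> mx" using assms by (intro \<tau>_add) auto
  moreover have "(x \<ominus> y) \<oplus> y = x" using assms by (simp add: a_minus_def a_assoc l_neg)
  ultimately show False using diff_mx[OF assms(3), of "\<tau> x - (\<tau> (x \<ominus> y) + \<tau> y)"] by simp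
qed

end

section \<open>Gauss sums modulo the valuation ring\<close>

context val_ring
begin

lemma mx_trans: "a - b \<in> mx \<Longrightarrow> b - c \<in> mx \<Longrightarrow> a - c \<in> mx"
  using add_mx[of "a - b" "b - c"] by simp

lemma mx_sym: "a - b \<in> mx \<Longrightarrow> b - a \<in> mx"
  using uminus_mx[of "a - b"] by simp

lemma mx_power_cong:
  assumes "a - b \<in> mx" "a \<in> V" "b \<in> V" shows "a ^ n - b ^ n \<in> mx"
proof (induction n)
  case (Suc n)
  have "a ^ Suc n - b ^ Suc n = a * (a ^ n - b ^ n) + (a - b) * b ^ n" by (simp add: algebra_simps)
  moreover have "a * (a ^ n - b ^ n) \<in> mx" using assms(2) Suc by (rule mult_mx')
  moreover have "(a - b) * b ^ n \<in> mx" using assms(1) power_V[OF assms(3)] by (rule mult_mx)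
  ultimately show ?case using add_mx by simp
qed (simp add: zero_mx)

lemma mx_sum_cong: "(\<And>i. i \<in> I \<Longrightarrow> h i - k i \<in> mx) \<Longrightarrow> sum h I - sum k I \<in> mx"
  by (simp add: sum_mx flip: sum_subtractf)

lemma mx_frobenius_add:
  assumes "a \<in> V" "b \<in> V" shows "(a + b) ^ p - (a ^ p + b ^ p) \<in> mx"
proof -
  have "(a + b) ^ p = (\<Sum>i\<le>p. of_nat (p choose i) * a ^ i * b ^ (p - i))"
    by (rule binomial_ring)
  also have "\<dots> = b ^ p + (\<Sum>i\<in>{1..<p}. of_nat (p choose i) * a ^ i * b ^ (p - i)) + a ^ p"
  proof -
    have "{..p} = insert 0 (insert p {1..<p})" using p_gt_1 by auto
    thus ?thesis using p_gt_1 by simp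
  qed
  finally have "(a + b) ^ p - (a ^ p + b ^ p) = (\<Sum>i\<in>{1..<p}. of_nat (p choose i) * a ^ i * b ^ (p - i))"
    by simp
  also have "\<dots> \<in> mx"
  proof (rule sum_mx)
    fix i assume "i \<in> {1..<p}"
    hence "p dvd (p choose i)" using prime_p by (intro dvd_choose_prime) auto
    hence "of_nat (p choose i) \<in> mx" by (simp only: of_nat_mx_iff)
    thus "of_nat (p choose i) * a ^ i * b ^ (p - i) \<in> mx"
      using assms by (intro mult_mx power_V)
  qed
  finally show ?thesis .
qed

lemma mx_frobenius_sum:
  assumes "finite I" "\<And>i. i \<in> I \<Longrightarrow> h i \<in> V" shows "sum h I ^ p - (\<Sum>i\<in>I. h i ^ p) \<in> mx"
  using assms
proof (induction I rule: finite_induct)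
  case (insert x F)
  have "(h x + sum h F) ^ p - (h x ^ p + sum h F ^ p) \<in> mx"
    using insert by (intro mx_frobenius_add sum_V) auto
  moreover have "(h x ^ p + sum h F ^ p) - (h x ^ p + (\<Sum>i\<in>F. h i ^ p)) \<in> mx"
    using insert by simp
  ultimately show ?case using insert by (simp add: mx_trans)
qed (use p_gt_1 in \<open>simp add: zero_mx power_0_left\<close>)

lemma mx_frobenius_iterated:
  assumes "a \<in> V" "b \<in> V" shows "(a + b) ^ (p ^ i) - (a ^ (p ^ i) + b ^ (p ^ i)) \<in> mx"
proof (induction i)
  case (Suc i)
  have *: "x ^ (p ^ Suc i) = (x ^ (p ^ i)) ^ p" for x :: complex by (simp add: mult.commute flip: power_mult)
  have "((a + b) ^ (p ^ i)) ^ p - (a ^ (p ^ i) + b ^ (p ^ i)) ^ p \<in> mx"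
    using Suc assms by (intro mx_power_cong power_V add_V)
  moreover have "(a ^ (p ^ i) + b ^ (p ^ i)) ^ p - ((a ^ (p ^ i)) ^ p + (b ^ (p ^ i)) ^ p) \<in> mx"
    using assms by (intro mx_frobenius_add power_V)
  ultimately show ?case unfolding * by (rule mx_trans)
qed (simp add: zero_mx)

lemma root_order_p_cong_1:
  assumes "\<epsilon> ^ p = 1" shows "\<epsilon> - 1 \<in> mx"
proof -
  have V: "\<epsilon> \<in> V" using assms p_gt_1 by (intro root_of_unity_V[of _ p]) auto
  hence "(\<epsilon> - 1 + 1) ^ p - ((\<epsilon> - 1) ^ p + 1 ^ p) \<in> mx"
    by (intro mx_frobenius_add diff_V one_V)
  hence "- ((\<epsilon> - 1) ^ p) \<in> mx" using assms by simp
  hence "(\<epsilon> - 1) ^ p \<in> mx" using uminus_mx by fastforce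
  thus ?thesis by (rule power_mx[OF _ diff_V[OF V one_V]])
qed

text \<open>Expanding \<open>(\<pi> + 1) ^ p = 1\<close> and dividing out \<open>\<pi>\<close> gives
  \<open>of_nat p * u = - (\<pi> ^ (p - 1))\<close>, where \<open>u\<close> has constant term
  \<open>c 0 = 1\<close> and is therefore a unit congruent to 1 modulo \<open>mx\<close>.\<close>

lemma p_div_power_V:
  assumes "\<epsilon> ^ p = 1" "\<epsilon> \<noteq> 1"
  shows "of_nat p / (\<epsilon> - 1) ^ (p - 1) \<in> V"
proof -
  define \<pi> where "\<pi> = \<epsilon> - 1"
  have \<pi>: "\<pi> \<in> mx" "\<pi> \<noteq> 0" using root_order_p_cong_1[OF assms(1)] assms(2) by (auto simp: \<pi>_def)
  obtain k where k: "p = Suc (Suc k)" using p_gt_1 that[of "p - 2"] by simp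
  define c where "c j = (p choose Suc j) div p" for j
  have c: "(p choose Suc j) = p * c j" if "j < Suc k" for j
  proof -
    have "p dvd (p choose Suc j)" by (rule dvd_choose_prime) (use prime_p that k in auto)
    thus ?thesis by (simp only: c_def dvd_mult_div_cancel)
  qed
  define u where "u = (\<Sum>j<Suc k. of_nat (c j) * \<pi> ^ j)"
  have "1 = (\<pi> + 1) ^ p" using assms by (simp add: \<pi>_def)
  also have "\<dots> = (\<Sum>i\<le>p. of_nat (p choose i) * \<pi> ^ i)" by (simp add: binomial_ring)
  also have "\<dots> = 1 + (\<Sum>j<p. of_nat (p choose Suc j) * \<pi> ^ Suc j)"
    by (simp add: lessThan_Suc_atMost[symmetric] sum.lessThan_Suc_shift del: sum.lessThan_Suc power_Suc binomial_Suc_Suc)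
  also have "(\<Sum>j<p. of_nat (p choose Suc j) * \<pi> ^ Suc j)
     = (\<Sum>j<Suc k. of_nat (p choose Suc j) * \<pi> ^ Suc j) + \<pi> ^ p"
    using sum.lessThan_Suc[of "\<lambda>j. of_nat (p choose Suc j) * \<pi> ^ Suc j" "Suc k"]
    unfolding k[symmetric] by (simp only: binomial_n_n of_nat_1 mult_1_left)
  also have "(\<Sum>j<Suc k. of_nat (p choose Suc j) * \<pi> ^ Suc j) = of_nat p * \<pi> * u"
    unfolding u_def sum_distrib_left by (intro sum.cong refl) (simp add: c)
  finally have "of_nat p * \<pi> * u = - (\<pi> ^ p)" by (simp add: add_eq_0_iff2)
  also have "\<pi> ^ p = \<pi> * \<pi> ^ (p - 1)" by (simp add: k)
  finally have "\<pi> * (of_nat p * u) = \<pi> * - (\<pi> ^ (p - 1))" by (simp add: mult_ac)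
  hence pu: "of_nat p * u = - (\<pi> ^ (p - 1))" using \<pi>(2) by (simp only: mult_cancel_left simp_thms)
  have "u = 1 + \<pi> * (\<Sum>j<k. of_nat (c (Suc j)) * \<pi> ^ j)"
  proof -
    have "c 0 = 1" using p_gt_1 by (simp add: c_def)
    thus ?thesis unfolding u_def sum.lessThan_Suc_shift by (simp add: sum_distrib_left mult_ac)
  qed
  moreover have "\<pi> * (\<Sum>j<k. of_nat (c (Suc j)) * \<pi> ^ j) \<in> mx"
    using \<pi> by (intro mult_mx sum_V mult_V of_nat_V power_V mx_V)
  ultimately have u1: "u - 1 \<in> mx" by simp
  have "u \<notin> mx"
  proof
    assume "u \<in> mx"
    from diff_mx[OF this u1] show False using one_notin_mx by simp
  qed
  moreover have uV: "u \<in> V" using add_V[OF mx_V[OF u1] one_V] by simp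
  ultimately have "inverse u \<in> V" "u \<noteq> 0" using inverse_V zero_mx by auto
  moreover have "of_nat p / \<pi> ^ (p - 1) = - inverse u"
    using pu \<open>u \<noteq> 0\<close> \<pi>(2) by (simp add: field_simps eq_neg_iff_add_eq_0)
  ultimately show ?thesis using uminus_V by (simp add: \<pi>_def)
qed

end

section \<open>Trace and Teichmueller character\<close>

context finite_field_above
begin

lemma pow_card: assumes "x \<in> carrier R" shows "x [^] (p ^ f) = x"
proof (cases "x = \<zero>")
  case False
  then obtain i where i: "x = g [^] (i::nat)" using assms U_cases[of x] by (auto simp: U_def)
  have "x [^] (p ^ f) = (g [^] n0) [^] i \<otimes> g [^] i"
    by (simp add: i nat_pow_pow n0_Suc mult.commute nat_pow_mult add.commute)
  thus ?thesis by (simp add: g i nat_pow_one)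
qed (simp add: nat_pow_zero n0_Suc)

lemma \<tau>_pow_card: "x \<in> carrier R \<Longrightarrow> \<tau> x ^ (p ^ f) = \<tau> x"
  by (metis pow_card \<tau>_pow)

lemma U_pow: "x \<in> U \<Longrightarrow> x [^] (k::nat) \<in> U"
  by (induction k) (auto intro: one_U mult_U)

lemma bij_frobenius: "bij_betw (\<lambda>x. x [^] p) U U"
proof -
  have "inj_on (\<lambda>x. x [^] p) U"
  proof (rule inj_onI)
    fix x y assume xy: "x \<in> U" "y \<in> U" "x [^] p = y [^] p"
    have *: "w = (w [^] p) [^] (p ^ (f - 1))" if "w \<in> U" for w
    proof -
      have "p * p ^ (f - 1) = p ^ f" using f_pos by (metis power_eq_if not_less_zero)
      thus ?thesis using pow_card[OF U_carrier[OF that]] U_carrier[OF that] by (simp add: nat_pow_pow)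
    qed
    show "x = y" using *[OF xy(1)] *[OF xy(2)] xy(3) by simp
  qed
  moreover have "(\<lambda>x. x [^] p) ` U \<subseteq> U" using U_pow by auto
  ultimately show ?thesis using fin_U by (simp add: bij_betw_def endo_inj_surj)
qed

text \<open>The counterpart of the trace in \<open>V\<close>, formed with the Teichmueller lift.
  Properties of \<open>trace_rep\<close> are read off from it modulo \<open>mx\<close>.\<close>

definition T :: "'a \<Rightarrow> complex" where "T x = (\<Sum>i<f. \<tau> x ^ (p ^ i))"

lemma T_V: "x \<in> carrier R \<Longrightarrow> T x \<in> V"
  unfolding T_def by (intro sum_V power_V \<tau>_V)

lemma T_frobenius: assumes "x \<in> carrier R" shows "(\<Sum>i<f. (\<tau> x ^ (p ^ i)) ^ p) = T x"
proof -
  have "(\<Sum>i<f. (\<tau> x ^ (p ^ i)) ^ p) = (\<Sum>i<f. \<tau> x ^ (p ^ Suc i))"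
    by (simp add: mult.commute flip: power_mult)
  also have "\<dots> = T x"
    using sum.lessThan_Suc_shift[of "\<lambda>i. \<tau> x ^ (p ^ i)" f] sum.lessThan_Suc[of "\<lambda>i. \<tau> x ^ (p ^ i)" f]
      \<tau>_pow_card[OF assms] unfolding T_def by simp
  finally show ?thesis .
qed

lemma abs_trace_closed: "x \<in> carrier R \<Longrightarrow> abs_trace R p f x \<in> carrier R"
  unfolding abs_trace_def by (intro finsum_closed) auto

lemma \<tau>_abs_trace: assumes x: "x \<in> carrier R" shows "\<tau> (abs_trace R p f x) - T x \<in> mx"
proof -
  have "\<tau> (\<Oplus>i\<in>{..<n}. x [^] (p ^ i)) - (\<Sum>i<n. \<tau> x ^ (p ^ i)) \<in> mx" for n
  proof (induction n)
    case (Suc n)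
    have cl: "(\<Oplus>i\<in>{..<n}. x [^] (p ^ i)) \<in> carrier R" using x by (intro finsum_closed) auto
    have eq: "(\<Oplus>i\<in>{..<Suc n}. x [^] (p ^ i)) = x [^] (p ^ n) \<oplus> (\<Oplus>i\<in>{..<n}. x [^] (p ^ i))"
      using x by (simp add: lessThan_Suc)
    have "\<tau> (x [^] (p ^ n) \<oplus> (\<Oplus>i\<in>{..<n}. x [^] (p ^ i))) - (\<tau> x ^ (p ^ n) + \<tau> (\<Oplus>i\<in>{..<n}. x [^] (p ^ i))) \<in> mx"
      using \<tau>_add[of "x [^] (p ^ n)" "\<Oplus>i\<in>{..<n}. x [^] (p ^ i)"] x cl by (simp add: \<tau>_pow)
    moreover have "(\<tau> x ^ (p ^ n) + \<tau> (\<Oplus>i\<in>{..<n}. x [^] (p ^ i))) - (\<Sum>i<Suc n. \<tau> x ^ (p ^ i)) \<in> mx"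
      using Suc by simp
    ultimately show ?case unfolding eq by (rule mx_trans)
  qed (simp add: zero_mx)
  thus ?thesis unfolding abs_trace_def T_def .
qed

lemma emb_pow: "emb (a ^ k) = emb a [^] (k::nat)"
  by (induction k) (simp_all add: emb_mult m_comm)

lemma emb_eq_iff: "emb a = emb b \<longleftrightarrow> int p dvd a - b"
proof -
  have "emb a = emb b \<longleftrightarrow> emb (a + (- b)) = \<zero>"
    unfolding emb_add emb_uminus by (metis a_minus_def emb_closed r_right_minus_eq)
  thus ?thesis by (simp add: emb_eq_0_iff)
qed

text \<open>By Fermat's theorem the nonzero multiples of \<open>\<one>\<close> supply
  \<open>p - 1\<close> solutions of \<open>x [^] (p - 1) = \<one>\<close>, and a field has no
  more.\<close>

lemma frobenius_fixed:
  assumes "y \<in> carrier R" "y [^] p = y"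
  shows "\<exists>k<p. emb (int k) = y"
proof -
  define A where "A = {x \<in> carrier R. x [^] (p - 1) = \<one>}"
  have p1: "p = Suc (p - 1)" using p_gt_1 by simp
  have "card A \<le> p - 1" unfolding A_def using num_roots_le_deg[OF fin, of "p - 1"] p_gt_1 by simp
  moreover have fA: "finite A" using fin by (simp add: A_def)
  have sub: "(\<lambda>k. emb (int k)) ` {1..<p} \<subseteq> A"
  proof clarify
    fix k assume k: "k \<in> {1..<p}"
    hence nd: "\<not> p dvd k" using nat_dvd_not_less by auto
    hence "[k ^ (p - 1) = 1] (mod p)" using fermat_theorem prime_p by blast
    hence "[int k ^ (p - 1) = 1] (mod int p)" by (metis cong_int_iff of_nat_1 of_nat_power)
    hence "emb (int k ^ (p - 1)) = emb 1" by (simp only: emb_eq_iff cong_iff_dvd_diff)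
    thus "emb (int k) \<in> A" by (simp add: A_def emb_pow)
  qed
  have inj: "inj_on (\<lambda>k. emb (int k)) {1..<p}"
  proof (rule inj_onI)
    fix a b assume ab: "a \<in> {1..<p}" "b \<in> {1..<p}" "emb (int a) = emb (int b)"
    hence "[int a = int b] (mod int p)" by (simp add: emb_eq_iff cong_iff_dvd_diff)
    hence "[a = b] (mod p)" by (simp add: cong_int_iff)
    thus "a = b" using ab by (simp add: cong_def)
  qed
  have "card ((\<lambda>k. emb (int k)) ` {1..<p}) = p - 1" using inj by (simp add: card_image)
  ultimately have A: "(\<lambda>k. emb (int k)) ` {1..<p} = A" using card_seteq[OF fA sub] by simp
  show ?thesis
  proof (cases "y = \<zero>")
    case True
    thus ?thesis using p_gt_1 by (intro exI[of _ 0]) simp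
  next
    case False
    have "y [^] (p - 1) \<otimes> y = \<one> \<otimes> y" using assms p1 by (metis l_one nat_pow_Suc)
    hence "y [^] (p - 1) = \<one>"
      using m_rcancel[OF False assms(1) nat_pow_closed[OF assms(1)] one_closed] by blast
    hence "y \<in> A" using assms(1) by (simp add: A_def)
    thus ?thesis unfolding A[symmetric] by auto
  qed
qed

definition t :: "'a \<Rightarrow> nat" where "t x = trace_rep R p f x"

text \<open>The definite description in \<open>trace_rep\<close> denotes because the trace is fixed
  by Frobenius: this holds for \<open>T\<close> modulo \<open>mx\<close>, and \<open>\<tau>\<close>
  is injective modulo \<open>mx\<close>.\<close>

lemma t: assumes x: "x \<in> carrier R" shows "t x < p" "emb (int (t x)) = abs_trace R p f x"
proof -
  let ?y = "abs_trace R p f x"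
  have y: "?y \<in> carrier R" by (rule abs_trace_closed[OF x])
  have "\<tau> (?y [^] p) - T x ^ p \<in> mx"
    using mx_power_cong[OF \<tau>_abs_trace[OF x] \<tau>_V[OF y] T_V[OF x], of p] by (simp add: \<tau>_pow y)
  moreover have "T x ^ p - T x \<in> mx"
    using mx_frobenius_sum[of "{..<f}" "\<lambda>i. \<tau> x ^ (p ^ i)"] x \<tau>_V
    unfolding T_frobenius[OF x] by (simp add: power_V T_def)
  moreover have "T x - \<tau> ?y \<in> mx" by (rule mx_sym[OF \<tau>_abs_trace[OF x]])
  ultimately have "\<tau> (?y [^] p) - \<tau> ?y \<in> mx" by (meson mx_trans)
  hence "?y [^] p = ?y" using y by (intro \<tau>_inj_mod) auto
  then obtain k where k: "k < p" "emb (int k) = ?y" using frobenius_fixed[OF y] by blast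
  have e: "emb (int k) = add_pow R k \<one>" for k by (simp add: emb_def add_pow_int_ge)
  have "t x < p \<and> add_pow R (t x) \<one> = ?y"
    unfolding t_def trace_rep_def
  proof (rule theI[of "\<lambda>k. k < p \<and> add_pow R k \<one> = ?y"])
    show "k < p \<and> add_pow R k \<one> = ?y" using k by (simp add: e)
    fix j assume j: "j < p \<and> add_pow R j \<one> = ?y"
    hence "emb (int j) = emb (int k)" using k(2) by (simp add: e)
    hence "[int j = int k] (mod int p)" by (simp add: emb_eq_iff cong_iff_dvd_diff)
    hence "[j = k] (mod p)" by (simp add: cong_int_iff)
    thus "j = k" using j k by (simp add: cong_def)
  qed
  thus "t x < p" "emb (int (t x)) = ?y" by (auto simp: e)
qed

lemma t_cong_T: assumes x: "x \<in> carrier R" shows "of_nat (t x) - T x \<in> mx"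
proof -
  have "of_nat (t x) - \<tau> (abs_trace R p f x) \<in> mx"
    using mx_sym[OF \<tau>_emb[of "int (t x)"]] t(2)[OF x] by simp
  thus ?thesis using \<tau>_abs_trace[OF x] by (rule mx_trans)
qed

lemma t_add: assumes x: "x \<in> carrier R" and y: "y \<in> carrier R"
  shows "[t (x \<oplus> y) = t x + t y] (mod p)"
proof -
  have xy: "x \<oplus> y \<in> carrier R" using x y by simp
  have "T (x \<oplus> y) - (T x + T y) \<in> mx"
    unfolding T_def sum.distrib[symmetric]
  proof (rule mx_sum_cong)
    fix i
    have "\<tau> (x \<oplus> y) ^ (p ^ i) - (\<tau> x + \<tau> y) ^ (p ^ i) \<in> mx"
      using x y by (intro mx_power_cong \<tau>_add \<tau>_V add_V) auto
    thus "\<tau> (x \<oplus> y) ^ (p ^ i) - (\<tau> x ^ (p ^ i) + \<tau> y ^ (p ^ i)) \<in> mx"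
      using mx_frobenius_iterated[OF \<tau>_V[OF x] \<tau>_V[OF y]] by (rule mx_trans)
  qed
  with t_cong_T[OF xy] have "of_nat (t (x \<oplus> y)) - (T x + T y) \<in> mx" by (rule mx_trans)
  moreover have "(T x + T y) - (of_nat (t x) + of_nat (t y)) \<in> mx"
    using add_mx[OF mx_sym[OF t_cong_T[OF x]] mx_sym[OF t_cong_T[OF y]]] by (simp add: algebra_simps)
  ultimately have "of_nat (t (x \<oplus> y)) - (of_nat (t x) + of_nat (t y)) \<in> mx" by (rule mx_trans)
  hence "of_int (int (t (x \<oplus> y)) - int (t x + t y)) \<in> mx" by simp
  hence "[int (t (x \<oplus> y)) = int (t x + t y)] (mod int p)" unfolding of_int_mx_iff cong_iff_dvd_diff .
  thus ?thesis by (simp only: cong_int_iff)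
qed

lemma t_frobenius: assumes x: "x \<in> carrier R" shows "t (x [^] p) = t x"
proof -
  have "T (x [^] p) = T x"
    unfolding T_frobenius[OF x, symmetric] using x
    by (simp add: T_def \<tau>_pow mult.commute flip: power_mult)
  hence "of_nat (t (x [^] p)) - of_nat (t x) \<in> mx"
    using mx_trans[OF t_cong_T[OF nat_pow_closed[OF x, of p]]] mx_sym[OF t_cong_T[OF x]] x by simp
  hence "of_int (int (t (x [^] p)) - int (t x)) \<in> mx" by simp
  hence "[int (t (x [^] p)) = int (t x)] (mod int p)" unfolding of_int_mx_iff cong_iff_dvd_diff .
  hence "[t (x [^] p) = t x] (mod p)" by (simp only: cong_int_iff)
  thus ?thesis using t(1)[OF x] t(1)[of "x [^] p"] x by (simp add: cong_def)
qed

lemma \<tau>_U_neq_0: "x \<in> U \<Longrightarrow> \<tau> x \<noteq> 0"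
  using \<tau>_U_notin_mx zero_mx by metis

lemma sum_\<tau>_power: "(\<Sum>x\<in>U. \<tau> x ^ a) = (if n0 dvd a then of_nat n0 else 0)"
proof -
  have "(\<Sum>x\<in>U. \<tau> x ^ a) = (\<Sum>i<n0. (z ^ a) ^ i)"
    unfolding g(2)[THEN arg_cong[of _ _ "sum (\<lambda>x. \<tau> x ^ a)"]] sum.reindex[OF g(3)]
    by (intro sum.cong refl) (simp add: \<tau>_g_pow mult.commute flip: power_mult)
  also have "\<dots> = (if z ^ a = 1 then of_nat n0 else 0)"
    by (rule sum_powers_root_of_unity) (simp only: power_mult[symmetric] mult.commute[of a] power_mult z(1) power_one)
  also have "z ^ a = 1 \<longleftrightarrow> n0 dvd a"
    using z_pow_eq_1_imp[of a] z(1) by (auto simp: power_mult)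
  finally show ?thesis .
qed

definition \<omega> :: "'a \<Rightarrow> complex" where "\<omega> x = inverse (\<tau> x)"

lemma \<omega>_mult: "x \<in> U \<Longrightarrow> y \<in> U \<Longrightarrow> \<omega> (x \<otimes> y) = \<omega> x * \<omega> y"
  using U_carrier by (simp add: \<omega>_def \<tau>_mult)
lemma \<omega>_U_pow: "x \<in> U \<Longrightarrow> \<omega> x ^ n0 = 1"
  using \<tau>_U_pow by (simp add: \<omega>_def power_inverse)
lemma \<omega>_V: "x \<in> U \<Longrightarrow> \<omega> x \<in> V"
  using root_of_unity_V[OF \<omega>_U_pow] n0_ge_2 by simp

lemma sum_\<omega>_power: "(\<Sum>x\<in>U. \<omega> x ^ a) = (if n0 dvd a then of_nat n0 else 0)"
proof -
  have "(\<Sum>x\<in>U. \<omega> x ^ a) = cnj (\<Sum>x\<in>U. \<tau> x ^ a)"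
  proof (unfold cnj_sum, intro sum.cong refl)
    fix x assume "x \<in> U"
    hence "norm (\<tau> x) ^ n0 = 1 ^ n0" using \<tau>_U_pow by (simp flip: norm_power)
    hence "norm (\<tau> x) = 1" using n0_ge_2 by (intro power_eq_imp_eq_base[of "norm (\<tau> x)" n0 1]) auto
    hence "\<tau> x * cnj (\<tau> x) = 1" by (simp flip: complex_norm_square)
    hence "\<omega> x = cnj (\<tau> x)" unfolding \<omega>_def by (rule inverse_unique)
    thus "\<omega> x ^ a = cnj (\<tau> x ^ a)" by simp
  qed
  thus ?thesis by (simp add: sum_\<tau>_power)
qed

end

text \<open>The additive character comes from an arbitrary nontrivial \<open>p\<close>-th root of
  unity, so that the locale can be interpreted for every conjugate of a Gauss sum.\<close>

locale gauss_sums = finite_field_above p V R f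
  for p :: nat and V :: "complex set" and R :: "('a, 'b) ring_scheme" (structure) and f :: nat +
  fixes \<epsilon> :: complex
  assumes \<epsilon>: "\<epsilon> ^ p = 1" "\<epsilon> \<noteq> 1"
begin

definition \<pi> :: complex where "\<pi> = \<epsilon> - 1"
definition \<Psi> :: "'a \<Rightarrow> complex" where "\<Psi> x = \<epsilon> ^ t x"
definition G :: "nat \<Rightarrow> complex" where "G a = (\<Sum>x\<in>U. \<Psi> x * \<omega> x ^ a)"

lemma \<pi>: "\<pi> \<noteq> 0" "\<pi> \<in> mx" "\<pi> \<in> V"
  using \<epsilon> root_order_p_cong_1[OF \<epsilon>(1)] mx_V by (auto simp: \<pi>_def)

lemma \<epsilon>_V: "\<epsilon> \<in> V" using root_of_unity_V[OF \<epsilon>(1)] p_gt_1 by simp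

lemma \<epsilon>_power_cong: assumes "[a = b] (mod p)" shows "\<epsilon> ^ a = \<epsilon> ^ b"
proof -
  have "\<epsilon> ^ a = \<epsilon> ^ (a mod p)" for a
  proof -
    have "\<epsilon> ^ a = \<epsilon> ^ (p * (a div p) + a mod p)" by simp
    thus ?thesis unfolding power_add power_mult by (simp add: \<epsilon>)
  qed
  from this[of a] this[of b] show ?thesis using assms by (simp add: cong_def)
qed

lemma \<Psi>_add: "x \<in> carrier R \<Longrightarrow> y \<in> carrier R \<Longrightarrow> \<Psi> (x \<oplus> y) = \<Psi> x * \<Psi> y"
  using \<epsilon>_power_cong[OF t_add] by (simp add: \<Psi>_def power_add)

lemma \<Psi>_zero: "\<Psi> \<zero> = 1"
proof -
  have "\<Psi> \<zero> * \<Psi> \<zero> = \<Psi> \<zero>" using \<Psi>_add[of \<zero> \<zero>] by simp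
  moreover have "\<epsilon> \<noteq> 0" using \<epsilon> p_gt_1 by (auto simp: power_0_left)
  ultimately show ?thesis by (simp add: \<Psi>_def)
qed

text \<open>The first case of Stickelberger's congruence: \<open>(1 + \<pi>)^k\<close> is \<open>1 + k \<pi>\<close>
  to first order, so \<open>G 1 / \<pi>\<close> reduces to \<open>\<Sum>x. x\<^sup>-\<^sup>1 Tr x = -1\<close>.\<close>

lemma G_1_aux:
  "G 1 = \<pi> * (\<Sum>x\<in>U. \<omega> x * (\<Sum>k<t x. \<epsilon> ^ k))"
  "(\<Sum>x\<in>U. \<omega> x * (\<Sum>k<t x. \<epsilon> ^ k)) - of_nat n0 \<in> mx"
proof -
  have \<Psi>: "\<Psi> x = 1 + \<pi> * (\<Sum>k<t x. \<epsilon> ^ k)" for x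
  proof -
    have "(\<Sum>k<t x. \<epsilon> ^ k) = (\<epsilon> ^ t x - 1) / (\<epsilon> - 1)" using \<epsilon>(2) by (rule geometric_sum)
    thus ?thesis using \<epsilon>(2) by (simp add: \<Psi>_def \<pi>_def)
  qed
  have nd: "\<not> n0 dvd 1" using n0_ge_2 by auto
  have "G 1 = (\<Sum>x\<in>U. \<omega> x ^ 1 + \<pi> * (\<omega> x * (\<Sum>k<t x. \<epsilon> ^ k)))"
    unfolding G_def \<Psi> by (intro sum.cong refl) (simp add: algebra_simps)
  also have "\<dots> = \<pi> * (\<Sum>x\<in>U. \<omega> x * (\<Sum>k<t x. \<epsilon> ^ k))"
    unfolding sum.distrib sum_\<omega>_power sum_distrib_left using nd by simp
  finally show "G 1 = \<pi> * (\<Sum>x\<in>U. \<omega> x * (\<Sum>k<t x. \<epsilon> ^ k))" .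
  have geo: "(\<Sum>k<n. \<epsilon> ^ k) - of_nat n \<in> mx" for n
  proof -
    have "(\<Sum>k<n. \<epsilon> ^ k) - (\<Sum>k<n. 1 ^ k) \<in> mx"
      by (intro mx_sum_cong mx_power_cong root_order_p_cong_1 \<epsilon> \<epsilon>_V one_V)
    thus ?thesis by simp
  qed
  have "(\<Sum>x\<in>U. \<omega> x * (\<Sum>k<t x. \<epsilon> ^ k)) - (\<Sum>x\<in>U. \<omega> x * T x) \<in> mx"
  proof (rule mx_sum_cong)
    fix x assume x: "x \<in> U"
    have "(\<Sum>k<t x. \<epsilon> ^ k) - T x \<in> mx"
      using geo t_cong_T[OF U_carrier[OF x]] by (rule mx_trans)
    hence "\<omega> x * ((\<Sum>k<t x. \<epsilon> ^ k) - T x) \<in> mx" by (rule mult_mx'[OF \<omega>_V[OF x]])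
    thus "\<omega> x * (\<Sum>k<t x. \<epsilon> ^ k) - \<omega> x * T x \<in> mx" by (simp add: algebra_simps)
  qed
  moreover have "(\<Sum>x\<in>U. \<omega> x * T x) = of_nat n0"
  proof -
    \<comment> \<open>The sum of \<open>\<tau> x ^ (p ^ i - 1)\<close> over \<open>U\<close>
      survives only for \<open>i = 0\<close>, as \<open>n0\<close> divides \<open>p ^ i - 1\<close>
      for no other \<open>i < f\<close>.\<close>
    have "(\<Sum>x\<in>U. \<omega> x * T x) = (\<Sum>i<f. \<Sum>x\<in>U. \<tau> x ^ (p ^ i - 1))"
      unfolding T_def sum_distrib_left
    proof (subst sum.swap, intro sum.cong refl)
      fix x i assume x: "x \<in> U"
      obtain k where "p ^ i = Suc k" using p_gt_1 by (metis gr0_implies_Suc zero_less_power less_trans zero_less_one)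
      thus "\<omega> x * \<tau> x ^ (p ^ i) = \<tau> x ^ (p ^ i - 1)"
        using \<tau>_U_neq_0[OF x] by (simp add: \<omega>_def)
    qed
    also have "\<dots> = (\<Sum>i<f. if i = 0 then of_nat n0 else 0)"
    proof (intro sum.cong refl)
      fix i assume i: "i \<in> {..<f}"
      have "n0 dvd p ^ i - 1 \<longleftrightarrow> i = 0"
      proof
        assume d: "n0 dvd p ^ i - 1"
        have "p ^ i < p ^ f" using i p_gt_1 by (intro power_strict_increasing) auto
        moreover have "p ^ i > 0" using p_gt_1 by simp
        ultimately have "p ^ i - 1 < n0" using n0_Suc by linarith
        hence "p ^ i - 1 = 0" using d nat_dvd_not_less by auto
        hence "p ^ i = 1" using \<open>p ^ i > 0\<close> by linarith
        thus "i = 0" using p_gt_1 by (cases i) auto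
      qed simp
      thus "(\<Sum>x\<in>U. \<tau> x ^ (p ^ i - 1)) = (if i = 0 then of_nat n0 else 0)"
        unfolding sum_\<tau>_power by simp
    qed
    finally show ?thesis using f_pos by simp
  qed
  ultimately show "(\<Sum>x\<in>U. \<omega> x * (\<Sum>k<t x. \<epsilon> ^ k)) - of_nat n0 \<in> mx" by simp
qed

text \<open>As \<open>p\<close> does not divide \<open>n0\<close>, the cofactor of
  \<open>\<pi>\<close> in \<open>G_1_aux\<close> is a unit, so \<open>G 1\<close> has exactly the
  valuation of \<open>\<pi>\<close>.\<close>

lemma G_1: "G 1 \<noteq> 0" "\<pi> / G 1 \<in> V"
proof -
  define W where "W = (\<Sum>x\<in>U. \<omega> x * (\<Sum>k<t x. \<epsilon> ^ k))"
  have W: "G 1 = \<pi> * W" "W - of_nat n0 \<in> mx" using G_1_aux unfolding W_def by auto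
  have "W \<notin> mx"
  proof
    assume "W \<in> mx"
    from diff_mx[OF this W(2)] have "of_nat n0 \<in> mx" by simp
    thus False using p_not_dvd_n0 of_nat_mx_iff by blast
  qed
  moreover have "W \<in> V" unfolding W_def by (intro sum_V mult_V \<omega>_V power_V \<epsilon>_V)
  ultimately have "inverse W \<in> V" "W \<noteq> 0" using inverse_V zero_mx by auto
  moreover have "\<pi> / (\<pi> * W) = inverse W" using \<pi>(1) by (simp add: field_simps)
  ultimately show "G 1 \<noteq> 0" "\<pi> / G 1 \<in> V" using \<pi>(1) unfolding W(1) by auto
qed

lemma \<Psi>_nontrivial: "\<exists>y\<in>U. \<Psi> y \<noteq> 1"
proof (rule ccontr)
  assume "\<not> ?thesis"
  hence "G 1 = (\<Sum>x\<in>U. \<omega> x ^ 1)" unfolding G_def by (intro sum.cong refl) simp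
  moreover have "\<not> n0 dvd 1" using n0_ge_2 by auto
  ultimately show False unfolding sum_\<omega>_power using G_1(1) by simp
qed

lemma sum_\<Psi>: "(\<Sum>x\<in>U. \<Psi> x) = - 1"
proof -
  obtain y where y: "y \<in> U" "\<Psi> y \<noteq> 1" using \<Psi>_nontrivial by blast
  have yc: "y \<in> carrier R" by (rule U_carrier[OF y(1)])
  have "bij_betw (\<lambda>x. y \<oplus> x) (carrier R) (carrier R)"
    by (rule bij_betwI[where g = "\<lambda>x. \<ominus> y \<oplus> x"]) (use yc in \<open>auto simp: a_assoc[symmetric] r_neg l_neg\<close>)
  hence "(\<Sum>x\<in>carrier R. \<Psi> (y \<oplus> x)) = (\<Sum>x\<in>carrier R. \<Psi> x)"
    by (rule sum.reindex_bij_betw)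
  moreover have "(\<Sum>x\<in>carrier R. \<Psi> (y \<oplus> x)) = \<Psi> y * (\<Sum>x\<in>carrier R. \<Psi> x)"
    unfolding sum_distrib_left by (intro sum.cong refl) (simp add: \<Psi>_add yc)
  ultimately have "(\<Sum>x\<in>carrier R. \<Psi> x) = 0" using y(2) by simp
  moreover have "(\<Sum>x\<in>carrier R. \<Psi> x) = \<Psi> \<zero> + (\<Sum>x\<in>U. \<Psi> x)"
    unfolding U_def using fin by (intro sum.remove) auto
  ultimately show ?thesis by (simp add: \<Psi>_zero eq_neg_iff_add_eq_0 add.commute)
qed

lemma \<omega>_power_dvd: "x \<in> U \<Longrightarrow> n0 dvd a \<Longrightarrow> \<omega> x ^ a = 1"
  by (elim dvdE) (simp add: power_mult \<omega>_U_pow)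

lemma \<tau>_power_dvd: "x \<in> U \<Longrightarrow> n0 dvd a \<Longrightarrow> \<tau> x ^ a = 1"
  by (elim dvdE) (simp add: power_mult \<tau>_U_pow)

lemma G_dvd: "n0 dvd a \<Longrightarrow> G a = - 1"
  unfolding G_def sum_\<Psi>[symmetric] by (intro sum.cong refl) (simp add: \<omega>_power_dvd)

lemma bij_mult_U: assumes "c \<in> U" shows "bij_betw (\<lambda>x. c \<otimes> x) U U"
proof -
  have "inj_on (\<lambda>x. c \<otimes> x) U"
    using assms by (intro inj_onI) (auto simp: U_def m_lcancel)
  moreover have "(\<lambda>x. c \<otimes> x) ` U \<subseteq> U" using assms mult_U by auto
  ultimately show ?thesis using fin_U by (simp add: bij_betw_def endo_inj_surj)
qed

lemma twisted_sum:
  assumes "c \<in> U"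
  shows "(\<Sum>y\<in>U. \<omega> y ^ m * \<Psi> (c \<otimes> y)) = \<tau> c ^ m * G m"
proof -
  have "(\<Sum>y\<in>U. \<Psi> (c \<otimes> y) * \<omega> (c \<otimes> y) ^ m) = G m"
    unfolding G_def by (rule sum.reindex_bij_betw[OF bij_mult_U[OF assms]])
  hence "\<tau> c ^ m * G m = (\<Sum>y\<in>U. \<tau> c ^ m * (\<Psi> (c \<otimes> y) * \<omega> (c \<otimes> y) ^ m))"
    by (simp only: sum_distrib_left[symmetric])
  also have "\<dots> = (\<Sum>y\<in>U. \<omega> y ^ m * \<Psi> (c \<otimes> y))"
  proof (intro sum.cong refl)
    fix y assume y: "y \<in> U"
    have "\<tau> c ^ m * \<omega> (c \<otimes> y) ^ m = \<omega> y ^ m"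
      using \<tau>_U_neq_0[OF assms] unfolding \<omega>_mult[OF assms y] power_mult_distrib
      by (simp add: \<omega>_def power_inverse)
    thus "\<tau> c ^ m * (\<Psi> (c \<otimes> y) * \<omega> (c \<otimes> y) ^ m) = \<omega> y ^ m * \<Psi> (c \<otimes> y)"
      by (simp add: mult.left_commute mult.commute)
  qed
  finally show ?thesis by simp
qed

text \<open>Substitution of \<open>y \<otimes> w\<close> for \<open>x\<close> in the double sum. The
  inner sum is then a Gauss sum twisted by \<open>w \<oplus> \<one>\<close>, evaluated below
  according to whether \<open>n0\<close> divides \<open>a + b\<close>.\<close>

lemma G_mult: "G a * G b = (\<Sum>w\<in>U. \<omega> w ^ a * (\<Sum>y\<in>U. \<omega> y ^ (a + b) * \<Psi> ((w \<oplus> \<one>) \<otimes> y)))"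
proof -
  have "G a * G b = (\<Sum>y\<in>U. \<Sum>x\<in>U. \<Psi> x * \<omega> x ^ a * (\<Psi> y * \<omega> y ^ b))"
    unfolding G_def sum_product by (rule sum.swap)
  also have "\<dots> = (\<Sum>y\<in>U. \<Sum>w\<in>U. \<omega> w ^ a * (\<omega> y ^ (a + b) * \<Psi> ((w \<oplus> \<one>) \<otimes> y)))"
  proof (rule sum.cong[OF refl])
    fix y assume y: "y \<in> U"
    have "(\<Sum>x\<in>U. \<Psi> x * \<omega> x ^ a * (\<Psi> y * \<omega> y ^ b))
      = (\<Sum>w\<in>U. \<Psi> (y \<otimes> w) * \<omega> (y \<otimes> w) ^ a * (\<Psi> y * \<omega> y ^ b))"
      by (rule sum.reindex_bij_betw[OF bij_mult_U[OF y], symmetric])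
    also have "\<dots> = (\<Sum>w\<in>U. \<omega> w ^ a * (\<omega> y ^ (a + b) * \<Psi> ((w \<oplus> \<one>) \<otimes> y)))"
    proof (intro sum.cong refl)
      fix w assume w: "w \<in> U"
      note c = U_carrier[OF w] U_carrier[OF y]
      have "(w \<oplus> \<one>) \<otimes> y = y \<otimes> w \<oplus> y"
        unfolding l_distr[OF c(1) one_closed c(2)] m_comm[OF c] using c by simp
      hence "\<Psi> ((w \<oplus> \<one>) \<otimes> y) = \<Psi> (y \<otimes> w) * \<Psi> y" using c by (simp add: \<Psi>_add)
      thus "\<Psi> (y \<otimes> w) * \<omega> (y \<otimes> w) ^ a * (\<Psi> y * \<omega> y ^ b)
        = \<omega> w ^ a * (\<omega> y ^ (a + b) * \<Psi> ((w \<oplus> \<one>) \<otimes> y))"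
        by (simp add: \<omega>_mult[OF y w] power_mult_distrib power_add mult_ac)
    qed
    finally show "(\<Sum>x\<in>U. \<Psi> x * \<omega> x ^ a * (\<Psi> y * \<omega> y ^ b))
      = (\<Sum>w\<in>U. \<omega> w ^ a * (\<omega> y ^ (a + b) * \<Psi> ((w \<oplus> \<one>) \<otimes> y)))" .
  qed
  also have "\<dots> = (\<Sum>w\<in>U. \<omega> w ^ a * (\<Sum>y\<in>U. \<omega> y ^ (a + b) * \<Psi> ((w \<oplus> \<one>) \<otimes> y)))"
    by (subst sum.swap) (simp add: sum_distrib_left)
  finally show ?thesis .
qed

lemma minus_one_U: "\<ominus> \<one> \<in> U"
  using one_U by (auto simp: U_def)

lemma plus_one_eq_zero_iff: "w \<in> carrier R \<Longrightarrow> w \<oplus> \<one> = \<zero> \<longleftrightarrow> w = \<ominus> \<one>"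
  by (metis a_inv_closed add.m_comm l_neg minus_equality one_closed)

text \<open>The cofactor of \<open>G (a + b)\<close> is a Jacobi sum in disguise; its integrality
  gives the subadditivity of the valuation.\<close>

lemma G_mult_nontrivial:
  assumes "\<not> n0 dvd a + b"
  shows "G a * G b = G (a + b) * (\<Sum>w\<in>U. \<omega> w ^ a * \<tau> (w \<oplus> \<one>) ^ (a + b))"
  unfolding G_mult sum_distrib_left[of "G (a + b)"]
proof (rule sum.cong[OF refl])
  fix w assume w: "w \<in> U"
  have "(\<Sum>y\<in>U. \<omega> y ^ (a + b) * \<Psi> ((w \<oplus> \<one>) \<otimes> y)) = \<tau> (w \<oplus> \<one>) ^ (a + b) * G (a + b)"
  proof (cases "w \<oplus> \<one> = \<zero>")
    case True
    have "(\<Sum>y\<in>U. \<omega> y ^ (a + b) * \<Psi> (\<zero> \<otimes> y)) = (\<Sum>y\<in>U. \<omega> y ^ (a + b))"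
      by (intro sum.cong refl) (simp add: U_carrier \<Psi>_zero)
    \<comment> \<open>A positive exponent makes \<open>\<tau> \<zero> ^ (a + b)\<close> vanish,
      matching the vanishing character sum.\<close>
    moreover have "0 < a + b" using assms by (intro Nat.gr0I notI) simp
    hence "\<tau> \<zero> ^ (a + b) = 0" unfolding \<tau>_0 by (rule zero_power)
    ultimately show ?thesis unfolding True sum_\<omega>_power using assms by simp
  next
    case False
    thus ?thesis using w by (intro twisted_sum) (auto simp: U_def)
  qed
  thus "\<omega> w ^ a * (\<Sum>y\<in>U. \<omega> y ^ (a + b) * \<Psi> ((w \<oplus> \<one>) \<otimes> y))
    = G (a + b) * (\<omega> w ^ a * \<tau> (w \<oplus> \<one>) ^ (a + b))" by simp
qed

text \<open>The inner sum in \<open>G_mult\<close> is \<open>p ^ f - 1\<close> at minus one and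
  \<open>- 1\<close> elsewhere; the constant \<open>- 1\<close> contributes nothing because the sum
  of \<open>\<omega> w ^ a\<close> vanishes.\<close>

lemma G_mult_trivial:
  assumes "n0 dvd a + b" "\<not> n0 dvd a"
  shows "G a * G b = \<omega> (\<ominus> \<one>) ^ a * of_nat (p ^ f)"
proof -
  have inner: "(\<Sum>y\<in>U. \<omega> y ^ (a + b) * \<Psi> ((w \<oplus> \<one>) \<otimes> y)) = (if w = \<ominus> \<one> then of_nat (p ^ f) else 0) - 1"
    if w: "w \<in> U" for w
  proof (cases "w = \<ominus> \<one>")
    case True
    have "(\<Sum>y\<in>U. \<omega> y ^ (a + b) * \<Psi> (\<zero> \<otimes> y)) = (\<Sum>y\<in>U. \<omega> y ^ (a + b))"
      by (intro sum.cong refl) (simp add: U_carrier \<Psi>_zero)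
    moreover have "w \<oplus> \<one> = \<zero>" using True w plus_one_eq_zero_iff[of w] U_carrier by blast
    ultimately show ?thesis using True unfolding sum_\<omega>_power by (simp add: assms(1) n0_Suc)
  next
    case False
    hence c: "w \<oplus> \<one> \<in> U" using w plus_one_eq_zero_iff[of w] by (auto simp: U_def)
    thus ?thesis using twisted_sum[OF c, of "a + b"] False \<tau>_power_dvd[OF c assms(1)] G_dvd[OF assms(1)] by simp
  qed
  have "G a * G b = (\<Sum>w\<in>U. \<omega> w ^ a * ((if w = \<ominus> \<one> then of_nat (p ^ f) else 0) - 1))"
    unfolding G_mult by (intro sum.cong refl) (simp add: inner)
  also have "\<dots> = (\<Sum>w\<in>U. if w = \<ominus> \<one> then \<omega> w ^ a * of_nat (p ^ f) else 0) - (\<Sum>w\<in>U. \<omega> w ^ a)"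
    unfolding sum_subtractf[symmetric] by (intro sum.cong refl) (simp add: algebra_simps)
  also have "\<dots> = \<omega> (\<ominus> \<one>) ^ a * of_nat (p ^ f)"
    unfolding sum_\<omega>_power using assms(2) fin_U minus_one_U by (simp add: sum.delta)
  finally show ?thesis .
qed

lemma \<omega>_minus_one: "\<omega> (\<ominus> \<one>) ^ 2 = 1"
proof -
  have "\<omega> (\<ominus> \<one> \<otimes> \<ominus> \<one>) = \<omega> (\<ominus> \<one>) ^ 2"
    by (simp add: \<omega>_mult[OF minus_one_U minus_one_U] power2_eq_square)
  moreover have "\<ominus> \<one> \<otimes> \<ominus> \<one> = \<one>" by (simp add: l_minus)
  ultimately show ?thesis by (simp add: \<omega>_def)
qed

lemma G_neq_0: "G a \<noteq> 0"
proof (cases "n0 dvd a")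
  case False
  have "n0 dvd a + (n0 - 1) * a"
  proof -
    have "a + (n0 - 1) * a = n0 * a" using n0_ge_2 by (cases n0) auto
    thus ?thesis by simp
  qed
  from G_mult_trivial[OF this False] have "G a * G ((n0 - 1) * a) \<noteq> 0"
    using \<omega>_minus_one p_gt_1 by (auto simp: power2_eq_square)
  thus ?thesis by auto
qed (simp add: G_dvd)

text \<open>The upper bound \<open>v(G a) \<le> s v(\<pi>)\<close>; by subadditivity it holds whenever \<open>a\<close> is a sum of
  \<open>s\<close> powers of \<open>p\<close>.\<close>

definition bounded_by :: "nat \<Rightarrow> nat \<Rightarrow> bool" where
  "bounded_by s a \<longleftrightarrow> \<pi> ^ s / G a \<in> V"

text \<open>The quotient for \<open>a + b\<close> is the product of the two given ones with a Jacobi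
  sum, which lies in \<open>V\<close>. If \<open>n0\<close> divides \<open>a + b\<close>, then
  \<open>G (a + b) = - 1\<close>.\<close>

lemma bounded_by_add:
  assumes "bounded_by s a" "bounded_by s' b"
  shows "bounded_by (s + s') (a + b)"
proof (cases "n0 dvd a + b")
  case True
  hence "\<pi> ^ (s + s') / G (a + b) = - (\<pi> ^ (s + s'))" by (simp add: G_dvd)
  thus ?thesis unfolding bounded_by_def using \<pi>(3) by (simp add: uminus_V power_V)
next
  case False
  define J where "J = (\<Sum>w\<in>U. \<omega> w ^ a * \<tau> (w \<oplus> \<one>) ^ (a + b))"
  have JV: "J \<in> V" unfolding J_def
    by (intro sum_V mult_V power_V \<omega>_V \<tau>_V) (auto intro: U_carrier)
  have GJ: "G a * G b = G (a + b) * J" unfolding J_def by (rule G_mult_nontrivial[OF False])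
  have eq: "\<pi> ^ (s + s') / G (a + b) = (\<pi> ^ s / G a) * (\<pi> ^ s' / G b) * J"
  proof -
    have "(\<pi> ^ s / G a) * (\<pi> ^ s' / G b) * J = \<pi> ^ (s + s') * J / (G (a + b) * J)"
      unfolding GJ[symmetric] by (simp add: power_add)
    moreover have "J \<noteq> 0" using GJ G_neq_0[of a] G_neq_0[of b] by auto
    ultimately show ?thesis by simp
  qed
  show ?thesis
    using mult_V[OF mult_V[OF assms[unfolded bounded_by_def]] JV] unfolding bounded_by_def eq .
qed

lemma bounded_by_0: "bounded_by 0 0"
  using uminus_V[OF one_V] by (simp add: bounded_by_def G_dvd)

lemma G_frobenius: "G (p * a) = G a"
proof -
  have "G a = (\<Sum>x\<in>U. \<Psi> (x [^] p) * \<omega> (x [^] p) ^ a)"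
    unfolding G_def by (rule sum.reindex_bij_betw[OF bij_frobenius, symmetric])
  also have "\<dots> = G (p * a)"
    unfolding G_def
  proof (intro sum.cong refl)
    fix x assume x: "x \<in> U"
    have "\<Psi> (x [^] p) = \<Psi> x" by (simp add: \<Psi>_def t_frobenius U_carrier[OF x])
    moreover have "\<omega> (x [^] p) = \<omega> x ^ p" by (simp add: \<omega>_def \<tau>_pow U_carrier[OF x] power_inverse)
    ultimately show "\<Psi> (x [^] p) * \<omega> (x [^] p) ^ a = \<Psi> x * \<omega> x ^ (p * a)" by (simp add: power_mult)
  qed
  finally show ?thesis by simp
qed

lemma bounded_by_p_power: "bounded_by 1 (p ^ i)"
proof -
  have "G (p ^ i) = G 1" by (induction i) (simp_all add: G_frobenius)
  thus ?thesis unfolding bounded_by_def using G_1(2) by simp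
qed

lemma bounded_by_digits:
  assumes "finite I"
  shows "bounded_by (\<Sum>i\<in>I. d i) (\<Sum>i\<in>I. d i * p ^ h i)"
  using assms
proof (induction I rule: finite_induct)
  case (insert i I)
  have "bounded_by n (n * p ^ h i)" for n
  proof (induction n)
    case (Suc n)
    show ?case using bounded_by_add[OF bounded_by_p_power Suc, of "h i"] by simp
  qed (simp add: bounded_by_0)
  from bounded_by_add[OF this[of "d i"] insert.IH] show ?case using insert by simp
qed (simp add: bounded_by_0)

text \<open>With \<open>q = p ^ f\<close> the product formula gives
  \<open>G a ^ 2 / q = q / G b ^ 2\<close>. As \<open>2 * s = f * (p - 1)\<close>, the quotient of
  \<open>q\<close> by \<open>\<pi> ^ (2 * s)\<close> is a power of the element in
  \<open>p_div_power_V\<close>, and the upper bound for \<open>G b\<close> does the rest.\<close>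

lemma G_square_div_V:
  assumes "\<not> n0 dvd a" "n0 dvd a + b" "bounded_by s b" "2 * s = f * (p - 1)"
  shows "G a ^ 2 / of_nat (p ^ f) \<in> V"
proof -
  let ?q = "of_nat (p ^ f) :: complex"
  have "(G a * G b) ^ 2 = (\<omega> (\<ominus> \<one>) ^ 2) ^ a * ?q ^ 2"
    unfolding G_mult_trivial[OF assms(2,1)] by (simp add: power_mult_distrib mult.commute flip: power_mult)
  hence "G a ^ 2 * G b ^ 2 = ?q ^ 2" by (simp add: \<omega>_minus_one power_mult_distrib)
  hence "G a ^ 2 / ?q = ?q / G b ^ 2"
    using G_neq_0[of b] p_gt_1 by (simp add: field_simps power2_eq_square)
  also have "\<dots> = (of_nat p / \<pi> ^ (p - 1)) ^ f * (\<pi> ^ s / G b) ^ 2"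
  proof -
    have "(\<pi> ^ s) ^ 2 = (\<pi> ^ (p - 1)) ^ f"
      using assms(4) by (simp add: mult.commute flip: power_mult)
    thus ?thesis using \<pi>(1) by (simp add: power_divide)
  qed
  also have "\<dots> \<in> V"
    using assms(3) p_div_power_V[OF \<epsilon>] unfolding bounded_by_def \<pi>_def
    by (intro mult_V power_V)
  finally show ?thesis .
qed

text \<open>Conjugation inverts the values of both characters, so \<open>cnj (G a)\<close> is
  \<open>G b\<close> up to a sign, with \<open>b\<close> standing for \<open>- a\<close>; the
  product formula has the same sign.\<close>

lemma norm_G_square:
  assumes "\<not> n0 dvd a"
  shows "norm (G a) ^ 2 = real (p ^ f)"
proof -
  define b where "b = (n0 - 1) * a"
  have ab: "a + b = n0 * a" unfolding b_def using n0_ge_2 by (cases n0) auto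
  have norm: "norm (\<epsilon>) = 1"
  proof -
    have "norm \<epsilon> ^ p = 1 ^ p" using \<epsilon>(1) by (simp flip: norm_power)
    thus ?thesis using p_gt_1 by (intro power_eq_imp_eq_base[of "norm \<epsilon>" p 1]) auto
  qed
  have norm\<omega>: "norm (\<omega> x) = 1" if "x \<in> U" for x
  proof -
    have "norm (\<omega> x) ^ n0 = 1 ^ n0" using \<omega>_U_pow[OF that] by (simp flip: norm_power)
    thus ?thesis using n0_ge_2 by (intro power_eq_imp_eq_base[of "norm (\<omega> x)" n0 1]) auto
  qed
  have "cnj (G a) = (\<Sum>x\<in>U. \<Psi> (\<ominus> \<one> \<otimes> x) * \<omega> x ^ b)"
    unfolding G_def cnj_sum
  proof (intro sum.cong refl)
    fix x assume x: "x \<in> U"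
    note xc = U_carrier[OF x]
    have "\<Psi> x * \<Psi> (\<ominus> \<one> \<otimes> x) = 1"
      using \<Psi>_add[of x "\<ominus> \<one> \<otimes> x"] xc by (simp add: \<Psi>_zero l_minus r_neg)
    moreover have "norm (\<Psi> x) = 1" by (simp add: \<Psi>_def norm_power norm)
    hence "\<Psi> x * cnj (\<Psi> x) = 1" by (simp only: complex_norm_square[symmetric]) simp
    ultimately have 1: "cnj (\<Psi> x) = \<Psi> (\<ominus> \<one> \<otimes> x)" by (metis inverse_unique)
    have "\<omega> x ^ a * cnj (\<omega> x ^ a) = 1"
      using norm\<omega>[OF x] by (simp only: complex_norm_square[symmetric] norm_power) simp
    moreover have "\<omega> x ^ a * \<omega> x ^ b = 1"
      unfolding power_add[symmetric] ab by (rule \<omega>_power_dvd[OF x]) simp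
    ultimately have 2: "cnj (\<omega> x ^ a) = \<omega> x ^ b" by (metis inverse_unique)
    show "cnj (\<Psi> x * \<omega> x ^ a) = \<Psi> (\<ominus> \<one> \<otimes> x) * \<omega> x ^ b" by (simp only: complex_cnj_mult 1 2)
  qed
  also have "\<dots> = \<tau> (\<ominus> \<one>) ^ b * G b"
    using twisted_sum[OF minus_one_U, of b] by (simp add: mult.commute)
  finally have "G a * cnj (G a) = \<tau> (\<ominus> \<one>) ^ b * (G a * G b)" by simp
  also have "G a * G b = \<omega> (\<ominus> \<one>) ^ a * of_nat (p ^ f)"
    by (rule G_mult_trivial[OF _ assms]) (simp add: ab)
  also have "\<tau> (\<ominus> \<one>) ^ b * (\<omega> (\<ominus> \<one>) ^ a * of_nat (p ^ f)) = of_nat (p ^ f)"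
  proof -
    have "\<tau> (\<ominus> \<one>) = \<omega> (\<ominus> \<one>)"
      using \<omega>_minus_one \<tau>_U_neq_0[OF minus_one_U] unfolding \<omega>_def
      by (simp add: power2_eq_square field_simps)
    hence "\<tau> (\<ominus> \<one>) ^ b * \<omega> (\<ominus> \<one>) ^ a = \<omega> (\<ominus> \<one>) ^ (a + b)"
      by (simp add: power_add mult.commute)
    also have "\<dots> = 1" unfolding ab by (rule \<omega>_power_dvd[OF minus_one_U]) simp
    finally show ?thesis by (simp add: mult.assoc[symmetric])
  qed
  finally have "complex_of_real (norm (G a) ^ 2) = complex_of_real (real (p ^ f))"
    by (simp flip: complex_norm_square)
  thus ?thesis by (simp only: of_real_eq_iff)
qed

end

section \<open>Ramanujan sums and a criterion for roots of unity\<close>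

lemma zeta_mult_power: assumes "d > 0" shows "zeta (d * m) ^ d = zeta m"
  using assms by (simp add: zeta_power) (simp add: zeta_def)

text \<open>Sorting the sum over all \<open>t < k\<close> by \<open>gcd t k\<close> splits it into
  the sums of this kind for the divisors of \<open>k\<close>. The whole is 0 or \<open>k\<close>, so
  strong induction isolates the term for \<open>k\<close> itself.\<close>

lemma ramanujan_sum_Ints:
  assumes "k > 0"
  shows "(\<Sum>t | t < k \<and> coprime t k. zeta k ^ (t * j)) \<in> \<int>"
  using assms
proof (induction k rule: less_induct)
  case (less k)
  define c where "c k = (\<Sum>t | t < k \<and> coprime t k. zeta k ^ (t * j))" for k
  have block: "(\<Sum>t | t < k \<and> gcd t k = d. zeta k ^ (t * j)) = c (k div d)" if d: "d dvd k" for d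
  proof -
    obtain m where m: "k = d * m" using d by (elim dvdE)
    have pos: "d > 0" "m > 0" using m less.prems by auto
    have "bij_betw (\<lambda>t. d * t) {t. t < m \<and> coprime t m} {t. t < k \<and> gcd t k = d}"
    proof (rule bij_betw_imageI)
      show "inj_on (\<lambda>t. d * t) {t. t < m \<and> coprime t m}" using pos by (auto simp: inj_on_def)
      show "(\<lambda>t. d * t) ` {t. t < m \<and> coprime t m} = {t. t < k \<and> gcd t k = d}"
      proof (intro equalityI subsetI)
        fix t assume "t \<in> (\<lambda>t. d * t) ` {t. t < m \<and> coprime t m}"
        thus "t \<in> {t. t < k \<and> gcd t k = d}" using pos by (auto simp: m gcd_mult_distrib_nat[symmetric])
      next
        fix t assume t: "t \<in> {t. t < k \<and> gcd t k = d}"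
        hence "d dvd t" by (metis (mono_tags, lifting) gcd_dvd1 mem_Collect_eq)
        then obtain t' where t': "t = d * t'" by (elim dvdE)
        have "d * gcd t' m = d" using t unfolding t' m by (simp add: gcd_mult_distrib_nat)
        hence "gcd t' m = 1" using nat_mult_eq_cancel1[OF pos(1), of "gcd t' m" 1] by simp
        hence "coprime t' m" by (rule coprime_iff_gcd_eq_1[THEN iffD2])
        moreover have "t' < m" using t pos unfolding t' m by simp
        ultimately show "t \<in> (\<lambda>t. d * t) ` {t. t < m \<and> coprime t m}" unfolding t' by blast
      qed
    qed
    hence "(\<Sum>t | t < k \<and> gcd t k = d. zeta k ^ (t * j)) = (\<Sum>t | t < m \<and> coprime t m. zeta k ^ (d * t * j))"
      by (rule sum.reindex_bij_betw[symmetric])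
    also have "\<dots> = c m" unfolding c_def
    proof (intro sum.cong refl)
      fix t
      have "zeta k ^ (d * t * j) = (zeta k ^ d) ^ (t * j)" by (simp add: mult.assoc flip: power_mult)
      thus "zeta k ^ (d * t * j) = zeta m ^ (t * j)" unfolding m zeta_mult_power[OF pos(1)] .
    qed
    finally show ?thesis using pos by (simp add: m)
  qed
  have "(\<Sum>t<k. zeta k ^ (t * j)) = (\<Sum>d\<in>{d. d dvd k}. \<Sum>t\<in>{t \<in> {..<k}. gcd t k = d}. zeta k ^ (t * j))"
    by (rule sum.group[symmetric]) (use less.prems in auto)
  also have "\<dots> = (\<Sum>d\<in>{d. d dvd k}. c (k div d))"
    by (intro sum.cong refl) (simp add: block)
  also have "\<dots> = c k + (\<Sum>d\<in>{d. d dvd k} - {1}. c (k div d))"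
    using less.prems by (subst sum.remove[of _ 1]) auto
  finally have "c k = (\<Sum>t<k. zeta k ^ (t * j)) - (\<Sum>d\<in>{d. d dvd k} - {1}. c (k div d))" by simp
  moreover have "(\<Sum>t<k. zeta k ^ (t * j)) \<in> \<int>"
  proof -
    have "(zeta k ^ j) ^ k = 1" using less.prems by (simp add: zeta_power_eq_1_iff flip: power_mult)
    from sum_powers_root_of_unity[OF this] show ?thesis
      by (simp add: mult.commute split: if_splits flip: power_mult)
  qed
  moreover have "(\<Sum>d\<in>{d. d dvd k} - {1}. c (k div d)) \<in> \<int>"
  proof (rule Ints_sum)
    fix d assume d: "d \<in> {d. d dvd k} - {1}"
    hence "d > 0" using less.prems by (auto intro!: Nat.gr0I)
    hence "d > 1" using d by auto
    hence "k div d < k" "k div d > 0" using d less.prems by (auto simp: div_greater_zero_iff dvd_imp_le)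
    thus "c (k div d) \<in> \<int>" unfolding c_def by (rule less.IH)
  qed
  ultimately show ?case unfolding c_def by simp
qed

lemma evc_1 [simp]: "evc 1 w = 1"
  using evc_monom[of 1 0 w] by (simp add: monom_0 one_pCons)

lemma evc_power: "evc (P ^ n) w = evc P w ^ n"
  by (induction n) (simp_all add: evc_mult)

text \<open>Integrality of cyclotomic traces by hand: the sum is an integer combination of Ramanujan
  sums.\<close>

lemma sum_evc_primitive_Ints:
  assumes "k > 0"
  shows "(\<Sum>t | t < k \<and> coprime t k. evc P (zeta k ^ t)) \<in> \<int>"
proof -
  define N where "N = Suc (degree P)"
  have alt: "evc P w = (\<Sum>i<N. of_int (coeff P i) * w ^ i)" for w
    by (rule evc_altdef) (simp add: N_def coeff_eq_0)
  have "(\<Sum>t | t < k \<and> coprime t k. evc P (zeta k ^ t))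
    = (\<Sum>i<N. of_int (coeff P i) * (\<Sum>t | t < k \<and> coprime t k. zeta k ^ (t * i)))"
    unfolding alt sum_distrib_left by (subst sum.swap) (simp add: power_mult)
  also have "\<dots> \<in> \<int>" by (intro Ints_sum Ints_mult Ints_of_int ramanujan_sum_Ints assms)
  finally show ?thesis .
qed

text \<open>A form of Kronecker's theorem: the sums \<open>\<Sum>t. W t ^ n * \<zeta>^(t i)\<close> over units \<open>t\<close>
  modulo \<open>k\<close> are rational integers bounded by \<open>k\<close>, so for two exponents \<open>n\<close> they all agree, and
  Fourier inversion recovers \<open>W 1 ^ n\<close> from them.\<close>

lemma (in val_ring) root_of_unity_criterion:
  fixes k s :: nat and P :: "int poly"
  defines "W \<equiv> \<lambda>t. evc P (zeta k ^ t) / of_nat (p ^ s)"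
  assumes k: "k > 1"
    and W: "\<And>t. coprime t k \<Longrightarrow> norm (W t) = 1" "\<And>t. coprime t k \<Longrightarrow> W t \<in> V"
  shows "root_of_unity (W 1)"
proof -
  define A where "A = {t. t < k \<and> coprime t k}"
  define c where "c n i = (\<Sum>t\<in>A. W t ^ n * (zeta k ^ t) ^ i)" for n i
  have finA: "finite A" and cardA: "card A \<le> k"
  proof -
    have "A \<subseteq> {..<k}" by (auto simp: A_def)
    thus "finite A" "card A \<le> k" using card_mono[of "{..<k}" A] finite_subset by auto
  qed
  have zk: "zeta k ^ k = 1" using k by (simp add: zeta_power_eq_1_iff)
  have zV: "zeta k \<in> V" using root_of_unity_V[OF zk] k by simp
  have nz: "norm (zeta k) = 1"
  proof -
    have "norm (zeta k) ^ k = 1 ^ k" using zk by (simp flip: norm_power)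
    thus ?thesis using k by (intro power_eq_imp_eq_base[of "norm (zeta k)" k 1]) auto
  qed
  \<comment> \<open>The sum is an integer over a power of \<open>p\<close> and lies in
    \<open>V\<close>, hence is an integer; its absolute value is at most the number of
    summands.\<close>
  have c_int: "c n i \<in> of_int ` {- int k..int k}" for n i
  proof -
    have "(\<Sum>t\<in>A. evc (P ^ n * monom 1 i) (zeta k ^ t)) \<in> \<int>"
      unfolding A_def using k by (intro sum_evc_primitive_Ints) simp
    then obtain a where a: "(\<Sum>t\<in>A. evc (P ^ n * monom 1 i) (zeta k ^ t)) = of_int a"
      by (elim Ints_cases)
    have "c n i = (\<Sum>t\<in>A. evc (P ^ n * monom 1 i) (zeta k ^ t)) / of_nat (p ^ (s * n))"
      unfolding c_def sum_divide_distrib W_def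
      by (intro sum.cong refl) (simp add: evc_mult evc_power evc_monom power_divide power_mult)
    hence ca: "c n i = of_int a / of_nat (p ^ (s * n))" unfolding a .
    have "c n i \<in> V" unfolding c_def
      by (intro sum_V mult_V power_V zV W) (simp add: A_def)
    then obtain b where b: "c n i = of_int b" using V_int_if_denom_p_power unfolding ca by blast
    have "norm (c n i) \<le> (\<Sum>t\<in>A. norm (W t ^ n * (zeta k ^ t) ^ i))"
      unfolding c_def by (rule norm_sum)
    also have "\<dots> = real (card A)"
      using W(1) by (simp add: A_def norm_mult norm_power nz)
    finally have "norm (c n i) \<le> real k" using cardA by linarith
    hence "\<bar>real_of_int b\<bar> \<le> real k" unfolding b by simp
    hence "b \<in> {- int k..int k}" by auto
    thus ?thesis unfolding b by blast
  qed
  \<comment> \<open>Pigeonhole: infinitely many exponents \<open>n\<close>, but finitely many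
    vectors of bounded integers.\<close>
  have "\<not> inj (\<lambda>n. restrict (c n) {..<k})"
  proof
    assume "inj (\<lambda>n. restrict (c n) {..<k})"
    moreover have "range (\<lambda>n. restrict (c n) {..<k}) \<subseteq> PiE {..<k} (\<lambda>_. of_int ` {- int k..int k})"
      by (intro image_subsetI PiE_I) (use c_int in \<open>simp_all only: restrict_apply lessThan_iff if_True if_False\<close>)
    moreover have "finite (PiE {..<k} (\<lambda>_. of_int ` {- int k..int k} :: complex set))"
      by (intro finite_PiE) auto
    ultimately show False using finite_subset finite_imageD infinite_UNIV_nat by blast
  qed
  then obtain n1 n2 where n: "n1 \<noteq> n2" "restrict (c n1) {..<k} = restrict (c n2) {..<k}"
    unfolding inj_on_def by blast
  \<comment> \<open>The exponent \<open>k - 1\<close> stands for \<open>- 1\<close>, so the inner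
    sum over \<open>i\<close> detects \<open>t = 1\<close>.\<close>
  have inv: "(\<Sum>i<k. c n i * (zeta k ^ (k - 1)) ^ i) = of_nat k * W 1 ^ n" for n
  proof -
    have "(\<Sum>i<k. c n i * (zeta k ^ (k - 1)) ^ i)
      = (\<Sum>t\<in>A. W t ^ n * (\<Sum>i<k. (zeta k ^ (t + (k - 1))) ^ i))"
      unfolding c_def sum_distrib_right sum_distrib_left
      by (subst sum.swap) (simp only: power_add power_mult_distrib mult.assoc)
    also have "\<dots> = (\<Sum>t\<in>A. if t = 1 then of_nat k * W 1 ^ n else 0)"
    proof (intro sum.cong refl)
      fix t assume t: "t \<in> A"
      have "(zeta k ^ (t + (k - 1))) ^ k = 1"
        using k by (simp add: zeta_power_eq_1_iff flip: power_mult)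
      note sum = sum_powers_root_of_unity[OF this]
      have "k dvd t + (k - 1) \<longleftrightarrow> t = 1"
      proof
        assume "k dvd t + (k - 1)"
        then obtain l where l: "t + (k - 1) = k * l" by (elim dvdE)
        have "0 < k * l" "k * l < k * 2" unfolding l[symmetric] using t k by (auto simp: A_def)
        hence "l = 1" by simp
        thus "t = 1" using l k by simp
      qed (use k in auto)
      hence "zeta k ^ (t + (k - 1)) = 1 \<longleftrightarrow> t = 1" using k by (simp only: zeta_power_eq_1_iff)
      thus "W t ^ n * (\<Sum>i<k. (zeta k ^ (t + (k - 1))) ^ i) = (if t = 1 then of_nat k * W 1 ^ n else 0)"
        unfolding sum by simp
    qed
    also have "\<dots> = of_nat k * W 1 ^ n"
      using finA k by (simp add: A_def)
    finally show ?thesis .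
  qed
  have "of_nat k * W 1 ^ n1 = of_nat k * W 1 ^ n2"
    unfolding inv[symmetric] by (intro sum.cong refl) (metis n(2) restrict_apply)
  hence eq: "W 1 ^ n1 = W 1 ^ n2" using k by simp
  have nz: "W 1 \<noteq> 0" using W(1)[of 1] by auto
  have *: "root_of_unity (W 1)" if "a < b" "W 1 ^ a = W 1 ^ b" for a b :: nat
  proof -
    have "W 1 ^ a * W 1 ^ (b - a) = W 1 ^ b"
      using that(1) by (simp only: power_add[symmetric] le_add_diff_inverse less_imp_le)
    hence "W 1 ^ a * W 1 ^ (b - a) = W 1 ^ a" unfolding that(2) .
    hence "W 1 ^ (b - a) = 1" using nz by simp
    thus ?thesis unfolding root_of_unity_def using that(1) by (intro exI[of _ "b - a"]) simp
  qed
  show ?thesis using *[of n1 n2] *[of n2 n1] n(1) eq by (metis linorder_neqE_nat)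
qed

section \<open>Distribution relations for fractional parts\<close>

lemma frac_add_int: "frac (x + of_int k) = frac x"
  by (simp add: frac_def)

lemma frac_eq_if_diff_int: "x - y = of_int k \<Longrightarrow> frac x = frac (y::real)"
  using frac_add_int[of y k] by (simp add: algebra_simps)

text \<open>Removing a multiple of \<open>1 / l\<close> from \<open>y\<close> leaves
  \<open>y0\<close> with \<open>0 \<le> y0 < 1 / l\<close>. The fractional parts are then the
  numbers \<open>y0 + i / l\<close>, permuted by \<open>\<phi>\<close>.\<close>

lemma sum_frac_shift:
  fixes y :: real
  assumes "l > 0"
  shows "(\<Sum>i<l. frac (y + real i / real l)) = frac (real l * y) + (real l - 1) / 2"
proof -
  define k where "k = \<lfloor>real l * y\<rfloor>"
  define y0 where "y0 = y - of_int k / real l"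
  have y0: "0 \<le> y0" "real l * y0 < 1" and ly0: "real l * y0 = frac (real l * y)"
  proof -
    show eq: "real l * y0 = frac (real l * y)"
      using assms by (simp add: y0_def k_def frac_def field_simps)
    show "real l * y0 < 1" unfolding eq by (rule frac_lt_1)
    have "0 \<le> real l * y0" unfolding eq by simp
    thus "0 \<le> y0" using assms by (simp add: zero_le_mult_iff)
  qed
  define \<phi> where "\<phi> i = nat ((int i + k) mod int l)" for i
  have inj: "inj_on \<phi> {..<l}"
  proof (rule inj_onI)
    fix i j assume ij: "i \<in> {..<l}" "j \<in> {..<l}" "\<phi> i = \<phi> j"
    hence "(int i + k) mod int l = (int j + k) mod int l"
      using assms by (simp add: \<phi>_def nat_eq_iff)
    hence "int i mod int l = int j mod int l" by (metis cong_add_rcancel cong_def)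
    thus "i = j" using ij by simp
  qed
  moreover have "\<phi> ` {..<l} \<subseteq> {..<l}" using assms by (auto simp: \<phi>_def nat_less_iff)
  ultimately have bij: "bij_betw \<phi> {..<l} {..<l}"
    by (simp add: bij_betw_def endo_inj_surj)
  have "frac (y + real i / real l) = y0 + real (\<phi> i) / real l" if "i < l" for i
  proof -
    have "y + real i / real l = y0 + of_int (int i + k) / real l"
      by (simp add: y0_def add_divide_distrib)
    also have "of_int (int i + k) / real l = of_int ((int i + k) div int l) + real (\<phi> i) / real l"
    proof -
      have "int i + k = int l * ((int i + k) div int l) + int (\<phi> i)"
        using assms by (simp add: \<phi>_def)
      hence "real_of_int (int i + k) = real l * of_int ((int i + k) div int l) + real (\<phi> i)"
        by (metis of_int_add of_int_mult of_int_of_nat_eq)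
      thus ?thesis using assms by (simp add: field_simps)
    qed
    finally have eq: "y + real i / real l = (y0 + real (\<phi> i) / real l) + of_int ((int i + k) div int l)"
      by simp
    have "(int i + k) mod int l < int l" using assms by simp
    hence "\<phi> i < l" using assms by (simp add: \<phi>_def nat_less_iff)
    hence "real (\<phi> i) + 1 \<le> real l" by linarith
    moreover have "real l * (y0 + real (\<phi> i) / real l) = real l * y0 + real (\<phi> i)"
      using assms by (simp add: distrib_left)
    ultimately have "real l * (y0 + real (\<phi> i) / real l) < real l * 1" using y0(2) by linarith
    hence "y0 + real (\<phi> i) / real l < 1"
      using assms mult_less_cancel_left_pos[of "real l"] by simp
    moreover have "0 \<le> y0 + real (\<phi> i) / real l" using y0(1) by simp
    ultimately have "frac (y0 + real (\<phi> i) / real l) = y0 + real (\<phi> i) / real l"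
      by (simp add: frac_eq)
    thus ?thesis unfolding eq by (simp only: frac_add_int)
  qed
  hence "(\<Sum>i<l. frac (y + real i / real l)) = (\<Sum>i<l. y0 + real (\<phi> i) / real l)" by simp
  also have "\<dots> = (\<Sum>i<l. y0 + real i / real l)"
    using sum.reindex_bij_betw[OF bij, of "\<lambda>i. y0 + real i / real l"] .
  also have "\<dots> = real l * y0 + (\<Sum>i<l. real i) / real l"
    by (simp add: sum.distrib sum_divide_distrib)
  also have "(\<Sum>i<l. real i) = real l * (real l - 1) / 2"
    by (induction l) (auto simp: algebra_simps add_divide_distrib diff_divide_distrib)
  finally show ?thesis using ly0 assms by simp
qed

text \<open>The function \<open>B\<close> of the overview. As \<open>frac\<close> vanishes at
  integers, an integer \<open>p ^ j * x\<close> contributes \<open>- 1/2\<close> and not 0, so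
  oddness holds only where no term is an integer.\<close>

definition frac_orbit :: "nat \<Rightarrow> nat \<Rightarrow> real \<Rightarrow> real" where
  "frac_orbit p f x = (\<Sum>j<f. frac (real p ^ j * x) - 1/2)"

lemma frac_orbit_cong:
  assumes "x - y = of_int k"
  shows "frac_orbit p f x = frac_orbit p f y"
  unfolding frac_orbit_def
proof (intro sum.cong refl)
  fix j
  have "real p ^ j * x - real p ^ j * y = of_int (int p ^ j * k)"
    using assms by (simp flip: right_diff_distrib)
  thus "frac (real p ^ j * x) - 1/2 = frac (real p ^ j * y) - 1/2"
    by (metis frac_eq_if_diff_int)
qed

text \<open>Multiplication by \<open>p ^ j\<close> permutes the classes modulo \<open>l\<close>, so
  each \<open>j\<close> is an instance of \<open>sum_frac_shift\<close>, whose constant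
  \<open>(l - 1) / 2\<close> absorbs all but one of the shifts by \<open>1/2\<close>.\<close>

lemma frac_orbit_distribution:
  assumes "coprime p l" "l > 0"
  shows "(\<Sum>i<l. frac_orbit p f (x + real i / real l)) = frac_orbit p f (real l * x)"
proof -
  have "(\<Sum>i<l. frac (real p ^ j * (x + real i / real l)) - 1/2) = frac (real p ^ j * (real l * x)) - 1/2" for j
  proof -
    define \<phi> where "\<phi> i = (p ^ j * i) mod l" for i
    have inj: "inj_on \<phi> {..<l}"
    proof (rule inj_onI)
      fix a b assume ab: "a \<in> {..<l}" "b \<in> {..<l}" "\<phi> a = \<phi> b"
      hence "[p ^ j * a = p ^ j * b] (mod l)" by (simp add: \<phi>_def cong_def)
      moreover have "coprime (p ^ j) l" using assms by simp
      ultimately have "[a = b] (mod l)" by (simp only: cong_mult_lcancel_nat)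
      thus "a = b" using ab by (simp add: cong_def)
    qed
    moreover have "\<phi> ` {..<l} \<subseteq> {..<l}" using assms by (auto simp: \<phi>_def)
    ultimately have bij: "bij_betw \<phi> {..<l} {..<l}"
      by (simp add: bij_betw_def endo_inj_surj)
    have "frac (real p ^ j * (x + real i / real l)) = frac (real p ^ j * x + real (\<phi> i) / real l)" for i
    proof (rule frac_eq_if_diff_int)
      have "real (p ^ j * i) = real l * real ((p ^ j * i) div l) + real (\<phi> i)"
        unfolding \<phi>_def by (metis div_mult_mod_eq mult.commute of_nat_add of_nat_mult)
      hence "real p ^ j * real i / real l = real ((p ^ j * i) div l) + real (\<phi> i) / real l"
        using assms by (simp add: field_simps)
      thus "real p ^ j * (x + real i / real l) - (real p ^ j * x + real (\<phi> i) / real l)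
        = of_int (int ((p ^ j * i) div l))" by (simp add: algebra_simps)
    qed
    hence "(\<Sum>i<l. frac (real p ^ j * (x + real i / real l)) - 1/2)
      = (\<Sum>i<l. frac (real p ^ j * x + real (\<phi> i) / real l)) - real l / 2"
      by (simp add: sum_subtractf)
    also have "(\<Sum>i<l. frac (real p ^ j * x + real (\<phi> i) / real l)) = (\<Sum>i<l. frac (real p ^ j * x + real i / real l))"
      using sum.reindex_bij_betw[OF bij, of "\<lambda>i. frac (real p ^ j * x + real i / real l)"] .
    also have "\<dots> = frac (real l * (real p ^ j * x)) + (real l - 1) / 2"
      by (rule sum_frac_shift[OF assms(2)])
    finally show ?thesis by (simp add: field_simps)
  qed
  thus ?thesis unfolding frac_orbit_def by (subst sum.swap) simp
qed

lemma frac_orbit_uminus: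
  assumes "\<And>j. j < f \<Longrightarrow> real p ^ j * x \<notin> \<int>"
  shows "frac_orbit p f (- x) = - frac_orbit p f x"
proof -
  have "frac (real p ^ j * (- x)) - 1/2 = - (frac (real p ^ j * x) - 1/2)" if "j < f" for j
    using frac_neg[of "real p ^ j * x"] assms[OF that] by simp
  thus ?thesis unfolding frac_orbit_def by (simp flip: sum_negf)
qed

text \<open>The hypothesis makes the orbit periodic with period \<open>f\<close> modulo 1, so
  multiplication by \<open>p\<close> rotates the sum.\<close>

lemma frac_orbit_mult_p:
  assumes "(real p ^ f - 1) * x \<in> \<int>"
  shows "frac_orbit p f (real p ^ e * x) = frac_orbit p f x"
proof -
  have step: "frac_orbit p f (real p * x) = frac_orbit p f x" if x: "(real p ^ f - 1) * x \<in> \<int>" for x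
  proof -
    obtain k where k: "(real p ^ f - 1) * x = of_int k" using x by (auto elim: Ints_cases)
    have "frac (real p ^ f * x) = frac x"
      by (rule frac_eq_if_diff_int[of _ _ k]) (use k in \<open>simp add: algebra_simps\<close>)
    hence "(\<Sum>j<f. frac (real p ^ Suc j * x) - 1/2) = (\<Sum>j<f. frac (real p ^ j * x) - 1/2)"
      using sum.lessThan_Suc_shift[of "\<lambda>j. frac (real p ^ j * x) - 1/2" f]
        sum.lessThan_Suc[of "\<lambda>j. frac (real p ^ j * x) - 1/2" f] by simp
    thus ?thesis unfolding frac_orbit_def by (simp add: mult_ac)
  qed
  show ?thesis
  proof (induction e)
    case (Suc e)
    have "(real p ^ f - 1) * (real p ^ e * x) = of_nat (p ^ e) * ((real p ^ f - 1) * x)" by simp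
    also have "\<dots> \<in> \<int>" by (rule Ints_mult[OF Ints_of_nat assms])
    finally show ?case using step[of "real p ^ e * x"] Suc by (simp add: mult.assoc)
  qed simp
qed

text \<open>Exponents count modulo the periods, so the Chinese remainder theorem for exponents lets
  the two components move independently. A period 0 forces the other period to be 1, and then
  \<open>p\<close> is 1 for that modulus.\<close>

lemma cong_power_crt:
  fixes p m M F1 F2 :: nat
  assumes "[p ^ F1 = 1] (mod m)" "[p ^ F2 = 1] (mod M)" "coprime F1 F2"
  shows "\<exists>e. [p ^ e = p ^ e1] (mod m) \<and> [p ^ e = p ^ e2] (mod M)"
proof (cases "F1 = 0 \<or> F2 = 0")
  case True
  thus ?thesis
  proof
    assume "F1 = 0"
    hence "[p ^ 1 = 1] (mod M)" using assms by simp
    hence "[p ^ e = 1] (mod M)" for e using cong_pow[of "p ^ 1" 1 M e] by simp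
    from cong_trans[OF this[of e1] cong_sym[OF this[of e2]]]
    show ?thesis by (intro exI[of _ e1]) simp
  next
    assume "F2 = 0"
    hence "[p ^ 1 = 1] (mod m)" using assms by simp
    hence "[p ^ e = 1] (mod m)" for e using cong_pow[of "p ^ 1" 1 m e] by simp
    from cong_trans[OF this[of e2] cong_sym[OF this[of e1]]]
    show ?thesis by (intro exI[of _ e2]) simp
  qed
next
  case False
  obtain e where e: "[e = e1] (mod F1)" "[e = e2] (mod F2)"
    using binary_chinese_remainder_nat[OF assms(3)] by blast
  have *: "[p ^ a = p ^ b] (mod n)" if "[a = b] (mod k)" "[p ^ k = 1] (mod n)" for a b k n
  proof -
    have "[p ^ a = p ^ (a mod k)] (mod n)" for a
    proof -
      have "p ^ a = (p ^ k) ^ (a div k) * p ^ (a mod k)"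
        by (simp flip: power_mult power_add)
      moreover have "[(p ^ k) ^ (a div k) * p ^ (a mod k) = 1 ^ (a div k) * p ^ (a mod k)] (mod n)"
        by (intro cong_mult cong_pow that(2) cong_refl)
      ultimately show ?thesis by simp
    qed
    from this[of a] this[of b] show ?thesis using that(1) unfolding cong_def by metis
  qed
  show ?thesis using *[OF e(1) assms(1)] *[OF e(2) assms(2)] by blast
qed

text \<open>As the order of \<open>p\<close> is odd, \<open>- 1\<close> is not a power of
  \<open>p\<close>. So the powers \<open>A\<close> and their negatives \<open>B\<close> are disjoint
  sets of \<open>ord m p\<close> residues each, and together exhaust the units.\<close>

lemma unit_mod_index_two:
  fixes m p :: nat and c :: int
  assumes "m > 2" "coprime p m" "totient m = 2 * ord m p" "odd (ord m p)" "coprime c (int m)"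
  shows "\<exists>e. [c = int p ^ e] (mod int m) \<or> [c = - (int p ^ e)] (mod int m)"
proof -
  define k where "k = ord m p"
  define A where "A = (\<lambda>e. p ^ e mod m) ` {..<k}"
  define B where "B = (\<lambda>a. m - a) ` A"
  have A1: "a \<in> totatives m" "a < m" if "a \<in> A" for a
  proof -
    obtain e where e: "a = p ^ e mod m" using \<open>a \<in> A\<close> unfolding A_def by blast
    have cop: "coprime a m" unfolding e using assms by (simp add: coprime_commute)
    hence "a \<noteq> 0" using assms(1) by (intro notI) simp
    thus "a \<in> totatives m" "a < m" using cop assms(1) by (auto simp: totatives_def e less_imp_le)
  qed
  have B1: "b \<in> totatives m" if "b \<in> B" for b
  proof -
    obtain a where a: "a \<in> A" "b = m - a" using \<open>b \<in> B\<close> unfolding B_def by blast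
    have "coprime (m - a) m"
    proof (rule coprimeI)
      fix d assume d: "d dvd m - a" "d dvd m"
      hence "d dvd a" using A1(2)[OF a(1)] by (meson dvd_diffD1 less_imp_le)
      thus "is_unit d" using d(2) A1(1)[OF a(1)] coprime_common_divisor[of a m d]
        by (simp add: totatives_def)
    qed
    thus ?thesis using A1[OF a(1)] a(2) by (auto simp: totatives_def)
  qed
  have cA: "card A = k"
  proof -
    have "inj_on (\<lambda>e. p ^ e mod m) {..<k}"
      using inj_power_mod[of m p] assms(2) unfolding k_def by (simp add: coprime_commute)
    thus ?thesis by (simp add: A_def card_image)
  qed
  have cB: "card B = k"
  proof -
    have "inj_on (\<lambda>a. m - a) A"
    proof (rule inj_onI)
      fix a b assume "a \<in> A" "b \<in> A" "m - a = m - b"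
      thus "a = b" using A1(2)[of a] A1(2)[of b] by linarith
    qed
    thus ?thesis using cA by (simp add: B_def card_image)
  qed
  have neg: "\<not> [p ^ e = m - 1] (mod m)" for e
  proof
    assume "[p ^ e = m - 1] (mod m)"
    hence "[int p ^ e = int (m - 1)] (mod int m)" by (simp only: cong_int_iff flip: of_nat_power)
    moreover have "[int (m - 1) = - 1] (mod int m)" using assms(1) by (simp add: cong_iff_dvd_diff of_nat_diff)
    ultimately have n: "[int p ^ e = - 1] (mod int m)" by (rule cong_trans)
    have "[(int p ^ e) ^ k = (- 1) ^ k] (mod int m)" by (rule cong_pow[OF n])
    moreover have "(int p ^ e) ^ k = int ((p ^ k) ^ e)" by (simp add: mult.commute flip: power_mult)
    moreover have "[int ((p ^ k) ^ e) = int (1 ^ e)] (mod int m)"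
      unfolding cong_int_iff by (intro cong_pow) (unfold k_def, rule ord)
    ultimately have "[1 = (- 1) ^ k] (mod int m)"
      by (simp only: power_one of_nat_1) (metis cong_sym cong_trans)
    hence "[1 = - 1] (mod int m)" using assms(4) unfolding k_def by simp
    hence "int m dvd 2" by (simp add: cong_iff_dvd_diff)
    hence "int m \<le> 2" by (rule zdvd_imp_le) simp
    thus False using assms(1) by simp
  qed
  have "A \<inter> B = {}"
  proof (rule ccontr)
    assume "A \<inter> B \<noteq> {}"
    then obtain e e' where e: "p ^ e mod m = m - p ^ e' mod m" "e' < k" unfolding A_def B_def by blast
    have s: "[p ^ e + p ^ e' = 0] (mod m)"
    proof -
      have "p ^ e mod m + p ^ e' mod m = m" using e(1) assms(1)
        mod_less_divisor[of m "p ^ e'"] by linarith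
      hence "(p ^ e mod m + p ^ e' mod m) mod m = 0" by simp
      thus ?thesis unfolding cong_def by (simp add: mod_add_eq)
    qed
    \<comment> \<open>The factor turns the second summand into \<open>p ^ k\<close>, which is 1
      modulo \<open>m\<close>; so \<open>- 1\<close> would be a power of \<open>p\<close>.\<close>
    have "[p ^ (k - e') * (p ^ e + p ^ e') = p ^ (k - e') * 0] (mod m)" by (intro cong_mult s cong_refl)
    hence "[p ^ (k - e' + e) + p ^ k = 0] (mod m)" using e(2) by (simp add: distrib_left flip: power_add)
    moreover have "[p ^ (k - e' + e) + p ^ k = p ^ (k - e' + e) + 1] (mod m)"
      by (intro cong_add cong_refl) (unfold k_def, rule ord)
    ultimately have "[p ^ (k - e' + e) + 1 = 0] (mod m)" by (metis cong_sym cong_trans)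
    moreover have "[m - 1 + 1 = 0] (mod m)" using assms(1) by (simp add: cong_def)
    ultimately have "[p ^ (k - e' + e) + 1 = m - 1 + 1] (mod m)" by (metis cong_sym cong_trans)
    hence "[p ^ (k - e' + e) = m - 1] (mod m)" by (simp only: cong_add_rcancel_nat)
    thus False using neg by blast
  qed
  hence "card (A \<union> B) = totient m" using cA cB assms(3) card_Un_disjoint[of A B]
    by (simp add: A_def B_def k_def)
  moreover have "A \<union> B \<subseteq> totatives m" using A1 B1 by blast
  ultimately have AB: "A \<union> B = totatives m"
    by (intro card_subset_eq) (auto simp: totient_def)
  define c' where "c' = nat (c mod int m)"
  have c': "[c = int c'] (mod int m)" using assms(1) by (simp add: c'_def cong_def)
  have "coprime (int c') (int m)" using cong_imp_coprime[OF c'] assms(5) by blast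
  hence cop: "coprime c' m" by simp
  have "c' < m" using assms(1) by (simp add: c'_def nat_less_iff)
  moreover have "c' \<noteq> 0" using cop assms(1) by (cases "c' = 0") auto
  ultimately have "c' \<in> A \<union> B" using cop AB by (simp add: totatives_def)
  thus ?thesis
  proof
    assume "c' \<in> A"
    then obtain e where "c' = p ^ e mod m" unfolding A_def by blast
    hence "[int c' = int (p ^ e)] (mod int m)" unfolding cong_int_iff by (simp add: cong_def)
    thus ?thesis using cong_trans[OF c'] by auto
  next
    assume "c' \<in> B"
    then obtain e where e: "c' = m - p ^ e mod m" unfolding A_def B_def by blast
    have "int c' = int m - int (p ^ e) mod int m" using e assms(1)
      by (simp add: of_nat_diff zmod_int less_imp_le)
    moreover have "int (p ^ e) = int m * (int (p ^ e) div int m) + int (p ^ e) mod int m"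
      by (rule mult_div_mod_eq[symmetric])
    ultimately have "int c' - (- (int p ^ e)) = int m + int m * (int (p ^ e) div int m)"
      by (simp only: of_nat_power)
    hence "int c' - (- (int p ^ e)) = int m * (1 + int (p ^ e) div int m)"
      by (simp only: distrib_left mult_1_right)
    hence "[int c' = - (int p ^ e)] (mod int m)"
      unfolding cong_iff_dvd_diff by simp
    thus ?thesis using cong_trans[OF c'] by auto
  qed
qed

lemma sum_units_prime_power:
  fixes h :: "nat \<Rightarrow> real"
  assumes "Factorial_Ring.prime q" "u \<ge> 1"
  shows "(\<Sum>c | c < q ^ u \<and> coprime c q. h c) = (\<Sum>c<q ^ u. h c) - (\<Sum>i<q ^ (u - 1). h (q * i))"
proof -
  have q0: "q > 0" using assms(1) by (rule prime_gt_0_nat)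
  have qu: "q ^ u = q * q ^ (u - 1)" using assms(2) by (cases u) auto
  have cop: "coprime c q \<longleftrightarrow> \<not> q dvd c" for c
    using assms(1) by (metis coprime_commute prime_imp_coprime coprime_absorb_left not_prime_unit)
  have split: "{..<q ^ u} = {c. c < q ^ u \<and> coprime c q} \<union> (*) q ` {..<q ^ (u - 1)}"
    using q0 by (auto simp: cop qu elim!: dvdE)
  have "(\<Sum>c<q ^ u. h c) = (\<Sum>c | c < q ^ u \<and> coprime c q. h c) + sum h ((*) q ` {..<q ^ (u - 1)})"
    by (rule trans[OF arg_cong[OF split, of "sum h"] sum.union_disjoint]) (auto simp: cop)
  moreover have "sum h ((*) q ` {..<q ^ (u - 1)}) = (\<Sum>i<q ^ (u - 1). h (q * i))"
    using q0 by (subst sum.reindex) (auto simp: inj_on_def)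
  ultimately show ?thesis by simp
qed

text \<open>\<open>q\<close>, \<open>u\<close>, \<open>m\<close> stand for the distinguished prime
  power and \<open>M\<close> for the product of the others chosen by \<open>J\<close>. Since
  property (star) keeps \<open>f\<close> fixed while the modulus varies, \<open>f\<close> enters as
  a common period; \<open>F\<close> is a period modulo \<open>M\<close> prime to the order modulo
  \<open>m\<close>.\<close>

locale two_blocks =
  fixes p f q u m M F e2 e3 e4 :: nat
  assumes q: "Factorial_Ring.prime q" "odd q" and u: "u \<ge> 1" and m_def: "m = q ^ u"
    and M: "odd M" "coprime m M" and cop_p: "coprime p m" "coprime p M"
    and dvd: "m * M dvd p ^ f - 1" and p_odd: "odd p"
    and index: "totient m = 2 * ord m p" "odd (ord m p)"
    and F: "[p ^ F = 1] (mod M)" "coprime (ord m p) F"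
    and two: "[2 = int p ^ e2] (mod int m)"
    and minus_two: "[- 2 = int p ^ e3] (mod int M)"
    and q_pow: "[int q = int p ^ e4] (mod int M)"
begin

definition S :: "int \<Rightarrow> int \<Rightarrow> real" where
  "S a b = frac_orbit p f (of_int a / real m + of_int b / real M)"

lemma m_gt_2: "m > 2"
proof -
  have "q > 2" using q prime_gt_1_nat[of q] by (cases "q = 2") auto
  moreover have "q ^ 1 \<le> q ^ u" using u q prime_gt_0_nat[of q] by (intro power_increasing) auto
  ultimately show ?thesis by (simp add: m_def)
qed

lemma M_pos: "M > 0" using M by (cases "M = 0") auto

lemma S_cong:
  assumes "[a = a'] (mod int m)" "[b = b'] (mod int M)"
  shows "S a b = S a' b'"
proof -
  obtain k l where kl: "a - a' = int m * k" "b - b' = int M * l"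
    using assms by (auto simp: cong_iff_dvd_diff elim!: dvdE)
  have "real_of_int a = real_of_int a' + real m * of_int k" "real_of_int b = real_of_int b' + real M * of_int l"
    using arg_cong[OF kl(1), of real_of_int] arg_cong[OF kl(2), of real_of_int] by simp_all
  hence "(of_int a / real m + of_int b / real M) - (of_int a' / real m + of_int b' / real M) = of_int (k + l)"
    using m_gt_2 M_pos by (simp add: field_simps)
  thus ?thesis unfolding S_def by (rule frac_orbit_cong)
qed

lemma orbit_int: "(real p ^ f - 1) * (of_int a / real m + of_int b / real M) \<in> \<int>"
proof -
  obtain k where k: "p ^ f - 1 = m * M * k" using dvd by (elim dvdE)
  have "real (p ^ f - 1) = real p ^ f - 1" using odd_pos[OF p_odd] by (subst of_nat_diff) auto
  hence "real p ^ f - 1 = real m * real M * real k" using k by (metis of_nat_mult)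
  hence "(real p ^ f - 1) * (of_int a / real m + of_int b / real M) = of_int (int k * (a * int M + b * int m))"
    using m_gt_2 M_pos by (simp add: field_simps)
  thus ?thesis by (metis Ints_of_int)
qed

text \<open>One power \<open>p ^ e\<close> agrees with \<open>p ^ i\<close> modulo \<open>m\<close>
  and with \<open>p ^ j\<close> modulo \<open>M\<close>, and multiplying both coordinates by it
  rotates the orbit.\<close>

lemma S_mult_powers: "S (int p ^ i * a) (int p ^ j * b) = S a b"
proof -
  have "[p ^ ord m p = 1] (mod m)" by (rule ord)
  from cong_power_crt[OF this F(1,2), of i j] obtain e
    where e: "[p ^ e = p ^ i] (mod m)" "[p ^ e = p ^ j] (mod M)" by blast
  have "S (int p ^ i * a) (int p ^ j * b) = S (int p ^ e * a) (int p ^ e * b)"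
    using e by (intro S_cong cong_mult cong_refl) (simp_all add: cong_sym flip: of_nat_power cong_int_iff)
  also have "\<dots> = frac_orbit p f (real p ^ e * (of_int a / real m + of_int b / real M))"
    unfolding S_def by (simp add: algebra_simps)
  also have "\<dots> = S a b" unfolding S_def by (rule frac_orbit_mult_p[OF orbit_int])
  finally show ?thesis .
qed

lemma S_mult:
  assumes "[x = int p ^ i] (mod int m)" "[y = int p ^ j] (mod int M)"
  shows "S (x * a) (y * b) = S a b"
  using S_cong[of "x * a" "int p ^ i * a" "y * b" "int p ^ j * b"] S_mult_powers assms
  by (simp add: cong_scalar_right)

text \<open>With \<open>a\<close> prime to \<open>m\<close> no point of the orbit is an integer, as
  oddness of \<open>frac_orbit\<close> requires.\<close>

lemma S_uminus:
  assumes "coprime a (int m)"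
  shows "S (- a) (- b) = - S a b"
proof -
  have "real p ^ j * (of_int a / real m + of_int b / real M) \<notin> \<int>" for j
  proof
    assume "real p ^ j * (of_int a / real m + of_int b / real M) \<in> \<int>"
    then obtain k where "real p ^ j * (of_int a / real m + of_int b / real M) = of_int k"
      by (auto elim: Ints_cases)
    hence "real p ^ j * (of_int a * real M + of_int b * real m) = of_int k * real m * real M"
      using m_gt_2 M_pos by (simp add: field_simps)
    hence "real_of_int (int p ^ j * (a * int M + b * int m)) = real_of_int (k * int m * int M)" by simp
    hence "int p ^ j * (a * int M + b * int m) = k * int m * int M" by (simp only: of_int_eq_iff)
    hence "int p ^ j * a * int M = int m * (k * int M - int p ^ j * b)" by (simp add: algebra_simps)
    hence "int m dvd int p ^ j * a * int M" by simp
    moreover have "coprime (int m) (int p ^ j * a * int M)"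
      using assms M cop_p by (simp add: coprime_commute)
    ultimately have "is_unit (int m)" by (metis coprime_absorb_left)
    thus False using m_gt_2 by simp
  qed
  hence "frac_orbit p f (- (of_int a / real m + of_int b / real M)) = - S a b"
    unfolding S_def by (intro frac_orbit_uminus) auto
  thus ?thesis unfolding S_def by (simp add: algebra_simps)
qed

text \<open>The distribution relation with \<open>l = q ^ v\<close> multiplies the second coordinate
  by \<open>q ^ v\<close>. This is a power of \<open>p\<close> modulo \<open>M\<close> and can be
  removed; here the hypothesis on \<open>q\<close> enters.\<close>

lemma sum_S_block:
  assumes "q ^ v dvd m"
  shows "(\<Sum>i<q ^ v. S (int (m div q ^ v * i)) b) = S 0 b"
proof -
  obtain w where w: "m = q ^ v * w" using assms by (elim dvdE)
  have qv: "q ^ v > 0" "w > 0" using q m_gt_2 w prime_gt_0_nat[of q] by (auto intro!: Nat.gr0I)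
  have "coprime p (q ^ v)" using cop_p(1) by (simp add: w)
  from frac_orbit_distribution[OF this qv(1), of f "of_int b / real M"]
  have "(\<Sum>i<q ^ v. frac_orbit p f (of_int b / real M + real i / real (q ^ v))) = S 0 (int q ^ v * b)"
    by (simp add: S_def)
  also have "S 0 (int q ^ v * b) = S 0 b"
  proof -
    have "[int q ^ v = int p ^ (e4 * v)] (mod int M)"
      unfolding power_mult by (intro cong_pow q_pow)
    thus ?thesis using S_mult[of 1 0 "int q ^ v" "e4 * v" 0 b] by simp
  qed
  finally show ?thesis unfolding S_def using qv by (simp add: w add.commute)
qed

text \<open>The units are all classes minus the multiples of \<open>q\<close>; the block sums for
  \<open>v = u\<close> and \<open>v = u - 1\<close> both equal \<open>S 0 b\<close> and
  cancel.\<close>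

lemma sum_S_units: "(\<Sum>c | c < m \<and> coprime c q. S (int c) b) = 0"
proof -
  have q0: "q > 0" using q(1) by (rule prime_gt_0_nat)
  have mq: "m = q * q ^ (u - 1)" using u by (cases u) (auto simp: m_def)
  have "(\<Sum>c<q ^ u. S (int c) b) = S 0 b"
    using sum_S_block[of u b] m_gt_2 unfolding m_def[symmetric] by simp
  moreover have "(\<Sum>i<q ^ (u - 1). S (int (q * i)) b) = S 0 b"
  proof -
    have "q ^ (u - 1) dvd m" "m div q ^ (u - 1) = q" using q0 by (simp_all add: mq)
    from sum_S_block[OF this(1), of b, unfolded this(2)] show ?thesis .
  qed
  ultimately show ?thesis
    using sum_units_prime_power[OF q(1) u, of "\<lambda>c. S (int c) b"] by (simp add: m_def)
qed

text \<open>Every unit is plus or minus a power of \<open>p\<close>, so the symmetric sum takes a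
  single value.\<close>

lemma S_pm:
  assumes "coprime c (int m)"
  shows "S c b + S (- c) b = S 1 b + S (- 1) b"
proof -
  have *: "S (int p ^ e) b = S 1 b" "S (- (int p ^ e)) b = S (- 1) b" for e
    using S_mult_powers[of e 1 0 b] S_mult_powers[of e "- 1" 0 b] by simp_all
  obtain e where "[c = int p ^ e] (mod int m) \<or> [c = - (int p ^ e)] (mod int m)"
    using unit_mod_index_two[OF m_gt_2 cop_p(1) index assms] by blast
  thus ?thesis
  proof
    assume c: "[c = int p ^ e] (mod int m)"
    hence "[- c = - (int p ^ e)] (mod int m)" by (simp add: cong_minus_minus_iff)
    with c S_cong[of c "int p ^ e" b b] S_cong[of "- c" "- (int p ^ e)" b b] * show ?thesis by simp
  next
    assume c: "[c = - (int p ^ e)] (mod int m)"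
    hence "[- c = int p ^ e] (mod int m)" using cong_minus_minus_iff[of "- c" "int p ^ e"] by simp
    with c S_cong[of c "- (int p ^ e)" b b] S_cong[of "- c" "int p ^ e" b b] * show ?thesis by simp
  qed
qed

text \<open>The map \<open>c \<mapsto> m - c\<close> pairs the summands of
  \<open>sum_S_units\<close>, and by \<open>S_pm\<close> all pairs have the same sum, which is
  therefore 0.\<close>

lemma S_opposite:
  assumes "coprime c (int m)"
  shows "S (- c) b = - S c b"
proof -
  define U where "U = {c. c < m \<and> coprime c q}"
  have q0: "q > 0" using q(1) by (rule prime_gt_0_nat)
  have U: "coprime (int c) (int m)" "c < m" "c > 0" if "c \<in> U" for c
    using that q m_gt_2 by (auto simp: U_def m_def intro!: Nat.gr0I)
  have copm: "coprime (m - c) q" if "c \<in> U" for c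
  proof (rule coprimeI)
    fix d assume d: "d dvd m - c" "d dvd q"
    have "q dvd m" using u by (auto simp: m_def)
    hence "d dvd c" using d dvd_diffD1[of d m c] U(2)[OF that] by (meson dvd_trans less_imp_le)
    thus "is_unit d" using d(2) that coprime_common_divisor[of c q d] by (simp add: U_def)
  qed
  have "bij_betw (\<lambda>c. m - c) U U"
  proof (rule bij_betwI[where g = "\<lambda>c. m - c"])
    have "m - c \<in> U" if "c \<in> U" for c
      using copm[OF that] U(2,3)[OF that] unfolding U_def by simp
    thus "(\<lambda>c. m - c) \<in> U \<rightarrow> U" "(\<lambda>c. m - c) \<in> U \<rightarrow> U" by blast+
    have "m - (m - c) = c" if "c \<in> U" for c using U(2)[OF that] by linarith
    thus "\<And>c. c \<in> U \<Longrightarrow> m - (m - c) = c" "\<And>c. c \<in> U \<Longrightarrow> m - (m - c) = c" by blast+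
  qed
  hence "(\<Sum>c\<in>U. S (int (m - c)) b) = (\<Sum>c\<in>U. S (int c) b)"
    by (rule sum.reindex_bij_betw)
  moreover have "S (int (m - c)) b = S (- int c) b" if "c \<in> U" for c
    using U[OF that] by (intro S_cong) (auto simp: cong_iff_dvd_diff of_nat_diff)
  ultimately have "(\<Sum>c\<in>U. S (int c) b + S (- int c) b) = 0"
    using sum_S_units[of b] by (simp add: U_def sum.distrib)
  moreover have "S (int c) b + S (- int c) b = S 1 b + S (- 1) b" if "c \<in> U" for c
    by (rule S_pm[OF U(1)[OF that]])
  ultimately have "real (card U) * (S 1 b + S (- 1) b) = 0" by simp
  moreover have "1 \<in> U" using m_gt_2 by (simp add: U_def)
  hence "card U \<noteq> 0" by (auto simp: U_def)
  ultimately have "S 1 b + S (- 1) b = 0" by simp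
  thus ?thesis using S_pm[OF assms, of b] by simp
qed

text \<open>Modulo \<open>m\<close> the factor 2 is a power of \<open>p\<close> and drops out;
  modulo \<open>M\<close> it is minus a power of \<open>p\<close> and leaves a sign. Oddness and
  \<open>S_opposite\<close> then contribute one change of sign each.\<close>

lemma S_double:
  assumes "coprime a (int m)"
  shows "S (2 * a) (2 * b) = S a b"
proof -
  have "S (2 * a) (2 * b) = S a (- b)" using S_mult[OF two minus_two, of a "- b"] by simp
  also have "\<dots> = - S (- a) b" using S_uminus[of "- a" b] assms by simp
  finally show ?thesis using S_opposite[OF assms, of b] by simp
qed

text \<open>With \<open>2 * c = b + m * M\<close> and \<open>y = c / (m * M)\<close> the fraction is
  \<open>y + 1 / 2\<close> modulo 1. The distribution relation for \<open>l = 2\<close> compares it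
  with \<open>y\<close> and \<open>2 * y\<close>, where \<open>S_double\<close> gives equal
  values.\<close>

theorem frac_orbit_half:
  assumes b: "coprime b (2 * m * M)"
  shows "frac_orbit p f (real b / real (2 * m * M)) = 0"
proof -
  have odd_m: "odd m" using q by (simp add: m_def)
  have "odd b" using b by simp
  hence "even (b + m * M)" using odd_m M(1) by simp
  then obtain c where c: "b + m * M = 2 * c" by (elim evenE)
  \<comment> \<open>Partial fractions: \<open>c / (m * M) = c1 / m + c2 / M\<close>.\<close>
  obtain s t where st: "s * int m + t * int M = 1"
    using bezout_int[of "int m" "int M"] M(2) by (metis coprime_iff_gcd_eq_1 coprime_int_iff)
  define c1 where "c1 = int c * t"
  define c2 where "c2 = int c * s"
  have c12: "int c = c1 * int M + c2 * int m"
    using arg_cong[OF st, of "\<lambda>x. int c * x"] by (simp add: c1_def c2_def algebra_simps)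
  have "coprime c1 (int m)"
  proof (rule coprimeI)
    fix d assume d: "d dvd c1" "d dvd int m"
    hence "d dvd int c" unfolding c12 by simp
    hence "d dvd 2 * int c - int m * int M" using d by simp
    moreover have "int b = 2 * int c - int m * int M" using arg_cong[OF c, of int] by simp
    ultimately have "d dvd int b" by simp
    moreover have "coprime (int b) (int m)" using b by simp
    ultimately show "is_unit d" using d(2) coprime_common_divisor by blast
  qed
  hence "S (2 * c1) (2 * c2) = S c1 c2" by (rule S_double)
  moreover define y where "y = of_int c1 / real m + of_int c2 / real M"
  ultimately have "frac_orbit p f (2 * y) = frac_orbit p f y"
    by (simp add: S_def algebra_simps)
  moreover have "frac_orbit p f y + frac_orbit p f (y + 1 / 2) = frac_orbit p f (2 * y)"
  proof -
    have two: "(\<Sum>i<2. h i) = h 0 + h 1" for h :: "nat \<Rightarrow> real" by (simp add: numeral_2_eq_2)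
    have "coprime p 2" using p_odd by simp
    from frac_orbit_distribution[OF this, of f y] show ?thesis unfolding two by simp
  qed
  ultimately have "frac_orbit p f (y + 1 / 2) = 0" by simp
  moreover have "y + 1 / 2 - real b / real (2 * m * M) = of_int 1"
  proof -
    have "real c = of_int c1 * real M + of_int c2 * real m"
      using arg_cong[OF c12, of real_of_int] by simp
    moreover have "real b = 2 * real c - real m * real M"
      using arg_cong[OF c, of real] by simp
    ultimately have rb: "real b = 2 * (of_int c1 * real M + of_int c2 * real m) - real m * real M" by simp
    have "real (2 * m * M) = 2 * real m * real M" by simp
    thus ?thesis unfolding y_def rb using m_gt_2 M_pos by (simp add: field_simps)
  qed
  hence "frac_orbit p f (y + 1 / 2) = frac_orbit p f (real b / real (2 * m * M))"
    by (rule frac_orbit_cong)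
  ultimately show ?thesis by simp
qed

end

section \<open>Purity from balanced digit sums\<close>

lemma frac_of_nat_div: "frac (real a / real n) = real (a mod n) / real n"
proof (cases "n = 0")
  case False
  have "real a = real n * real (a div n) + real (a mod n)"
    by (metis mult_div_mod_eq of_nat_add of_nat_mult)
  hence "real a / real n - real (a mod n) / real n = of_int (int (a div n))"
    using False by (simp add: field_simps)
  hence "frac (real a / real n) = frac (real (a mod n) / real n)" by (rule frac_eq_if_diff_int)
  also have "\<dots> = real (a mod n) / real n" using False by (simp add: frac_eq)
  finally show ?thesis .
qed (simp add: frac_def)

text \<open>The base-\<open>p\<close> digits of \<open>b (p ^ f - 1) / n\<close> are the carries of the orbit of \<open>b\<close> under
  multiplication by \<open>p\<close> modulo \<open>n\<close>.\<close>

lemma digits_of_orbit: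
  fixes p f n b :: nat
  assumes n: "n > 0" and b: "b < n" and p: "p > 0" and dvd: "n dvd p ^ f - 1"
  defines "y \<equiv> \<lambda>j. p ^ j * b mod n"
  defines "d \<equiv> \<lambda>j. p * y j div n"
  shows "(p ^ f - 1) div n * b = (\<Sum>j<f. d j * p ^ (f - 1 - j))"
    and "n * (\<Sum>j<f. d j) = (p - 1) * (\<Sum>j<f. y j)"
proof -
  have step: "p * y j = n * d j + y (Suc j)" for j
  proof -
    have "y (Suc j) = p * y j mod n" unfolding y_def by (simp add: mod_mult_right_eq mult.assoc)
    thus ?thesis unfolding d_def by simp
  qed
  have y0: "y 0 = b" using b by (simp add: y_def)
  obtain m where m: "p ^ f - 1 = n * m" using dvd by (elim dvdE)
  have pf: "p ^ f = n * m + 1" using m p by (metis One_nat_def Suc_eq_plus1 Suc_pred zero_less_power)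
  have yf: "y f = b"
  proof -
    have "y f = (n * (m * b) + b) mod n" unfolding y_def pf by (simp add: algebra_simps)
    thus ?thesis using b by simp
  qed
  \<comment> \<open>Horner form of the first \<open>k\<close> steps of long division; for
    \<open>k = f\<close> the remainder has returned to \<open>b\<close>.\<close>
  have unroll: "p ^ k * b = n * (\<Sum>j<k. d j * p ^ (k - 1 - j)) + y k" for k
  proof (induction k)
    case (Suc k)
    have "(\<Sum>j<Suc k. d j * p ^ (Suc k - 1 - j)) = p * (\<Sum>j<k. d j * p ^ (k - 1 - j)) + d k"
    proof -
      have "(\<Sum>j<k. d j * p ^ (Suc k - 1 - j)) = (\<Sum>j<k. p * (d j * p ^ (k - 1 - j)))"
      proof (intro sum.cong refl)
        fix j assume "j \<in> {..<k}"
        hence "Suc k - 1 - j = Suc (k - 1 - j)" by auto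
        thus "d j * p ^ (Suc k - 1 - j) = p * (d j * p ^ (k - 1 - j))" by simp
      qed
      thus ?thesis by (simp add: sum_distrib_left)
    qed
    hence "n * (\<Sum>j<Suc k. d j * p ^ (Suc k - 1 - j)) + y (Suc k)
      = p * (n * (\<Sum>j<k. d j * p ^ (k - 1 - j))) + (n * d k + y (Suc k))"
      by (simp only: distrib_left mult.left_commute add.assoc)
    also have "\<dots> = p * (p ^ k * b)" unfolding step[symmetric] Suc by (simp only: distrib_left)
    finally show ?case by simp
  qed (simp add: y0)
  have "n * m * b + b = n * (\<Sum>j<f. d j * p ^ (f - 1 - j)) + b"
    using unroll[of f] unfolding yf pf by (simp add: algebra_simps)
  hence "n * (m * b) = n * (\<Sum>j<f. d j * p ^ (f - 1 - j))" by (simp add: mult.assoc)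
  hence "m * b = (\<Sum>j<f. d j * p ^ (f - 1 - j))" using n by simp
  moreover have "(p ^ f - 1) div n = m" unfolding m using n by simp
  ultimately show "(p ^ f - 1) div n * b = (\<Sum>j<f. d j * p ^ (f - 1 - j))" by simp
  \<comment> \<open>Over a full period the remainders are only rotated, so summing
    \<open>step\<close> leaves \<open>p - 1\<close> times their sum.\<close>
  have "(\<Sum>j<f. y (Suc j)) = (\<Sum>j<f. y j)"
    using sum.lessThan_Suc_shift[of y f] sum.lessThan_Suc[of y f] y0 yf by simp
  moreover have "p * (\<Sum>j<f. y j) = n * (\<Sum>j<f. d j) + (\<Sum>j<f. y (Suc j))"
    unfolding sum_distrib_left sum.distrib[symmetric] by (intro sum.cong refl step)
  ultimately have "p * (\<Sum>j<f. y j) = n * (\<Sum>j<f. d j) + (\<Sum>j<f. y j)" by simp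
  thus "n * (\<Sum>j<f. d j) = (p - 1) * (\<Sum>j<f. y j)"
    by (simp add: diff_mult_distrib)
qed

lemma digit_sum_half:
  fixes p f n b :: nat
  assumes n: "n > 0" and b: "b < n" and p: "p > 0" and dvd: "n dvd p ^ f - 1"
    and half: "frac_orbit p f (real b / real n) = 0"
  shows "\<exists>d. (p ^ f - 1) div n * b = (\<Sum>j<f. d j * p ^ (f - 1 - j)) \<and> 2 * (\<Sum>j<f. d j) = f * (p - 1)"
proof -
  define y where "y = (\<lambda>j. p ^ j * b mod n)"
  define d where "d = (\<lambda>j. p * y j div n)"
  have digits: "(p ^ f - 1) div n * b = (\<Sum>j<f. d j * p ^ (f - 1 - j))"
    "n * (\<Sum>j<f. d j) = (p - 1) * (\<Sum>j<f. y j)"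
    unfolding d_def y_def by (rule digits_of_orbit[OF n b p dvd])+
  have "frac (real p ^ j * (real b / real n)) = real (y j) / real n" for j
    using frac_of_nat_div[of "p ^ j * b" n] by (simp add: y_def)
  hence "(\<Sum>j<f. real (y j) / real n) - real f / 2 = 0"
    using half by (simp add: frac_orbit_def sum_subtractf)
  hence "real (2 * (\<Sum>j<f. y j)) = real (n * f)"
    using n by (simp add: field_simps flip: sum_divide_distrib)
  hence y2: "2 * (\<Sum>j<f. y j) = n * f" by (simp only: of_nat_eq_iff)
  have "n * (2 * (\<Sum>j<f. d j)) = (p - 1) * (2 * (\<Sum>j<f. y j))"
    using digits(2) by simp
  hence "n * (2 * (\<Sum>j<f. d j)) = n * (f * (p - 1))" unfolding y2 by (simp only: mult_ac)
  hence "2 * (\<Sum>j<f. d j) = f * (p - 1)" by (rule nat_mult_eq_cancel1[OF n, THEN iffD1])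
  thus ?thesis using digits(1) by blast
qed

section \<open>Characters as powers of the Teichmueller character, and purity\<close>

context finite_field_above
begin

lemma root_of_unity_as_\<omega>_power:
  assumes "w ^ n0 = 1" shows "\<exists>a. w = \<omega> g ^ a"
proof -
  have "(\<lambda>a. z ^ a) ` {..<n0} \<subseteq> {w. w ^ n0 = 1}"
    by clarify (metis power_mult mult.commute power_one z(1))
  moreover have "inj_on (\<lambda>a. z ^ a) {..<n0}"
    by (rule inj_onI) (simp add: z_pow_eq_iff)
  hence "card ((\<lambda>a. z ^ a) ` {..<n0}) = n0" by (simp add: card_image)
  moreover have "card {w::complex. w ^ n0 = 1} = n0" "finite {w::complex. w ^ n0 = 1}"
    using n0_ge_2 card_roots_unity_eq[of n0] finite_roots_unity[of n0] by auto
  ultimately have eq: "(\<lambda>a. z ^ a) ` {..<n0} = {w. w ^ n0 = 1}" by (intro card_subset_eq) auto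
  have "inverse w \<in> {w. w ^ n0 = 1}" using assms by (simp add: power_inverse)
  then obtain a where "inverse w = z ^ a" unfolding eq[symmetric] by blast
  hence "inverse (inverse w) = inverse z ^ a" by (simp add: power_inverse)
  moreover have "\<omega> g = inverse z" using \<tau>_g_pow[of 1] by (simp add: \<omega>_def)
  ultimately show ?thesis by auto
qed

lemma \<omega>_g_power_eq_1_iff: "\<omega> g ^ a = 1 \<longleftrightarrow> n0 dvd a"
proof -
  have "\<omega> g = inverse z" using \<tau>_g_pow[of 1] by (simp add: \<omega>_def)
  hence "\<omega> g ^ a = 1 \<longleftrightarrow> z ^ a = 1" by (simp add: power_inverse)
  also have "\<dots> \<longleftrightarrow> n0 dvd a" using z_pow_eq_1_imp[of a] z(1) by (auto simp: power_mult)
  finally show ?thesis .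
qed

text \<open>Ties the analytic root \<open>zeta n\<close> to the root \<open>\<omega> g\<close>
  chosen through \<open>V\<close>, so that characters with values in powers of \<open>zeta n\<close>
  become powers of \<open>\<omega>\<close>.\<close>

lemma zeta_as_\<omega>_power:
  assumes n: "n > 0" "n dvd n0"
  shows "\<exists>b. coprime b n \<and> zeta n = \<omega> g ^ (n0 div n * b)"
proof -
  obtain m where m: "n0 = n * m" using n by (elim dvdE)
  have m0: "m > 0" using m n0_ge_2 by (auto intro!: Nat.gr0I)
  have "zeta n ^ n0 = 1" using n by (simp add: zeta_power_eq_1_iff)
  then obtain a where a: "zeta n = \<omega> g ^ a" using root_of_unity_as_\<omega>_power by blast
  have "\<omega> g ^ (a * n) = 1" using n a by (metis power_mult zeta_power_eq_1_iff dvd_refl)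
  hence "n * m dvd n * a" by (simp add: \<omega>_g_power_eq_1_iff m mult.commute)
  hence "m dvd a" using n by simp
  then obtain b where b: "a = m * b" by (elim dvdE)
  have "coprime b n"
  proof (rule coprimeI)
    fix d assume d: "d dvd b" "d dvd n"
    then obtain b' n' where bn: "b = d * b'" "n = d * n'" by (elim dvdE)
    have "zeta n ^ n' = \<omega> g ^ (a * n')" unfolding a by (simp add: power_mult)
    also have "a * n' = n0 * b'" unfolding b bn(1) m by (subst bn(2)) simp
    also have "\<omega> g ^ (n0 * b') = 1" by (simp add: \<omega>_g_power_eq_1_iff)
    finally have "n dvd n'" using n by (simp add: zeta_power_eq_1_iff)
    hence "d * n' dvd 1 * n'" using bn(2) by simp
    moreover have "n' > 0" using bn(2) n by (auto intro!: Nat.gr0I)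
    ultimately show "is_unit d" by (simp only: nat_mult_dvd_cancel_disj dvd_times_right_cancel_iff)
  qed
  moreover have "n0 div n = m" using m n by simp
  ultimately show ?thesis using a b by auto
qed

lemma character_power:
  assumes \<eta>: "mult_character R \<eta>"
  shows "\<eta> (g [^] (i::nat)) = \<eta> g ^ i"
proof (induction i)
  case 0
  have "\<eta> (\<one> \<otimes> \<one>) = \<eta> \<one> * \<eta> \<one>" "\<eta> \<one> \<noteq> 0"
    using \<eta> one_U unfolding mult_character_def U_def by blast+
  thus ?case by simp
next
  case (Suc i)
  have "\<eta> (g [^] i \<otimes> g) = \<eta> (g [^] i) * \<eta> g"
    using \<eta> g(1) g_pow_U[of i] unfolding mult_character_def U_def by blast
  thus ?case using Suc by simp
qed

text \<open>As \<open>g\<close> generates \<open>U\<close>, the order of \<open>\<eta>\<close> is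
  that of the single number \<open>\<eta> g\<close>, a primitive \<open>n\<close>-th root of
  unity.\<close>

lemma character_generator:
  assumes \<eta>: "mult_character R \<eta>" and n: "character_order R \<eta> = n"
  shows "n > 0" "\<exists>c. coprime c n \<and> \<eta> g = zeta n ^ c"
proof -
  have all: "(\<forall>x\<in>carrier R - {\<zero>}. \<eta> x ^ k = 1) \<longleftrightarrow> \<eta> g ^ k = 1" for k
  proof
    assume "\<forall>x\<in>carrier R - {\<zero>}. \<eta> x ^ k = 1"
    thus "\<eta> g ^ k = 1" using g(1) by (auto simp: U_def)
  next
    assume k: "\<eta> g ^ k = 1"
    show "\<forall>x\<in>carrier R - {\<zero>}. \<eta> x ^ k = 1"
    proof
      fix x assume "x \<in> carrier R - {\<zero>}"
      then obtain i where "x = g [^] (i::nat)" using U_cases[of x] unfolding U_def by blast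
      hence "\<eta> x ^ k = (\<eta> g ^ k) ^ i" by (simp add: character_power[OF \<eta>] mult.commute flip: power_mult)
      thus "\<eta> x ^ k = 1" using k by simp
    qed
  qed
  have n': "n = (LEAST k. k > 0 \<and> \<eta> g ^ k = 1)" using n unfolding character_order_def all by simp
  have "\<eta> g ^ n0 = 1" using character_power[OF \<eta>, of n0] character_power[OF \<eta>, of 0] g(4) by simp
  hence "n0 > 0 \<and> \<eta> g ^ n0 = 1" using n0_ge_2 by simp
  hence least: "n > 0 \<and> \<eta> g ^ n = 1" unfolding n' by (rule LeastI)
  thus "n > 0" by simp
  obtain c where c: "\<eta> g = zeta n ^ c" using root_of_unity_as_zeta_power least by blast
  have "coprime c n"
  proof (rule coprimeI)
    fix d assume d: "d dvd c" "d dvd n"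
    then obtain c' n'' where cn: "c = d * c'" "n = d * n''" by (elim dvdE)
    have "c * n'' = n * c'" unfolding cn(1) by (subst cn(2)) simp
    hence "\<eta> g ^ n'' = zeta n ^ (n * c')" unfolding c by (simp flip: power_mult)
    hence "\<eta> g ^ n'' = 1" using least by (simp add: zeta_power_eq_1_iff)
    moreover have "n'' > 0" using cn(2) least by (auto intro!: Nat.gr0I)
    ultimately have "n \<le> n''" unfolding n' by (intro Least_le) simp
    hence "d * n'' \<le> 1 * n''" using cn(2) by simp
    moreover have "d > 0" using cn(2) least by (auto intro!: Nat.gr0I)
    ultimately show "is_unit d" using \<open>n'' > 0\<close> by simp
  qed
  thus "\<exists>c. coprime c n \<and> \<eta> g = zeta n ^ c" using c by blast
qed

text \<open>The Gauss sum is the value of an integer polynomial \<open>P\<close> at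
  \<open>zeta (p * n)\<close>. Its conjugates are sums \<open>G (m * b)\<close> for the roots
  \<open>zeta p ^ s\<close> with \<open>b\<close> prime to \<open>n\<close>. The digit sums put
  their squares divided by \<open>p ^ f\<close> into \<open>V\<close> and the norm formula puts them
  on the unit circle, so the Kronecker argument applies to \<open>P ^ 2\<close>.\<close>

theorem pure_gauss_sum_if_frac_orbit_zero:
  assumes n: "n > 1" "n dvd p ^ f - 1"
    and half: "\<And>b. coprime b n \<Longrightarrow> frac_orbit p f (real b / real n) = 0"
    and \<eta>: "mult_character R \<eta>" "character_order R \<eta> = n"
  shows "pure_gauss_sum R p f \<eta>"
proof -
  define m where "m = n0 div n"
  have nm: "n0 = n * m" using n by (simp add: m_def n0_def)
  obtain c where c: "coprime c n" "\<eta> g = zeta n ^ c" using character_generator[OF \<eta>] by blast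
  obtain b0 where b0: "coprime b0 n" "zeta n = \<omega> g ^ (m * b0)"
    using zeta_as_\<omega>_power[of n] n unfolding m_def n0_def by auto
  define k where "k = p * n"
  have k: "k > 1" using n(1) p_gt_1 unfolding k_def by (simp add: one_less_mult)
  have zp: "zeta k ^ n = zeta p" using zeta_mult_power[of n p] n(1) by (simp add: k_def mult.commute)
  have zn: "zeta k ^ p = zeta n" using zeta_mult_power[of p n] p_gt_1 by (simp add: k_def)
  \<comment> \<open>As \<open>zeta k ^ n = zeta p\<close> and \<open>zeta k ^ p = zeta n\<close>,
    the monomial for \<open>x\<close> takes at \<open>zeta k\<close> the value of the additive times
    the multiplicative character.\<close>
  define P where "P = (\<Sum>x\<in>U. Polynomial.monom (1::int) (n * t x + p * (c * dlog x)))"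
  have evc_sum: "evc (sum h A) w = (\<Sum>x\<in>A. evc (h x) w)" for h :: "'a \<Rightarrow> int poly" and A w
    by (induction A rule: infinite_finite_induct) (simp_all add: evc_add)
  have \<eta>x: "\<eta> x = zeta n ^ (c * dlog x)" if "x \<in> U" for x
    using character_power[OF \<eta>(1), of "dlog x"] g_dlog[OF that] c(2) by (simp add: power_mult)
  have P1: "evc P (zeta k ^ 1) = gauss_sum R p f \<eta>"
    unfolding P_def evc_sum gauss_sum_def U_def[symmetric]
    by (intro sum.cong refl) (simp add: evc_monom power_add power_mult zp zn \<eta>x t_def)
  have main: "norm (evc P (zeta k ^ s)) ^ 2 = real (p ^ f) \<and> evc P (zeta k ^ s) ^ 2 / of_nat (p ^ f) \<in> V"
    if s: "coprime s k" for s
  proof -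
    have s: "coprime s p" "coprime s n" using s by (auto simp: k_def)
    have "\<not> p dvd s" using s(1) p_gt_1 by (metis coprime_absorb_left coprime_commute nat_dvd_1_iff_1 not_less_iff_gr_or_eq)
    hence "zeta p ^ s \<noteq> 1" using p_gt_1 by (simp add: zeta_power_eq_1_iff)
    moreover have "(zeta p ^ s) ^ p = 1" using p_gt_1 by (simp add: zeta_power_eq_1_iff flip: power_mult)
    ultimately interpret E: gauss_sums p V R f "zeta p ^ s" by unfold_locales
    define b where "b = b0 * c * s"
    have b: "coprime b n" using b0 c s by (simp add: b_def)
    have PG: "evc P (zeta k ^ s) = E.G (m * b)"
      unfolding P_def evc_sum E.G_def
    proof (intro sum.cong refl)
      fix x assume x: "x \<in> U"
      have "\<omega> x = \<omega> g ^ dlog x"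
        using \<tau>_g_pow[of "dlog x"] \<tau>_g_pow[of 1] g_dlog[OF x] by (simp add: \<omega>_def power_inverse)
      hence "\<omega> x ^ (m * b) = (\<omega> g ^ (m * b0)) ^ (c * dlog x * s)"
        by (simp add: b_def mult_ac flip: power_mult)
      hence 1: "\<omega> x ^ (m * b) = zeta n ^ (c * dlog x * s)" unfolding b0(2) .
      have "(zeta k ^ s) ^ (n * t x + p * (c * dlog x)) = (zeta k ^ n) ^ (s * t x) * (zeta k ^ p) ^ (c * dlog x * s)"
        by (simp add: distrib_left mult_ac flip: power_mult power_add)
      also have "\<dots> = (zeta p ^ s) ^ t x * \<omega> x ^ (m * b)" unfolding zp zn 1 by (simp add: power_mult)
      finally show "evc (Polynomial.monom 1 (n * t x + p * (c * dlog x))) (zeta k ^ s) = E.\<Psi> x * \<omega> x ^ (m * b)"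
        by (simp add: evc_monom E.\<Psi>_def)
    qed
    have m0: "m > 0" using nm n0_ge_2 by (auto intro!: Nat.gr0I)
    have nd: "\<not> n0 dvd m * b"
    proof
      assume "n0 dvd m * b"
      hence "n dvd b" using m0 unfolding nm by (simp add: mult.commute)
      hence "is_unit n" using b by (metis coprime_absorb_left coprime_commute)
      thus False using n(1) by simp
    qed
    \<comment> \<open>The residue of \<open>- b\<close> modulo \<open>n\<close>, below
      \<open>n\<close> as \<open>digit_sum_half\<close> requires; its digits bound the complementary
      sum \<open>E.G (m * b')\<close>.\<close>
    define b' where "b' = (n - b mod n)"
    have bm: "b mod n \<noteq> 0" using b n(1) by (metis coprime_absorb_left coprime_commute mod_0_imp_dvd nat_dvd_1_iff_1 not_less_iff_gr_or_eq)
    have b'n: "b' < n" using bm n(1) by (simp add: b'_def)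
    have bb: "n dvd b + b'"
    proof -
      have "b + b' = n * (b div n) + n" unfolding b'_def using n(1)
        by (metis add.assoc add_diff_inverse_nat less_imp_le mod_less_divisor mult_div_mod_eq not_less order_less_trans zero_less_one)
      thus ?thesis by simp
    qed
    have "coprime b' n"
    proof (rule coprimeI)
      fix d assume d: "d dvd b'" "d dvd n"
      hence "d dvd b + b'" using bb by (meson dvd_trans)
      hence "d dvd b" using d(1) by (simp add: dvd_add_left_iff)
      thus "is_unit d" using d(2) b coprime_common_divisor by blast
    qed
    from half[OF this] obtain d
      where d: "(p ^ f - 1) div n * b' = (\<Sum>j<f. d j * p ^ (f - 1 - j))" "2 * (\<Sum>j<f. d j) = f * (p - 1)"
      using digit_sum_half[of n b' p f] n b'n p_gt_1 by auto
    have "E.bounded_by (\<Sum>j<f. d j) (\<Sum>j<f. d j * p ^ (f - 1 - j))"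
      by (rule E.bounded_by_digits) simp
    hence bnd: "E.bounded_by (\<Sum>j<f. d j) (m * b')" using d(1) unfolding m_def n0_def by simp
    have "n0 dvd m * b + m * b'" unfolding nm distrib_left[symmetric] mult.commute[of n m] by (rule mult_dvd_mono[OF dvd_refl bb])
    from E.G_square_div_V[OF nd this bnd d(2)] E.norm_G_square[OF nd] show ?thesis unfolding PG by simp
  qed
  \<comment> \<open>Squaring avoids the half-integral power of \<open>p\<close>, as the criterion
    has an integral power in the denominator.\<close>
  have "root_of_unity (evc (P ^ 2) (zeta k ^ 1) / of_nat (p ^ f))"
  proof (rule root_of_unity_criterion[OF k])
    fix s assume s: "coprime s k"
    show "evc (P ^ 2) (zeta k ^ s) / of_nat (p ^ f) \<in> V" using main[OF s] by (simp add: evc_power)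
    show "norm (evc (P ^ 2) (zeta k ^ s) / of_nat (p ^ f)) = 1"
      using main[OF s] p_gt_1 by (simp add: evc_power norm_divide norm_power)
  qed
  hence "root_of_unity (gauss_sum R p f \<eta> ^ 2 / of_nat (p ^ f))" unfolding evc_power P1 .
  then obtain N where N: "N > 0" "(gauss_sum R p f \<eta> ^ 2 / of_nat (p ^ f)) ^ N = 1"
    unfolding root_of_unity_def by blast
  have "(real p powr (- real f / 2)) ^ 2 = inverse (real (p ^ f))"
  proof -
    have "(real p powr (- real f / 2)) ^ 2 = real p powr (- real f)"
      by (simp add: power2_eq_square flip: powr_add)
    thus ?thesis using p_gt_1 by (simp add: powr_minus powr_realpow)
  qed
  hence "complex_of_real (real p powr (- real f / 2)) ^ 2 = inverse (of_nat (p ^ f))"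
    by (metis of_real_inverse of_real_of_nat_eq of_real_power)
  hence "(complex_of_real (real p powr (- real f / 2)) * gauss_sum R p f \<eta>) ^ 2
    = gauss_sum R p f \<eta> ^ 2 / of_nat (p ^ f)"
    by (simp add: power_mult_distrib field_simps)
  hence "(complex_of_real (real p powr (- real f / 2)) * gauss_sum R p f \<eta>) ^ (2 * N) = 1"
    unfolding power_mult using N(2) by simp
  moreover have "2 * N > 0" using N(1) by simp
  ultimately show ?thesis unfolding pure_gauss_sum_def root_of_unity_def by blast
qed

end

theorem pure_triples_if_frac_orbit_zero:
  assumes "Factorial_Ring.prime p" "odd p" "f > 0" "n > 1" "n dvd p ^ f - 1"
    and "\<And>b. coprime b n \<Longrightarrow> frac_orbit p f (real b / real n) = 0"
  shows "(n, f, p) \<in> pure_triples"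
  unfolding pure_triples_def
proof (intro CollectI case_prodI conjI allI impI)
  fix R :: "nat ring" and \<eta>
  assume R: "field R" "finite (carrier R)" "card (carrier R) = p ^ f"
    and \<eta>: "mult_character R \<eta>" "character_order R \<eta> = n"
  obtain V where "val_ring p V" using val_ring_exists[OF assms(1)] by blast
  then interpret finite_field_above p V R f
    using R assms(2) by (simp add: finite_field_above_def finite_field_above_axioms_def)
  show "pure_gauss_sum R p f \<eta>"
    by (rule pure_gauss_sum_if_frac_orbit_zero[OF assms(4,5,6) \<eta>])
qed (use assms in auto)

text \<open>The argument runs for each \<open>J\<close> containing 1, with \<open>M'\<close> the
  product over \<open>J - {1}\<close>. The congruences pass from \<open>M div m 1\<close> to its
  divisor \<open>M'\<close>, while \<open>f\<close> remains the order modulo \<open>N\<close>; the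
  case \<open>J = {1..r}\<close> is \<open>N\<close> itself.\<close>

theorem theorem4p6:
  fixes p r N M f :: nat and q u m fs :: "nat \<Rightarrow> nat"
  assumes "Factorial_Ring.prime p"
    and "r \<ge> 1"
    and "\<And>i. i \<in> {1..r} \<Longrightarrow> Factorial_Ring.prime (q i) \<and> odd (q i) \<and> u i \<ge> 1"
    and "inj_on q {1..r}"
    and "\<And>i. i \<in> {1..r} \<Longrightarrow> m i = q i ^ u i"
    and "M = (\<Prod>i\<in>{1..r}. m i)"
    and "N = 2 * M"
    and "coprime p N"
    and "\<And>i. i \<in> {1..r} \<Longrightarrow> fs i = ord (m i) p"
    and "f = ord N p"
    and "\<And>i. i \<in> {1..r} \<Longrightarrow> odd (fs i)"
    and "\<And>i. i \<in> {2..r} \<Longrightarrow> gcd (fs 1) (fs i) = 1"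
    and "real (totient (m 1)) / real (fs 1) = 2"
    and "in_powers_mod 2 p (m 1)"
    and "in_powers_mod (- 2) p (M div m 1)"
    and "in_powers_mod (int (q 1)) p (M div m 1)"
  shows "(N, f, p) \<in> pure_triples_star \<and> star_property r m f p"
proof -
  have one: "1 \<in> {1..r}" using assms(2) by simp
  have odd_p: "odd p" using assms(7,8) by simp
  have cop: "coprime (m i) (m j)" if "i \<in> {1..r}" "j \<in> {1..r}" "i \<noteq> j" for i j
  proof -
    have "q i \<noteq> q j" using assms(4) that by (simp add: inj_on_eq_iff)
    hence "coprime (q i) (q j)" using assms(3) that by (intro primes_coprime) auto
    thus ?thesis using assms(5) that by simp
  qed
  have odd_m: "odd (m i)" if "i \<in> {1..r}" for i using assms(3,5)[OF that] by simp
  have m1: "m 1 > 0" using odd_m[OF one] by (rule odd_pos)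
  have f_pos: "f > 0" using assms(8,10) by (simp add: coprime_commute)
  have "[p ^ f = 1] (mod N)" unfolding assms(10) by (rule ord)
  hence N_dvd: "N dvd p ^ f - 1" by (rule cong_to_1_nat)
  have M_div: "M div m 1 = (\<Prod>i\<in>{1..r} - {1}. m i)"
    unfolding assms(6) using one m1 by (subst prod.remove[of _ 1]) auto
  have fs1: "fs 1 > 0" using assms(13) by (cases "fs 1 = 0") auto
  hence "real (totient (m 1)) = real (2 * fs 1)" using assms(13) by (simp add: field_simps)
  hence index: "totient (m 1) = 2 * ord (m 1) p" using assms(9)[OF one] by (simp only: of_nat_eq_iff)
  have pure: "(2 * (\<Prod>i\<in>J. m i), f, p) \<in> pure_triples" if J: "J \<subseteq> {1..r}" "1 \<in> J" for J
  proof -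
    define M' where "M' = (\<Prod>i\<in>J - {1}. m i)"
    \<comment> \<open>The product of the orders is a period of \<open>p\<close> modulo
      \<open>M'\<close> that inherits coprimality to \<open>fs 1\<close> from its factors.\<close>
    define F where "F = (\<Prod>i\<in>J - {1}. fs i)"
    have fin: "finite J" using J(1) finite_subset by blast
    have J': "i \<in> {1..r}" "i \<noteq> 1" "i \<in> {2..r}" if "i \<in> J - {1}" for i using that J(1) by auto
    have prod: "(\<Prod>i\<in>J. m i) = m 1 * M'"
      unfolding M'_def by (rule prod.remove[OF fin J(2)])
    have "(\<Prod>i\<in>J. m i) dvd M" unfolding assms(6) by (rule prod_dvd_prod_subset) (use J in auto)
    hence n_dvd_N: "2 * m 1 * M' dvd N" unfolding prod assms(7) by simp
    have cop_n: "coprime p (2 * m 1 * M')"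
      by (rule coprime_divisors[OF dvd_refl n_dvd_N assms(8)])
    have M'_dvd: "M' dvd M div m 1"
      unfolding M_div M'_def by (rule prod_dvd_prod_subset) (use J in auto)
    have n_dvd: "2 * m 1 * M' dvd p ^ f - 1" by (rule dvd_trans[OF n_dvd_N N_dvd])
    have F1: "[p ^ F = 1] (mod M')"
      unfolding M'_def
    proof (rule coprime_cong_prod_nat)
      show "\<And>i j. i \<in> J - {1} \<Longrightarrow> j \<in> J - {1} \<Longrightarrow> i \<noteq> j \<Longrightarrow> coprime (m i) (m j)"
        using cop J' by blast
      fix i assume i: "i \<in> J - {1}"
      hence "fs i dvd F" unfolding F_def using fin by (intro dvd_prodI) auto
      thus "[p ^ F = 1] (mod m i)" unfolding ord_divides using assms(9) J'(1)[OF i] by simp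
    qed
    have F2: "coprime (ord (m 1) p) F"
      unfolding F_def assms(9)[OF one, symmetric]
    proof (rule prod_coprime_right)
      fix i assume "i \<in> J - {1}"
      from assms(12)[OF J'(3)[OF this]] show "coprime (fs 1) (fs i)"
        by (rule coprime_iff_gcd_eq_1[THEN iffD2])
    qed
    obtain e2 where e2: "[2 = int p ^ e2] (mod int (m 1))"
      using assms(14) unfolding in_powers_mod_def by blast
    obtain e3 where "[- 2 = int p ^ e3] (mod int (M div m 1))"
      using assms(15) unfolding in_powers_mod_def by blast
    hence e3: "[- 2 = int p ^ e3] (mod int M')"
      by (rule cong_dvd_modulus) (use M'_dvd in simp)
    obtain e4 where "[int (q 1) = int p ^ e4] (mod int (M div m 1))"
      using assms(16) unfolding in_powers_mod_def by blast
    hence e4: "[int (q 1) = int p ^ e4] (mod int M')"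
      by (rule cong_dvd_modulus) (use M'_dvd in simp)
    interpret two_blocks p f "q 1" "u 1" "m 1" M' F e2 e3 e4
    proof unfold_locales
      show "odd M'" unfolding M'_def using odd_m J' fin by (simp add: even_prod_iff)
      show "coprime (m 1) M'" unfolding M'_def
        by (rule prod_coprime_right) (use cop one J' in blast)
      show "m 1 * M' dvd p ^ f - 1" by (rule dvd_trans[OF _ n_dvd]) simp
      show "odd (ord (m 1) p)" using assms(9,11)[OF one] by simp
    qed (use assms(3,5)[OF one] cop_n odd_p index F1 F2 e2 e3 e4 in auto)
    have "(2 * m 1 * M', f, p) \<in> pure_triples"
    proof (rule pure_triples_if_frac_orbit_zero[OF assms(1) odd_p f_pos _ n_dvd frac_orbit_half])
      show "1 < 2 * m 1 * M'"
      proof -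
        have "0 < m 1 * M'" using m_gt_2 M_pos by simp
        thus ?thesis unfolding mult.assoc by linarith
      qed
    qed
    thus ?thesis by (simp add: prod mult.assoc)
  qed
  have "(N, f, p) \<in> pure_triples" using pure[of "{1..r}"] one unfolding assms(6,7) by simp
  thus ?thesis using pure assms(10) unfolding pure_triples_star_def star_property_def by auto
qed

end
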